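(* Let $M:\Omega_0\to 2^{\mathbb{R}}$. The following are equivalent. (A) $M$ is a local stationary random countable set. (B) There exists an $A\in\mathfrak{G}$ such that $M^A$ is countable $\mathsf{W}$-a.s. and such that $M=M^A$ $\mathsf{W}$-a.s.
   Context: $\Omega_0:=\{\omega:\mathbb{R}\to\mathbb{R}\text{ continuous},\ \omega(0)=0\}$ with the locally uniform topology and Borel $\sigma$-field $\mathcal{B}_{\Omega_0}$, canonical process $B=(B_t)_{t\in\mathbb{R}}$. $\mathsf{W}$ is the completed two-sided Wiener measure: $(B_t)_{t\ge0}$ and $(B_{-t})_{t\ge 0}$ are independent standard Brownian motions under $\mathsf{W}$; its domain $\mathcal{G}$ is the $\mathsf{W}$-completion of $\mathcal{B}_{\Omega_0}$. For extended-real $s<t$, $\mathcal{F}_{s,t}$ is the $\sigma$-field generated by the increments of $B$ between the times $s$ and $t$ and by all events of $\mathsf{W}$-probability $0$ or $1$. For $u\in\mathbb{R}$ the Lévy shift $\Delta_u:\Omega_0\to\Omega_0$ is $\Delta_u(\omega)(t):=\omega(u+t)-\omega(u)$. $\dagger\notin\mathbb{R}$ is a coffin state; $\mathbb{R}^\dagger:=\mathbb{R}\cup\{\dagger\}$ with the $\sigma$-field generated by the Borel sets of $\mathbb{R}$ and $\{\dagger\}$. For a sequence $s=(s_i)_{i\in\mathbb{N}}$ in $\mathbb{R}^\dagger$, $[s]:=\{s_i:i\in\mathbb{N}\}\setminus\{\dagger\}$. For a sub-$\sigma$-field $\mathcal{A}$ of $\mathcal{G}$, an $\mathcal{A}$-measurable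 enumeration of a map $M:\Omega_0\to2^{\mathbb{R}}$ is a sequence $S=(S_i)_{i\in\mathbb{N}}$ of $\mathcal{A}$-measurable $\mathbb{R}^\dagger$-valued random variables with $M=[S]$ $\mathsf{W}$-a.s. $M$ is a random countable set if it has a $\mathcal{G}$-measurable enumeration; it is then local if for all extended-real $s<t$ the set $M\cap(s,t)$ has an $\mathcal{F}_{s,t}$-measurable enumeration, and stationary if for every $u\in\mathbb{R}$, $M=u+M(\Delta_u)$ $\mathsf{W}$-a.s. For $A\subset\Omega_0$, $M^A:\Omega_0\to 2^{\mathbb{R}}$ is the visiting set $M^A(\omega):=\{t\in\mathbb{R}:\Delta_t(\omega)\in A\}$. $\mathfrak{G}:=\bigcap_{\epsilon\in(0,\infty)}\sigma(B|_{(-\epsilon,\epsilon)})\subset\mathcal{B}_{\Omega_0}$ (no completions) is the germ $\sigma$-field around zero. *)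

theory Defs
  imports "HOL-Probability.Probability"
begin

section \<open>The path space\<close>

definition Omega0 :: "(real \<Rightarrow> real) set" where
  "Omega0 = {\<omega>. continuous_on UNIV \<omega> \<and> \<omega> 0 = 0}"

text \<open>The generating sets are open for uniform convergence on compacts, since a continuous
  function that is smaller than \<open>e\<close> on a compact \<open>K\<close> is bounded away from \<open>e\<close> on \<open>K\<close>;
  they form a base of that topology.\<close>

definition locally_uniform_topology :: "(real \<Rightarrow> real) topology" where
  "locally_uniform_topology = topology_generated_by
     {{\<eta> \<in> Omega0. \<forall>t\<in>K. \<bar>\<eta> t - \<omega> t\<bar> < e} | \<omega> K e. \<omega> \<in> Omega0 \<and> compact K \<and> e > 0}"

definition borel_Omega0 :: "(real \<Rightarrow> real) measure" where
  "borel_Omega0 = sigma Omega0 {U. openin locally_uniform_topology U}"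

definition levy_shift :: "real \<Rightarrow> (real \<Rightarrow> real) \<Rightarrow> real \<Rightarrow> real" where
  "levy_shift u \<omega> = (\<lambda>t. \<omega> (u + t) - \<omega> u)"


section \<open>Two-sided Wiener measure\<close>

definition standard_brownian_motion :: "'a measure \<Rightarrow> (real \<Rightarrow> 'a \<Rightarrow> real) \<Rightarrow> bool" where
  "standard_brownian_motion P X \<longleftrightarrow>
     prob_space P \<and>
     (\<forall>t\<ge>0. X t \<in> borel_measurable P) \<and>
     (\<forall>\<omega>\<in>space P. X 0 \<omega> = 0 \<and> continuous_on {0..} (\<lambda>t. X t \<omega>)) \<and>
     (\<forall>s t. 0 \<le> s \<and> s < t \<longrightarrow>
        distributed P lborel (\<lambda>\<omega>. X t \<omega> - X s \<omega>) (normal_density 0 (sqrt (t - s)))) \<and>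
     (\<forall>(n::nat) \<tau>. 0 \<le> \<tau> 0 \<and> (\<forall>i<n. \<tau> i < \<tau> (Suc i)) \<longrightarrow>
        prob_space.indep_vars P (\<lambda>_. borel) (\<lambda>i \<omega>. X (\<tau> (Suc i)) \<omega> - X (\<tau> i) \<omega>) {..<n})"

text \<open>The canonical process is \<open>B t \<omega> = \<omega> t\<close>. The following determines \<open>P\<close> uniquely.\<close>

definition two_sided_wiener :: "(real \<Rightarrow> real) measure \<Rightarrow> bool" where
  "two_sided_wiener P \<longleftrightarrow>
     prob_space P \<and> sets P = sets borel_Omega0 \<and>
     standard_brownian_motion P (\<lambda>t \<omega>. \<omega> t) \<and>
     standard_brownian_motion P (\<lambda>t \<omega>. \<omega> (- t)) \<and>
     prob_space.indep_var P
       (Pi\<^sub>M {0..} (\<lambda>_. borel)) (\<lambda>\<omega>. \<lambda>t\<in>{0..}. \<omega> t)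
       (Pi\<^sub>M {0..} (\<lambda>_. borel)) (\<lambda>\<omega>. \<lambda>t\<in>{0..}. \<omega> (- t))"

definition completed_wiener :: "(real \<Rightarrow> real) measure \<Rightarrow> bool" where
  "completed_wiener W \<longleftrightarrow> (\<exists>P. two_sided_wiener P \<and> W = completion P)"

text \<open>Sub-\<open>\<sigma>\<close>-fields are represented by measure spaces of which only the measurable sets
  matter.\<close>

definition increment_field ::
  "(real \<Rightarrow> real) measure \<Rightarrow> ereal \<Rightarrow> ereal \<Rightarrow> (real \<Rightarrow> real) measure" where
  "increment_field W s t = sigma Omega0
     ({(\<lambda>\<omega>. \<omega> v - \<omega> u) -` E \<inter> Omega0 | u v E.
         s \<le> ereal u \<and> u \<le> v \<and> ereal v \<le> t \<and> E \<in> sets (borel :: real measure)} \<union>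
      {N \<in> sets W. measure W N = 0 \<or> measure W N = 1})"

text \<open>No completion takes place here.\<close>

definition germ_field :: "(real \<Rightarrow> real) set set" where
  "germ_field = (\<Inter>\<epsilon>\<in>{0<..}. sets (vimage_algebra Omega0
      (\<lambda>\<omega>. \<lambda>t\<in>{-\<epsilon><..<\<epsilon>}. \<omega> t) (Pi\<^sub>M {-\<epsilon><..<\<epsilon>} (\<lambda>_. borel :: real measure))))"


section \<open>Random countable sets\<close>

text \<open>The coffin state is \<^const>\<open>None\<close>.\<close>

definition borel_coffin :: "real option measure" where
  "borel_coffin = sigma UNIV ({Some ` E | E. E \<in> sets borel} \<union> {{None}})"

definition seq_set :: "(nat \<Rightarrow> real option) \<Rightarrow> real set" where
  "seq_set s = {x. Some x \<in> range s}"

definition measurable_enumeration ::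
  "(real \<Rightarrow> real) measure \<Rightarrow> (real \<Rightarrow> real) measure \<Rightarrow> ((real \<Rightarrow> real) \<Rightarrow> real set) \<Rightarrow>
   (nat \<Rightarrow> (real \<Rightarrow> real) \<Rightarrow> real option) \<Rightarrow> bool" where
  "measurable_enumeration W \<A> M S \<longleftrightarrow>
     (\<forall>i. S i \<in> measurable \<A> borel_coffin) \<and>
     (AE \<omega> in W. M \<omega> = seq_set (\<lambda>i. S i \<omega>))"

definition random_countable_set ::
  "(real \<Rightarrow> real) measure \<Rightarrow> ((real \<Rightarrow> real) \<Rightarrow> real set) \<Rightarrow> bool" where
  "random_countable_set W M \<longleftrightarrow> (\<exists>S. measurable_enumeration W W M S)"

definition local_set ::
  "(real \<Rightarrow> real) measure \<Rightarrow> ((real \<Rightarrow> real) \<Rightarrow> real set) \<Rightarrow> bool" where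
  "local_set W M \<longleftrightarrow> (\<forall>s t :: ereal. s < t \<longrightarrow>
     (\<exists>S. measurable_enumeration W (increment_field W s t)
        (\<lambda>\<omega>. M \<omega> \<inter> {x. s < ereal x \<and> ereal x < t}) S))"

definition stationary_set ::
  "(real \<Rightarrow> real) measure \<Rightarrow> ((real \<Rightarrow> real) \<Rightarrow> real set) \<Rightarrow> bool" where
  "stationary_set W M \<longleftrightarrow>
     (\<forall>u. AE \<omega> in W. M \<omega> = (\<lambda>x. u + x) ` M (levy_shift u \<omega>))"

definition visiting_set :: "(real \<Rightarrow> real) set \<Rightarrow> (real \<Rightarrow> real) \<Rightarrow> real set" where
  "visiting_set A \<omega> = {t. levy_shift t \<omega> \<in> A}"

end

theory Submission imports Defs begin

text \<open>
  For (B) to (A), the graph \<open>{(t, \<omega>). s < t < t', \<Delta>\<^sub>t \<omega> \<in> A}\<close> is measurable with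
  respect to the increments between \<open>s\<close> and \<open>t'\<close> because \<open>A\<close> is a germ event, so one needs
  that a measurable set with countable sections over a complete probability space is, up to a null
  set, a countable union of measurable graphs. After coding reals by sequences of naturals, such a
  set is the injective projection of one with closed sections in Baire space. Projections are
  measurable by Choquet's capacity argument, and among all countable unions of measurable graphs
  there is one whose complement has minimal projection on every cylinder; a point that it misses
  would, since countable closed sets have isolated points, yield one that is isolated among the
  missed points and hence a further graph. Stationarity is the shift invariance of Wiener measure.

  For (A) to (B), let \<open>D\<close> enumerate \<open>M \<inter> (-\<epsilon>, \<epsilon>)\<close> through the increments in \<open>[-\<epsilon>, \<epsilon>]\<close>, and let
  \<open>A\<^sub>\<epsilon>\<close> be the event that \<open>-u \<in> D (\<Delta>\<^sub>u \<omega>)\<close> for almost every \<open>u \<in> (-\<epsilon>, \<epsilon>)\<close>.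
  By stationarity and Fubini, almost surely \<open>\<Delta>\<^sub>t \<omega> \<in> A\<^sub>\<epsilon>\<close> if and only if \<open>t \<in> M \<omega>\<close>, for all
  \<open>t\<close> at once. The limit inferior of \<open>A\<^sub>\<epsilon>\<close> along \<open>\<epsilon> = 1/n\<close> is the required germ event.
\<close>

text \<open>The obstacle in (A) to (B) is that stationarity holds almost surely for each fixed
  shift, whereas a visiting set tests its event at uncountably many shifts of one path. A null event
  can be met by some shift of almost every path, as local maxima show, so the obvious candidate, the
  event that the enumeration finds 0, may fail. An event that asks for almost every \<open>u\<close>
  is insensitive to Lebesgue-null sets of shifts, and only such sets remain after Fubini.

  In (B) to (A) the enumeration theorem is applied to Wiener measure restricted to an increment
  field. That field contains all null events, so the restriction is complete and the enumeration is
  measurable with respect to the increments themselves. Injectivity of the projection matters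
  because countable sections have to stay countable in the closed set above, where closedness
  supplies isolated points. The minimal projection replaces a transfinite Cantor-Bendixson
  derivation by one exhaustion over countably many cylinders.\<close>

section \<open>Random closed sets in Baire space\<close>

text \<open>The sections of a clopen random set are clopen uniformly: membership depends on the first
  \<open>k\<close> coordinates only, with \<open>k\<close> not depending on \<open>\<omega>\<close>.\<close>

definition clopen_random :: "'a measure \<Rightarrow> ((nat \<Rightarrow> nat) \<times> 'a) set \<Rightarrow> bool" where
  "clopen_random N C \<longleftrightarrow>
     (\<exists>k. \<forall>x x' \<omega>. (\<forall>i<k. x i = x' i) \<longrightarrow> (x, \<omega>) \<in> C \<longrightarrow> (x', \<omega>) \<in> C) \<and>
     (\<forall>x. Pair x -` C \<in> sets N)"

text \<open>The stages \<open>K j\<close> keep measurability tied to finite information about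
  \<open>x\<close>: each of them amounts to countably many events, one for each finite sequence of
  naturals.\<close>

definition closed_random :: "'a measure \<Rightarrow> ((nat \<Rightarrow> nat) \<times> 'a) set \<Rightarrow> bool" where
  "closed_random N C \<longleftrightarrow> (\<exists>K. (\<forall>j::nat. clopen_random N (K j)) \<and> C = (\<Inter>j. K j))"

text \<open>This is uniform continuity for the usual metric of Baire space. Substituting such a map
  preserves the uniform bound demanded by \<open>clopen_random\<close>.\<close>

definition finitary :: "((nat \<Rightarrow> nat) \<Rightarrow> nat \<Rightarrow> nat) \<Rightarrow> bool" where
  "finitary \<phi> \<longleftrightarrow> (\<forall>n. \<exists>k. \<forall>x x'. (\<forall>i<k. x i = x' i) \<longrightarrow> \<phi> x n = \<phi> x' n)"

lemma finitary_uniform: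
  assumes "finitary \<phi>"
  shows "\<exists>k. \<forall>x x'. (\<forall>i<k. x i = x' i) \<longrightarrow> (\<forall>i<n. \<phi> x i = \<phi> x' i)"
proof -
  obtain k where k: "\<And>i x x'. (\<forall>j<k i. x j = x' j) \<Longrightarrow> \<phi> x i = \<phi> x' i"
    using assms unfolding finitary_def by metis
  have "k i \<le> sum k {..<n}" if "i < n" for i
    using that by (intro member_le_sum) auto
  then show ?thesis
    by (intro exI[of _ "sum k {..<n}"]) (meson k order_less_le_trans)
qed

lemma clopen_randomI:
  assumes "\<And>x x' \<omega>. (\<forall>i<k. x i = x' i) \<Longrightarrow> (x, \<omega>) \<in> C \<Longrightarrow> (x', \<omega>) \<in> C"
    and "\<And>x. Pair x -` C \<in> sets N"
  shows "clopen_random N C"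
  using assms unfolding clopen_random_def by blast

lemma clopen_random_space:
  assumes "clopen_random N C" "(x, \<omega>) \<in> C"
  shows "\<omega> \<in> space N"
proof -
  have "\<omega> \<in> Pair x -` C" "Pair x -` C \<in> sets N"
    using assms by (auto simp: clopen_random_def)
  then show ?thesis
    using sets.sets_into_space by blast
qed

lemma closed_random_space:
  assumes "closed_random N C" "(x, \<omega>) \<in> C"
  shows "\<omega> \<in> space N"
  using assms clopen_random_space by (force simp: closed_random_def)

lemma clopen_random_vimage:
  assumes "clopen_random N C" "finitary \<phi>"
  shows "clopen_random N {(x, \<omega>). (\<phi> x, \<omega>) \<in> C}"
proof -
  obtain n where n: "\<And>x x' \<omega>. (\<forall>i<n. x i = x' i) \<Longrightarrow> (x, \<omega>) \<in> C \<Longrightarrow> (x', \<omega>) \<in> C"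
    and m: "\<And>x. Pair x -` C \<in> sets N"
    using assms(1) unfolding clopen_random_def by blast
  obtain k where k: "\<And>x x'. (\<forall>i<k. x i = x' i) \<Longrightarrow> (\<forall>i<n. \<phi> x i = \<phi> x' i)"
    using finitary_uniform[OF assms(2), of n] by blast
  show ?thesis
  proof (rule clopen_randomI[where k=k])
    fix x x' \<omega> assume "\<forall>i<k. x i = x' i" "(x, \<omega>) \<in> {(x, \<omega>). (\<phi> x, \<omega>) \<in> C}"
    then show "(x', \<omega>) \<in> {(x, \<omega>). (\<phi> x, \<omega>) \<in> C}"
      using n[OF k] by (simp only: mem_Collect_eq split_conv)
  next
    fix x
    show "Pair x -` {(x, \<omega>). (\<phi> x, \<omega>) \<in> C} \<in> sets N"
      using m[of "\<phi> x"] by (simp add: vimage_def)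
  qed
qed

lemma clopen_random_Int:
  assumes "clopen_random N C" "clopen_random N C'"
  shows "clopen_random N (C \<inter> C')"
proof -
  obtain n where n: "\<And>x x' \<omega>. (\<forall>i<n. x i = x' i) \<Longrightarrow> (x, \<omega>) \<in> C \<Longrightarrow> (x', \<omega>) \<in> C"
    and m: "\<And>x. Pair x -` C \<in> sets N"
    using assms(1) unfolding clopen_random_def by blast
  obtain n' where n': "\<And>x x' \<omega>. (\<forall>i<n'. x i = x' i) \<Longrightarrow> (x, \<omega>) \<in> C' \<Longrightarrow> (x', \<omega>) \<in> C'"
    and m': "\<And>x. Pair x -` C' \<in> sets N"
    using assms(2) unfolding clopen_random_def by blast
  show ?thesis
  proof (rule clopen_randomI[where k="max n n'"])
    fix x x' \<omega> assume "\<forall>i<max n n'. x i = x' i" "(x, \<omega>) \<in> C \<inter> C'"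
    then show "(x', \<omega>) \<in> C \<inter> C'"
      using n[of x x' \<omega>] n'[of x x' \<omega>] by auto
  qed (use m m' in auto)
qed

lemma clopen_random_Compl:
  assumes "clopen_random N C"
  shows "clopen_random N (UNIV \<times> space N - C)"
proof -
  obtain n where n: "\<And>x x' \<omega>. (\<forall>i<n. x i = x' i) \<Longrightarrow> (x, \<omega>) \<in> C \<Longrightarrow> (x', \<omega>) \<in> C"
    and m: "\<And>x. Pair x -` C \<in> sets N"
    using assms(1) unfolding clopen_random_def by blast
  show ?thesis
  proof (rule clopen_randomI[where k=n])
    fix x x' \<omega> assume "\<forall>i<n. x i = x' i" "(x, \<omega>) \<in> UNIV \<times> space N - C"
    then show "(x', \<omega>) \<in> UNIV \<times> space N - C"
      using n[of x' x \<omega>] by auto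
  next
    fix x
    have "Pair x -` (UNIV \<times> space N - C) = space N - Pair x -` C"
      by auto
    then show "Pair x -` (UNIV \<times> space N - C) \<in> sets N"
      using m by auto
  qed
qed

lemma clopen_random_depends:
  assumes "finitary \<phi>"
  shows "clopen_random N {(x, \<omega>). \<omega> \<in> space N \<and> \<phi> x n = m}"
proof -
  obtain k where k: "\<And>x x'. (\<forall>i<k. x i = x' i) \<Longrightarrow> \<phi> x n = \<phi> x' n"
    using assms unfolding finitary_def by blast
  show ?thesis
  proof (rule clopen_randomI[where k=k])
    fix x x' :: "nat \<Rightarrow> nat" and \<omega>
    assume "\<forall>i<k. x i = x' i" "(x, \<omega>) \<in> {(x, \<omega>). \<omega> \<in> space N \<and> \<phi> x n = m}"
    then show "(x', \<omega>) \<in> {(x, \<omega>). \<omega> \<in> space N \<and> \<phi> x n = m}"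
      using k[of x x'] by auto
  qed (auto simp: vimage_def)
qed

lemma closed_random_clopen: "clopen_random N C \<Longrightarrow> closed_random N C"
  unfolding closed_random_def by (intro exI[of _ "\<lambda>_. C"]) auto

lemma closed_random_vimage:
  assumes "closed_random N C" "finitary \<phi>"
  shows "closed_random N {(x, \<omega>). (\<phi> x, \<omega>) \<in> C}"
proof -
  obtain K where K: "\<And>j::nat. clopen_random N (K j)" "C = (\<Inter>j. K j)"
    using assms(1) unfolding closed_random_def by blast
  show ?thesis
    unfolding closed_random_def using K clopen_random_vimage[OF _ assms(2)]
    by (intro exI[of _ "\<lambda>j. {(x, \<omega>). (\<phi> x, \<omega>) \<in> K j}"]) auto
qed

lemma closed_random_INT:
  assumes "\<And>i::nat. closed_random N (C i)"
  shows "closed_random N (\<Inter>i. C i)"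
proof -
  obtain K where K: "\<And>i j::nat. clopen_random N (K i j)" "\<And>i. C i = (\<Inter>j. K i j)"
    using assms unfolding closed_random_def by metis
  show ?thesis
    unfolding closed_random_def
  proof (intro exI[of _ "\<lambda>n. K (fst (prod_decode n)) (snd (prod_decode n))"] conjI allI K)
    show "(\<Inter>i. C i) = (\<Inter>n. K (fst (prod_decode n)) (snd (prod_decode n)))"
    proof (rule set_eqI)
      fix p
      have "(\<forall>n. p \<in> K (fst (prod_decode n)) (snd (prod_decode n))) \<longleftrightarrow> (\<forall>i j. p \<in> K i j)"
        by (metis fst_conv snd_conv prod_encode_inverse)
      then show "p \<in> (\<Inter>i. C i) \<longleftrightarrow> p \<in> (\<Inter>n. K (fst (prod_decode n)) (snd (prod_decode n)))"
        by (simp add: K)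
    qed
  qed
qed

lemma closed_random_Int:
  assumes "closed_random N C" "closed_random N C'"
  shows "closed_random N (C \<inter> C')"
proof -
  have "C \<inter> C' = (\<Inter>i::nat. if i = 0 then C else C')"
    by (auto split: if_splits)
  then show ?thesis
    using closed_random_INT[of N "\<lambda>i. if i = 0 then C else C'"] assms by (simp split: if_splits)
qed

text \<open>A union of a closed set with a clopen one is closed. Intersected over all
  \<open>m\<close>, these implications glue countably many closed sets along the clopen partition
  given by one coordinate.\<close>

lemma closed_random_imp:
  assumes "closed_random N C" "finitary \<phi>"
  shows "closed_random N {(x, \<omega>). \<omega> \<in> space N \<and> (\<phi> x n = m \<longrightarrow> (x, \<omega>) \<in> C)}"
proof -
  obtain K where K: "\<And>j::nat. clopen_random N (K j)" "C = (\<Inter>j. K j)"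
    using assms(1) unfolding closed_random_def by blast
  let ?E = "{(x, \<omega>). \<omega> \<in> space N \<and> \<phi> x n = m}"
  let ?K = "\<lambda>j. UNIV \<times> space N - (?E \<inter> (UNIV \<times> space N - K j))"
  have "clopen_random N (?K j)" for j
    by (intro clopen_random_Compl clopen_random_Int clopen_random_depends assms K)
  moreover have "{(x, \<omega>). \<omega> \<in> space N \<and> (\<phi> x n = m \<longrightarrow> (x, \<omega>) \<in> C)} = (\<Inter>j. ?K j)"
    by (auto simp: K)
  ultimately show ?thesis
    unfolding closed_random_def by (intro exI[of _ ?K]) auto
qed

text \<open>Pairing coordinate by coordinate identifies the square of Baire space with Baire space
  in such a way that both projections are finitary.\<close>

definition pair_seq :: "(nat \<Rightarrow> nat) \<Rightarrow> (nat \<Rightarrow> nat) \<Rightarrow> nat \<Rightarrow> nat" where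
  "pair_seq y x = (\<lambda>n. prod_encode (y n, x n))"

definition fst_seq :: "(nat \<Rightarrow> nat) \<Rightarrow> nat \<Rightarrow> nat" where
  "fst_seq z = (\<lambda>n. fst (prod_decode (z n)))"

definition snd_seq :: "(nat \<Rightarrow> nat) \<Rightarrow> nat \<Rightarrow> nat" where
  "snd_seq z = (\<lambda>n. snd (prod_decode (z n)))"

lemma fst_pair_seq [simp]: "fst_seq (pair_seq y x) = y"
  and snd_pair_seq [simp]: "snd_seq (pair_seq y x) = x"
  and pair_fst_snd_seq [simp]: "pair_seq (fst_seq z) (snd_seq z) = z"
  by (simp_all add: fst_seq_def snd_seq_def pair_seq_def)

lemma finitaryI:
  assumes "\<And>n. \<exists>f m m'. \<forall>x. \<phi> x n = f (x m) (x m')"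
  shows "finitary \<phi>"
  unfolding finitary_def
proof
  fix n
  obtain f m m' where "\<And>x. \<phi> x n = f (x m) (x m')"
    using assms by blast
  then show "\<exists>k. \<forall>x x'. (\<forall>i<k. x i = x' i) \<longrightarrow> \<phi> x n = \<phi> x' n"
    by (intro exI[of _ "Suc (max m m')"]) simp
qed

lemma finitary_fst_seq: "finitary fst_seq" and finitary_snd_seq: "finitary snd_seq"
  by (rule finitaryI, force simp: fst_seq_def snd_seq_def)+

text \<open>The analogue of the classical fact that a Borel set is an injective continuous image of
  a closed subset of Baire space. Uniqueness of the witness \<open>x\<close> puts the sections of
  \<open>C\<close> in bijection with those of \<open>D\<close>, so that countability is
  inherited.\<close>

definition unique_projection :: "'a measure \<Rightarrow> ((nat \<Rightarrow> nat) \<times> 'a) set \<Rightarrow> bool" where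
  "unique_projection N D \<longleftrightarrow> (\<exists>C. closed_random N C \<and>
     (\<forall>y \<omega>. (y, \<omega>) \<in> D \<longleftrightarrow> (\<exists>x. (pair_seq y x, \<omega>) \<in> C)) \<and>
     (\<forall>y x x' \<omega>. (pair_seq y x, \<omega>) \<in> C \<longrightarrow> (pair_seq y x', \<omega>) \<in> C \<longrightarrow> x = x'))"

lemma unique_projection_clopen:
  assumes "clopen_random N D"
  shows "unique_projection N D"
proof -
  \<comment> \<open>No witness is called for, so it is pinned to the zero sequence to make it
    unique.\<close>
  define C where "C = {(z, \<omega>). (fst_seq z, \<omega>) \<in> D} \<inter> (\<Inter>n. {(z, \<omega>). \<omega> \<in> space N \<and> snd_seq z n = 0})"
  have "closed_random N C"
    unfolding C_def
    by (intro closed_random_Int closed_random_INT closed_random_clopen clopen_random_vimage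
        clopen_random_depends assms finitary_fst_seq finitary_snd_seq)
  moreover have "(pair_seq y x, \<omega>) \<in> C \<longleftrightarrow> (y, \<omega>) \<in> D \<and> x = (\<lambda>_. 0)" for y x \<omega>
    using clopen_random_space[OF assms, of y \<omega>] by (auto simp: C_def)
  ultimately show ?thesis
    unfolding unique_projection_def by (intro exI[of _ C]) simp
qed

text \<open>One sequence carries the witnesses for all \<open>D i\<close> as the rows of a matrix
  indexed through \<open>prod_encode\<close>. Each row is unique, hence so is the whole
  sequence.\<close>

lemma unique_projection_INT:
  assumes "\<And>i::nat. unique_projection N (D i)"
  shows "unique_projection N (\<Inter>i. D i)"
proof -
  obtain C where C: "\<And>i. closed_random N (C i)"
    "\<And>i y \<omega>. (y, \<omega>) \<in> D i \<longleftrightarrow> (\<exists>x. (pair_seq y x, \<omega>) \<in> C i)"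
    "\<And>i y x x' \<omega>. (pair_seq y x, \<omega>) \<in> C i \<Longrightarrow> (pair_seq y x', \<omega>) \<in> C i \<Longrightarrow> x = x'"
    using assms unfolding unique_projection_def by metis
  define \<phi> where "\<phi> i z = pair_seq (fst_seq z) (\<lambda>m. snd_seq z (prod_encode (i, m)))" for i z
  have \<phi>: "finitary (\<phi> i)" for i
    by (rule finitaryI) (force simp: \<phi>_def fst_seq_def snd_seq_def pair_seq_def)
  let ?C = "\<Inter>i. {(z, \<omega>). (\<phi> i z, \<omega>) \<in> C i}"
  have C': "closed_random N ?C"
    by (intro closed_random_INT closed_random_vimage C \<phi>)
  have *: "(pair_seq y x, \<omega>) \<in> ?C \<longleftrightarrow>
      (\<forall>i. (pair_seq y (\<lambda>m. x (prod_encode (i, m))), \<omega>) \<in> C i)" for y x \<omega>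
    by (simp add: \<phi>_def)
  show ?thesis
    unfolding unique_projection_def
  proof (intro exI[of _ ?C] conjI allI impI C')
    fix y \<omega>
    show "(y, \<omega>) \<in> (\<Inter>i. D i) \<longleftrightarrow> (\<exists>x. (pair_seq y x, \<omega>) \<in> ?C)"
    proof
      assume "(y, \<omega>) \<in> (\<Inter>i. D i)"
      then obtain X where "\<And>i. (pair_seq y (X i), \<omega>) \<in> C i"
        using C(2) by (metis INT_E UNIV_I)
      then have "(pair_seq y (\<lambda>n. X (fst (prod_decode n)) (snd (prod_decode n))), \<omega>) \<in> ?C"
        unfolding * by simp
      then show "\<exists>x. (pair_seq y x, \<omega>) \<in> ?C" by blast
    next
      assume "\<exists>x. (pair_seq y x, \<omega>) \<in> ?C"
      then show "(y, \<omega>) \<in> (\<Inter>i. D i)"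
        unfolding * using C(2) by blast
    qed
  next
    fix y x x' \<omega> assume "(pair_seq y x, \<omega>) \<in> ?C" "(pair_seq y x', \<omega>) \<in> ?C"
    then have "(\<lambda>m. x (prod_encode (i, m))) = (\<lambda>m. x' (prod_encode (i, m)))" for i
      unfolding * using C(3) by blast
    then have "x (prod_encode p) = x' (prod_encode p)" for p
      by (cases p) metis
    then show "x = x'"
      by (metis ext prod_decode_inverse)
  qed
qed

text \<open>The first coordinate of the witness names the index \<open>i\<close>, the remaining ones
  form a witness for \<open>D i\<close>. Disjointness is what makes the index, and with it the
  witness, unique.\<close>

lemma unique_projection_UN_disjoint:
  assumes "\<And>i::nat. unique_projection N (D i)" "disjoint_family D"
  shows "unique_projection N (\<Union>i. D i)"
proof -
  obtain C where C: "\<And>i. closed_random N (C i)"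
    "\<And>i y \<omega>. (y, \<omega>) \<in> D i \<longleftrightarrow> (\<exists>x. (pair_seq y x, \<omega>) \<in> C i)"
    "\<And>i y x x' \<omega>. (pair_seq y x, \<omega>) \<in> C i \<Longrightarrow> (pair_seq y x', \<omega>) \<in> C i \<Longrightarrow> x = x'"
    using assms(1) unfolding unique_projection_def by metis
  define \<psi> where "\<psi> z = pair_seq (fst_seq z) (\<lambda>m. snd_seq z (Suc m))" for z
  have \<psi>: "finitary \<psi>"
    by (rule finitaryI) (force simp: \<psi>_def fst_seq_def snd_seq_def pair_seq_def)
  let ?C = "\<Inter>i. {(z, \<omega>). \<omega> \<in> space N \<and> (snd_seq z 0 = i \<longrightarrow> (z, \<omega>) \<in> {(z, \<omega>). (\<psi> z, \<omega>) \<in> C i})}"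
  have C': "closed_random N ?C"
    by (intro closed_random_INT closed_random_imp closed_random_vimage C \<psi> finitary_snd_seq)
  have *: "(pair_seq y x, \<omega>) \<in> ?C \<longleftrightarrow> (pair_seq y (\<lambda>m. x (Suc m)), \<omega>) \<in> C (x 0)" for y x \<omega>
    using closed_random_space[OF C(1)] by (auto simp: \<psi>_def)
  show ?thesis
    unfolding unique_projection_def
  proof (intro exI[of _ ?C] conjI allI impI C')
    fix y \<omega>
    show "(y, \<omega>) \<in> (\<Union>i. D i) \<longleftrightarrow> (\<exists>x. (pair_seq y x, \<omega>) \<in> ?C)"
    proof
      assume "(y, \<omega>) \<in> (\<Union>i. D i)"
      then obtain i x where "(pair_seq y x, \<omega>) \<in> C i"
        using C(2) by blast
      then have "(pair_seq y (case_nat i x), \<omega>) \<in> ?C"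
        unfolding * by simp
      then show "\<exists>x. (pair_seq y x, \<omega>) \<in> ?C" by blast
    next
      assume "\<exists>x. (pair_seq y x, \<omega>) \<in> ?C"
      then show "(y, \<omega>) \<in> (\<Union>i. D i)"
        unfolding * using C(2) by blast
    qed
  next
    fix y x x' \<omega> assume **: "(pair_seq y x, \<omega>) \<in> ?C" "(pair_seq y x', \<omega>) \<in> ?C"
    then have "(y, \<omega>) \<in> D (x 0)" "(y, \<omega>) \<in> D (x' 0)"
      unfolding * using C(2) by blast+
    then have 0: "x 0 = x' 0"
      using assms(2) by (auto simp: disjoint_family_on_def)
    then have S: "(\<lambda>m. x (Suc m)) = (\<lambda>m. x' (Suc m))"
      using ** unfolding * using C(3) by metis
    show "x = x'"
    proof
      fix n show "x n = x' n"
        using 0 fun_cong[OF S] by (cases n) auto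
    qed
  qed
qed

text \<open>This is the product of the Borel \<sigma>-field of Baire space with \<open>N\<close>,
  presented by generators at which an induction can start.\<close>

definition baire_product :: "'a measure \<Rightarrow> ((nat \<Rightarrow> nat) \<times> 'a) measure" where
  "baire_product N = sigma (UNIV \<times> space N) {C. clopen_random N C}"

lemma clopen_random_subset: "{C. clopen_random N C} \<subseteq> Pow (UNIV \<times> space N)"
  using clopen_random_space by fastforce

lemma space_baire_product [simp]: "space (baire_product N) = UNIV \<times> space N"
  by (simp add: baire_product_def clopen_random_subset)

lemma sets_baire_product:
  "sets (baire_product N) = sigma_sets (UNIV \<times> space N) {C. clopen_random N C}"
  by (simp add: baire_product_def clopen_random_subset)

lemma sets_baire_product_clopen [intro]: "clopen_random N C \<Longrightarrow> C \<in> sets (baire_product N)"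
  by (auto simp: sets_baire_product)

lemma sets_baire_product_closed:
  assumes "closed_random N C"
  shows "C \<in> sets (baire_product N)"
  using assms by (auto simp: closed_random_def)

lemma unique_projection_Int:
  assumes "unique_projection N D" "unique_projection N D'"
  shows "unique_projection N (D \<inter> D')"
proof -
  have "D \<inter> D' = (\<Inter>i::nat. if i = 0 then D else D')"
    by (auto split: if_splits)
  then show ?thesis
    using unique_projection_INT[of N "\<lambda>i. if i = 0 then D else D'"] assms by (simp split: if_splits)
qed

text \<open>Carrying the complement along in the induction makes the class closed under
  countable unions: these can then be made disjoint.\<close>

lemma unique_projection_baire_product:
  assumes "D \<in> sets (baire_product N)"
  shows "unique_projection N D"
proof -
  let ?\<Omega> = "UNIV \<times> space N"
  have "unique_projection N D \<and> unique_projection N (?\<Omega> - D)"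
    using assms unfolding sets_baire_product
  proof (induction rule: sigma_sets.induct)
    case (Basic D)
    then show ?case
      using unique_projection_clopen clopen_random_Compl by blast
  next
    case Empty
    have "clopen_random N {}"
      by (rule clopen_randomI) auto
    then show ?case
      using unique_projection_clopen clopen_random_Compl by blast
  next
    case (Compl D)
    then have "?\<Omega> - (?\<Omega> - D) = D"
      using sigma_sets_into_sp[OF clopen_random_subset] by blast
    then show ?case
      using Compl by simp
  next
    case (Union D)
    have sub: "D i \<subseteq> ?\<Omega>" for i
      using Union(1) sigma_sets_into_sp[OF clopen_random_subset] by blast
    have D: "?\<Omega> - (\<Union>i. D i) = (\<Inter>i. ?\<Omega> - D i)"
      by auto
    have "unique_projection N (?\<Omega> - (\<Union>i. D i))"
      unfolding D by (intro unique_projection_INT) (use Union.IH in blast)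
    moreover have "unique_projection N (\<Union>i. D i)"
    proof -
      \<comment> \<open>Each disjointed set is a finite intersection of \<open>D n\<close> with
        complements, and the induction hypothesis covers all of these.\<close>
      have fin: "unique_projection N (D n \<inter> (\<Inter>i<k. ?\<Omega> - D i))" for n k
      proof (induction k)
        case (Suc k)
        have "D n \<inter> (\<Inter>i<Suc k. ?\<Omega> - D i) = (D n \<inter> (\<Inter>i<k. ?\<Omega> - D i)) \<inter> (?\<Omega> - D k)"
          by (auto simp: less_Suc_eq)
        then show ?case
          using Suc Union.IH by (metis unique_projection_Int)
      qed (use Union.IH in simp)
      have "disjointed D n = D n \<inter> (\<Inter>i<n. ?\<Omega> - D i)" for n
        using sub[of n] by (auto simp: disjointed_def)
      then have "unique_projection N (\<Union>n. disjointed D n)"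
        using fin by (intro unique_projection_UN_disjoint disjoint_family_disjointed) simp
      then show ?thesis
        by (simp add: UN_disjointed_eq)
    qed
    ultimately show ?case by blast
  qed
  then show ?thesis ..
qed


section \<open>Measurable projection\<close>

text \<open>Tychonoff's theorem for a product of finite discrete spaces.\<close>

lemma compact_bounded_seqs: "compact {x. \<forall>i. x i \<le> b i}" for b :: "nat \<Rightarrow> nat"
proof -
  have "compactin (product_topology (\<lambda>i. euclidean) UNIV) (Pi\<^sub>E UNIV (\<lambda>i. {..b i}))"
    by (subst compactin_PiE) (simp add: finite_imp_compact)
  moreover have "Pi\<^sub>E UNIV (\<lambda>i. {..b i}) = {x. \<forall>i. x i \<le> b i}"
    by (auto simp: PiE_iff)
  ultimately show ?thesis
    by (simp add: euclidean_product_topology)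
qed

lemma open_finitely_determined:
  fixes S :: "(nat \<Rightarrow> nat) set"
  assumes "\<And>x x'. (\<forall>i<k. x i = x' i) \<Longrightarrow> x \<in> S \<Longrightarrow> x' \<in> S"
  shows "open S"
proof (subst open_subopen, intro ballI)
  fix x assume "x \<in> S"
  have "open {f. \<forall>i\<in>{..<k}. f i \<in> {x i}}"
    by (rule product_topology_basis') (simp_all add: discrete_topology_class.open_discrete)
  moreover have "{f. \<forall>i\<in>{..<k}. f i \<in> {x i}} \<subseteq> S"
    using assms[OF _ \<open>x \<in> S\<close>] by auto
  ultimately show "\<exists>T. open T \<and> x \<in> T \<and> T \<subseteq> S"
    by (intro exI conjI) auto
qed

lemma closed_clopen_random_section:
  assumes "clopen_random N C"
  shows "closed {x. (x, \<omega>) \<in> C}"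
proof -
  obtain k where k: "\<And>x x' \<omega>. (\<forall>i<k. x i = x' i) \<Longrightarrow> (x, \<omega>) \<in> C \<Longrightarrow> (x', \<omega>) \<in> C"
    using assms unfolding clopen_random_def by blast
  have "open (- {x. (x, \<omega>) \<in> C})"
  proof (rule open_finitely_determined)
    fix x x' :: "nat \<Rightarrow> nat"
    assume "\<forall>i<k. x i = x' i" "x \<in> - {x. (x, \<omega>) \<in> C}"
    then show "x' \<in> - {x. (x, \<omega>) \<in> C}"
      using k[of x' x \<omega>] by auto
  qed
  then show ?thesis
    by (simp add: closed_def)
qed

text \<open>This is Choquet's capacitability argument: bounding the coordinates one after the other
  loses arbitrarily little outer measure, and over the resulting compact set of sequences the
  projection commutes with countable decreasing intersections.\<close>

lemma closed_random_inner_projection: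
  assumes "finite_measure N" "closed_random N C" "c < outer_measure_of N (snd ` C)"
  shows "\<exists>E\<in>sets N. E \<subseteq> snd ` C \<and> c \<le> emeasure N E"
proof -
  interpret finite_measure N by fact
  obtain K where K: "\<And>j::nat. clopen_random N (K j)" "C = (\<Inter>j. K j)"
    using assms(2) unfolding closed_random_def by blast
  \<comment> \<open>Partial intersections decrease, so that the events \<open>G n\<close> below
    decrease and continuity from above applies.\<close>
  define L where "L n = (\<Inter>j\<le>n. K j)" for n
  have L: "clopen_random N (L n)" for n
  proof (induction n)
    case 0
    then show ?case by (simp add: L_def K)
  next
    case (Suc n)
    then show ?case
      using clopen_random_Int[OF Suc K(1)[of "Suc n"]] by (simp add: L_def atMost_Suc Int_commute)
  qed
  have LC: "C = (\<Inter>n. L n)"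
    by (auto simp: K L_def)
  have L_dec: "L m \<subseteq> L n" if "n \<le> m" for n m
    using that by (auto simp: L_def)
  \<comment> \<open>Only the first \<open>n\<close> coordinates are bounded here. Nothing is known
    yet about measurability of this projection, whence the outer measure.\<close>
  define H where "H b n = {\<omega>. \<exists>x. (\<forall>i<n. x i \<le> b i) \<and> (x, \<omega>) \<in> C}" for b :: "nat \<Rightarrow> nat" and n :: nat
  have H_space: "H b n \<subseteq> space N" for b n
    using closed_random_space[OF assms(2)] by (auto simp: H_def)
  have H_cong: "H b n = H b' n" if "\<And>i. i < n \<Longrightarrow> b i = b' i" for b b' n
    using that by (auto simp: H_def)
  \<comment> \<open>As the bound on coordinate \<open>n\<close> grows, the sets exhaust
    \<open>H \<beta> n\<close>. Outer measure is continuous along increasing sequences of arbitrary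
    sets, so some finite bound keeps the strict inequality.\<close>
  have "\<exists>\<beta>. \<forall>n. c < outer_measure_of N (H (\<beta> n) n) \<and> (\<exists>m. \<beta> (Suc n) = (\<beta> n)(n := m))"
  proof (rule dependent_nat_choice)
    have "H b 0 = snd ` C" for b
      by (force simp: H_def)
    then show "\<exists>\<beta>. c < outer_measure_of N (H \<beta> 0)"
      using assms(3) by simp
  next
    fix \<beta> n assume c: "c < outer_measure_of N (H \<beta> n)"
    let ?H = "\<lambda>m. H (\<beta>(n := m)) (Suc n)"
    have upd: "(\<forall>i<Suc n. x i \<le> (\<beta>(n := m)) i) \<longleftrightarrow> (\<forall>i<n. x i \<le> \<beta> i) \<and> x n \<le> m" for x m
      by (auto simp: All_less_Suc)
    have "H \<beta> n = (\<Union>m. ?H m)"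
      unfolding H_def upd by auto
    moreover have "incseq ?H"
      unfolding H_def upd incseq_def using order_trans by blast
    ultimately have "c < (SUP m. outer_measure_of N (?H m))"
      using c SUP_outer_measure_of_incseq[of ?H N] H_space by simp
    then show "\<exists>\<beta>'. c < outer_measure_of N (H \<beta>' (Suc n)) \<and> (\<exists>m. \<beta>' = \<beta>(n := m))"
      by (auto simp: less_SUP_iff)
  qed
  then obtain \<beta> where \<beta>: "\<And>n. c < outer_measure_of N (H (\<beta> n) n)"
      "\<And>n. \<exists>m. \<beta> (Suc n) = (\<beta> n)(n := m)"
    by blast
  \<comment> \<open>The bound on coordinate \<open>i\<close> is final from stage
    \<open>Suc i\<close> on, so the stages have a limit.\<close>
  define b where "b i = \<beta> (Suc i) i" for i
  have \<beta>_b: "\<beta> n i = b i" if "i < n" for n i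
    using that
  proof (induction n)
    case (Suc n)
    obtain m where "\<beta> (Suc n) = (\<beta> n)(n := m)"
      using \<beta>(2) by blast
    then show ?case
      using Suc by (cases "i = n") (auto simp: b_def)
  qed simp
  have H_b: "c < outer_measure_of N (H b n)" for n
    using \<beta>(1)[of n] H_cong[of n "\<beta> n" b] \<beta>_b by simp
  \<comment> \<open>Here \<open>C\<close> is relaxed to \<open>L n\<close> while every coordinate is
    bounded. \<open>G n\<close> is measurable because \<open>L n\<close> reads finitely many
    coordinates, and it contains some \<open>H b k\<close>, which transfers the lower bound
    \<open>c\<close>.\<close>
  define G where "G n = {\<omega>. \<exists>x. (\<forall>i. x i \<le> b i) \<and> (x, \<omega>) \<in> L n}" for n
  have G_H: "G n \<in> sets N \<and> (\<exists>k. H b k \<subseteq> G n)" for n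
  proof -
    obtain k where k: "\<And>x x' \<omega>. (\<forall>i<k. x i = x' i) \<Longrightarrow> (x, \<omega>) \<in> L n \<Longrightarrow> (x', \<omega>) \<in> L n"
      and m: "\<And>x. Pair x -` L n \<in> sets N"
      using L[of n] unfolding clopen_random_def by blast
    define t where "t x = (\<lambda>i. if i < k then x i else 0)" for x :: "nat \<Rightarrow> nat"
    have t: "(t x, \<omega>) \<in> L n" if "(x, \<omega>) \<in> L n" for x \<omega>
      using that by (rule k[rotated]) (simp add: t_def)
    let ?F = "\<lambda>l i. if i < length l then l ! i else (0::nat)"
    have "t x = ?F (map x [0..<k])" for x
      by (auto simp: t_def)
    then have "range t \<subseteq> range ?F" by blast
    then have "countable (range t)"
      by (rule countable_subset) auto
    moreover have "G n = (\<Union>x\<in>{x\<in>range t. \<forall>i. x i \<le> b i}. Pair x -` L n)"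
    proof (intro set_eqI iffI)
      fix \<omega> assume "\<omega> \<in> G n"
      then obtain x where "\<forall>i. x i \<le> b i" "(x, \<omega>) \<in> L n"
        by (auto simp: G_def)
      then have "t x \<in> {x\<in>range t. \<forall>i. x i \<le> b i}" "(t x, \<omega>) \<in> L n"
        using t by (auto simp: t_def)
      then show "\<omega> \<in> (\<Union>x\<in>{x\<in>range t. \<forall>i. x i \<le> b i}. Pair x -` L n)"
        by blast
    qed (auto simp: G_def)
    ultimately have "G n \<in> sets N"
      using m by (auto intro!: sets.countable_UN'' intro: countable_subset)
    moreover have "H b k \<subseteq> G n"
    proof
      fix \<omega> assume "\<omega> \<in> H b k"
      then obtain x where x: "\<forall>i<k. x i \<le> b i" "(x, \<omega>) \<in> C"
        by (auto simp: H_def)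
      then have "(t x, \<omega>) \<in> L n"
        using t LC by blast
      moreover have "\<forall>i. t x i \<le> b i"
        using x by (auto simp: t_def)
      ultimately show "\<omega> \<in> G n"
        by (auto simp: G_def)
    qed
    ultimately show ?thesis by blast
  qed
  have G_c: "c \<le> emeasure N (G n)" for n
  proof -
    obtain k where "H b k \<subseteq> G n"
      using G_H by blast
    then have "outer_measure_of N (H b k) \<le> emeasure N (G n)"
      using outer_measure_of_mono[of "H b k" "G n" N] G_H[of n] by simp
    then show ?thesis
      using H_b[of k] by simp
  qed
  have "decseq G"
    using L_dec unfolding decseq_def G_def by blast
  then have "(INF n. emeasure N (G n)) = emeasure N (\<Inter>n. G n)"
    using G_H by (intro INF_emeasure_decseq) auto
  then have "c \<le> emeasure N (\<Inter>n. G n)"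
    using G_c by (simp flip: \<open>(INF n. emeasure N (G n)) = emeasure N (\<Inter>n. G n)\<close> add: INF_greatest)
  moreover have "(\<Inter>n. G n) \<subseteq> snd ` C"
  proof
    \<comment> \<open>The witnesses for the various \<open>n\<close> may differ. The sections of the
      \<open>L n\<close> are closed and decreasing, and each meets the compact box, so a common
      witness exists.\<close>
    fix \<omega> assume \<omega>: "\<omega> \<in> (\<Inter>n. G n)"
    have "{x. \<forall>i. x i \<le> b i} \<inter> (\<Inter>n\<in>UNIV. {x. (x, \<omega>) \<in> L n}) \<noteq> {}"
    proof (rule compact_imp_fip_image[OF compact_bounded_seqs])
      fix I' :: "nat set" assume "finite I'"
      define n where "n = Max (insert 0 I')"
      obtain x where "\<forall>i. x i \<le> b i" "(x, \<omega>) \<in> L n"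
        using \<omega> by (auto simp: G_def)
      moreover have "(x, \<omega>) \<in> L i" if "i \<in> I'" for i
      proof -
        have "i \<le> n"
          using that \<open>finite I'\<close> by (simp add: n_def)
        then show ?thesis
          using L_dec \<open>(x, \<omega>) \<in> L n\<close> by (metis subsetD)
      qed
      ultimately have "x \<in> {x. \<forall>i. x i \<le> b i} \<inter> (\<Inter>n\<in>I'. {x. (x, \<omega>) \<in> L n})"
        by simp
      then show "{x. \<forall>i. x i \<le> b i} \<inter> (\<Inter>n\<in>I'. {x. (x, \<omega>) \<in> L n}) \<noteq> {}"
        by (metis empty_iff)
    qed (rule closed_clopen_random_section[OF L])
    then obtain x where "(x, \<omega>) \<in> C"
      using LC by auto
    then show "\<omega> \<in> snd ` C"
      by force
  qed
  moreover have "(\<Inter>n. G n) \<in> sets N"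
    using G_H by auto
  ultimately show ?thesis by blast
qed

text \<open>The projection is squeezed between inner approximations and a measurable hull
  \<open>E\<close> of the same outer measure; completeness turns this into measurability.\<close>

lemma sets_closed_random_projection:
  assumes "finite_measure N" "complete_measure N" "closed_random N C"
  shows "snd ` C \<in> sets N"
proof -
  interpret finite_measure N by fact
  interpret complete_measure N by fact
  let ?H = "snd ` C"
  have "?H \<subseteq> space N"
    using closed_random_space[OF assms(3)] by auto
  then obtain E where E: "E \<in> sets N" "?H \<subseteq> E" "outer_measure_of N ?H = emeasure N E"
    using outer_measure_of_attain[of ?H N] by auto
  have "?H \<in> fmeasurable N"
  proof (subst fmeasurable_inner_outer, safe)
    fix e :: real assume "0 < e"
    define c where "c = ennreal (measure N E - e / 2)"
    have "\<exists>T\<in>sets N. T \<subseteq> ?H \<and> measure N E - e / 2 \<le> measure N T"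
    \<comment> \<open>In the first case \<open>ennreal\<close> would truncate \<open>c\<close> to 0
      and the strict inequality below the outer measure could fail; the empty set serves
      instead.\<close>
    proof (cases "measure N E - e / 2 \<le> 0")
      case True
      then show ?thesis
        by (intro bexI[of _ "{}"]) auto
    next
      case False
      then have "c < outer_measure_of N ?H"
        using \<open>0 < e\<close> by (simp add: c_def E emeasure_eq_measure ennreal_less_iff)
      then obtain T where "T \<in> sets N" "T \<subseteq> ?H" "c \<le> emeasure N T"
        using closed_random_inner_projection[OF assms(1,3)] by blast
      then show ?thesis
        using False by (auto simp: c_def emeasure_eq_measure)
    qed
    then obtain T where T: "T \<in> sets N" "T \<subseteq> ?H" "measure N E - e / 2 \<le> measure N T"
      by blast
    have "measure N T \<le> measure N E"
      using T E by (intro finite_measure_mono) auto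
    then have "\<bar>measure N T - measure N E\<bar> < e"
      using T \<open>0 < e\<close> by auto
    then show "\<exists>T\<in>fmeasurable N. \<exists>U\<in>fmeasurable N. T \<subseteq> ?H \<and> ?H \<subseteq> U \<and> \<bar>measure N T - measure N U\<bar> < e"
      using T E by (intro bexI[of _ T] bexI[of _ E]) (auto simp: fmeasurable_eq_sets)
  qed
  then show ?thesis
    by (rule fmeasurableD)
qed

lemma sets_baire_product_projection:
  assumes "finite_measure N" "complete_measure N" "D \<in> sets (baire_product N)"
  shows "snd ` D \<in> sets N"
proof -
  obtain C where "closed_random N C"
     "\<And>y \<omega>. (y, \<omega>) \<in> D \<longleftrightarrow> (\<exists>x. (pair_seq y x, \<omega>) \<in> C)"
    using unique_projection_baire_product[OF assms(3)] unfolding unique_projection_def by blast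
  moreover have "\<omega> \<in> snd ` D \<longleftrightarrow> \<omega> \<in> snd ` C" for \<omega>
  proof -
    have "\<omega> \<in> snd ` D \<longleftrightarrow> (\<exists>y x. (pair_seq y x, \<omega>) \<in> C)"
      using calculation(2) by force
    also have "\<dots> \<longleftrightarrow> (\<exists>z. (z, \<omega>) \<in> C)"
      by (metis pair_fst_snd_seq)
    finally show ?thesis by force
  qed
  then have "snd ` D = snd ` C"
    by (rule set_eqI)
  ultimately show ?thesis
    using sets_closed_random_projection[OF assms(1,2)] by simp
qed


section \<open>Countable sections\<close>

text \<open>Exhaustion: for each \<open>l\<close> there is a minimizing sequence of families. The
  union of all of them, over the countably many \<open>l\<close>, is still countable and, as
  \<open>\<Phi> l\<close> decreases when the family grows, minimal for every \<open>l\<close> at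
  once.\<close>

lemma simultaneous_minimizer:
  fixes \<Phi> :: "'l::countable \<Rightarrow> 'g set \<Rightarrow> ennreal"
  assumes anti: "\<And>l \<C> \<C>'. countable \<C>' \<Longrightarrow> \<C>' \<subseteq> \<Gamma> \<Longrightarrow> \<C> \<subseteq> \<C>' \<Longrightarrow> \<Phi> l \<C>' \<le> \<Phi> l \<C>"
  shows "\<exists>\<C>. countable \<C> \<and> \<C> \<subseteq> \<Gamma> \<and> (\<forall>l \<C>'. countable \<C>' \<longrightarrow> \<C>' \<subseteq> \<Gamma> \<longrightarrow> \<Phi> l \<C> \<le> \<Phi> l \<C>')"
proof -
  let ?S = "{\<C>. countable \<C> \<and> \<C> \<subseteq> \<Gamma>}"
  have "\<exists>\<D>. (\<forall>n::nat. \<D> n \<in> ?S) \<and> (INF n. \<Phi> l (\<D> n)) = (INF \<C>\<in>?S. \<Phi> l \<C>)" for l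
  proof -
    have "\<Phi> l ` ?S \<noteq> {}" by auto
    then obtain f :: "nat \<Rightarrow> ennreal" where f: "range f \<subseteq> \<Phi> l ` ?S" "(INF n. f n) = (INF \<C>\<in>?S. \<Phi> l \<C>)"
      using ennreal_Inf_countable_INF[of "\<Phi> l ` ?S"] by metis
    have "\<forall>n. \<exists>\<C>. \<C> \<in> ?S \<and> f n = \<Phi> l \<C>"
    proof
      fix n
      have "f n \<in> \<Phi> l ` ?S" using f(1) by auto
      then show "\<exists>\<C>. \<C> \<in> ?S \<and> f n = \<Phi> l \<C>" by auto
    qed
    from choice[OF this] obtain \<D> where "\<forall>n. \<D> n \<in> ?S \<and> f n = \<Phi> l (\<D> n)" ..
    then show ?thesis
      using f by (intro exI[of _ \<D>]) simp
  qed
  from choice[OF allI[OF this]] obtain \<D>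
    where "\<forall>l. (\<forall>n::nat. \<D> l n \<in> ?S) \<and> (INF n. \<Phi> l (\<D> l n)) = (INF \<C>\<in>?S. \<Phi> l \<C>)" ..
  then have \<D>: "\<And>l n. \<D> l n \<in> ?S" "\<And>l. (INF n. \<Phi> l (\<D> l n)) = (INF \<C>\<in>?S. \<Phi> l \<C>)"
    by blast+
  define \<C> where "\<C> = (\<Union>l. \<Union>n. \<D> l n)"
  have \<C>: "countable \<C>" "\<C> \<subseteq> \<Gamma>"
    using \<D>(1) by (auto simp: \<C>_def)
  have "\<Phi> l \<C> \<le> \<Phi> l \<C>'" if "countable \<C>'" "\<C>' \<subseteq> \<Gamma>" for l \<C>'
  proof -
    have "\<Phi> l \<C> \<le> (INF n. \<Phi> l (\<D> l n))"
      by (intro INF_greatest anti \<C>) (auto simp: \<C>_def)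
    also have "\<dots> \<le> \<Phi> l \<C>'"
      unfolding \<D>(2) using that by (intro INF_lower) auto
    finally show ?thesis .
  qed
  then show ?thesis
    using \<C> by blast
qed

text \<open>The function is partial, defined on an event \<open>E\<close> only, since a section may
  be empty.\<close>

definition random_graph :: "'a measure \<Rightarrow> ((nat \<Rightarrow> nat) \<times> 'a) set \<Rightarrow> bool" where
  "random_graph N g \<longleftrightarrow> (\<exists>E\<in>sets N. \<exists>f. (\<forall>n m. {\<omega>\<in>E. f \<omega> n = m} \<in> sets N) \<and> g = (\<lambda>\<omega>. (f \<omega>, \<omega>)) ` E)"

lemma random_graph_empty: "random_graph N {}"
  unfolding random_graph_def by (intro bexI[of _ "{}"]) auto

lemma sets_random_graph:
  assumes "random_graph N g"
  shows "g \<in> sets (baire_product N)"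
proof -
  obtain E f where E: "E \<in> sets N" "\<And>n m. {\<omega>\<in>E. f \<omega> n = m} \<in> sets N" "g = (\<lambda>\<omega>. (f \<omega>, \<omega>)) ` E"
    using assms unfolding random_graph_def by blast
  have "clopen_random N {(x, \<omega>). \<omega> \<in> E \<and> x n = f \<omega> n}" for n
  proof (rule clopen_randomI[where k="Suc n"])
    fix x
    have "Pair x -` {(x, \<omega>). \<omega> \<in> E \<and> x n = f \<omega> n} = {\<omega>\<in>E. f \<omega> n = x n}"
      by auto
    then show "Pair x -` {(x, \<omega>). \<omega> \<in> E \<and> x n = f \<omega> n} \<in> sets N"
      using E(2)[where m="x n" and n=n] by simp
  qed auto
  moreover have "g = (\<Inter>n. {(x, \<omega>). \<omega> \<in> E \<and> x n = f \<omega> n})"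
    by (auto simp: E(3) image_iff fun_eq_iff)
  ultimately show ?thesis
    by auto
qed

lemma sets_baire_product_coordinate:
  "{(x, \<omega>). \<omega> \<in> space N \<and> P (x n)} \<in> sets (baire_product N)"
proof (intro sets_baire_product_clopen clopen_randomI[where k="Suc n"])
  fix x
  have "Pair x -` {(x, \<omega>). \<omega> \<in> space N \<and> P (x n)} = (if P (x n) then space N else {})"
    by auto
  then show "Pair x -` {(x, \<omega>). \<omega> \<in> space N \<and> P (x n)} \<in> sets N"
    by simp
qed auto

text \<open>Uniqueness is tested coordinatewise. The event \<open>V n m\<close>, that the section
  has a point with \<open>n\<close>-th coordinate \<open>m\<close>, is a projection and so
  measurable. A nonempty section is a singleton exactly if no coordinate takes two values, and the
  same events give measurability of its point.\<close>

lemma unique_section: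
  assumes N: "finite_measure N" "complete_measure N" and R: "R \<in> sets (baire_product N)"
  defines "E \<equiv> {\<omega>. \<exists>!x. (x, \<omega>) \<in> R}"
  shows "E \<in> sets N" "random_graph N {(x, \<omega>)\<in>R. \<omega> \<in> E}"
proof -
  have sp: "\<omega> \<in> space N" if "(x, \<omega>) \<in> R" for x \<omega>
    using that sets.sets_into_space[OF R] by auto
  define V where "V n m = snd ` (R \<inter> {(x, \<omega>). \<omega> \<in> space N \<and> x n = m})" for n m
  have V: "V n m \<in> sets N" for n m
    unfolding V_def
    by (intro sets_baire_product_projection N sets.Int R sets_baire_product_coordinate)
  have V_iff: "\<omega> \<in> V n m \<longleftrightarrow> (\<exists>x. (x, \<omega>) \<in> R \<and> x n = m)" for \<omega> n m
    using sp by (force simp: V_def)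
  have "snd ` R \<in> sets N"
    by (intro sets_baire_product_projection N R)
  moreover have "E = snd ` R - (\<Union>n. \<Union>m. \<Union>m'\<in>{m'. m \<noteq> m'}. V n m \<inter> V n m')"
  proof (intro set_eqI iffI)
    fix \<omega> assume "\<omega> \<in> E"
    then show "\<omega> \<in> snd ` R - (\<Union>n. \<Union>m. \<Union>m'\<in>{m'. m \<noteq> m'}. V n m \<inter> V n m')"
      by (force simp: E_def V_iff)
  next
    fix \<omega> assume \<omega>: "\<omega> \<in> snd ` R - (\<Union>n. \<Union>m. \<Union>m'\<in>{m'. m \<noteq> m'}. V n m \<inter> V n m')"
    then obtain x where x: "(x, \<omega>) \<in> R" by auto
    have "x' = x" if "(x', \<omega>) \<in> R" for x'
    proof (rule ccontr)
      assume "x' \<noteq> x"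
      then obtain n where "x' n \<noteq> x n" by blast
      moreover have "\<omega> \<in> V n (x n)" "\<omega> \<in> V n (x' n)"
        using x that by (auto simp: V_iff)
      ultimately show False using \<omega> by auto
    qed
    then show "\<omega> \<in> E"
      using x by (auto simp: E_def)
  qed
  ultimately show E: "E \<in> sets N"
    using V by auto
  define f where "f \<omega> = (THE x. (x, \<omega>) \<in> R)" for \<omega>
  have f: "(x, \<omega>) \<in> R \<longleftrightarrow> x = f \<omega>" if "\<omega> \<in> E" for x \<omega>
  proof -
    have ex1: "\<exists>!x. (x, \<omega>) \<in> R"
      using that by (simp add: E_def)
    show ?thesis
      unfolding f_def using theI'[OF ex1] the1_equality[OF ex1] by blast
  qed
  have "{\<omega>\<in>E. f \<omega> n = m} = E \<inter> V n m" for n m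
    using f by (auto simp: V_iff)
  then have "{\<omega>\<in>E. f \<omega> n = m} \<in> sets N" for n m
    using E V by simp
  moreover have "{(x, \<omega>)\<in>R. \<omega> \<in> E} = (\<lambda>\<omega>. (f \<omega>, \<omega>)) ` E"
    using f by (auto simp: image_iff)
  ultimately show "random_graph N {(x, \<omega>)\<in>R. \<omega> \<in> E}"
    unfolding random_graph_def using E by blast
qed

text \<open>A Baire category argument. \<open>Q\<close> itself need not be closed, but limits of its
  points stay in the section of \<open>C\<close>. If no point of \<open>Q\<close> were isolated in
  \<open>Q\<close>, a limit could be steered away from every member of an enumeration of that
  section.\<close>

lemma closed_countable_isolated:
  assumes C: "closed_random N C" and count: "countable {x. (x, \<omega>) \<in> C}"
    and QC: "\<And>x. x \<in> Q \<Longrightarrow> (x, \<omega>) \<in> C" and ne: "x\<^sub>0 \<in> Q"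
  shows "\<exists>x\<in>Q. \<exists>k. \<forall>x'\<in>Q. (\<forall>i<k. x' i = x i) \<longrightarrow> x' = x"
proof (rule ccontr)
  assume "\<not> ?thesis"
  then have perfect: "\<exists>x'\<in>Q. (\<forall>i<k. x' i = x i) \<and> x' \<noteq> x" if "x \<in> Q" for x k
    using that by blast
  define e where "e = from_nat_into {x. (x, \<omega>) \<in> C}"
  have e: "\<exists>n. x = e n" if "(x, \<omega>) \<in> C" for x
    using from_nat_into_surj[OF count, of x] that by (auto simp: e_def)
  \<comment> \<open>A pair \<open>(x, k)\<close> stands for the cylinder of length \<open>k\<close>
    around \<open>x\<close>. The cylinder of \<open>q\<close> refines that of \<open>p\<close> and
    excludes \<open>e n\<close>.\<close>
  define rel where "rel n p q \<longleftrightarrow> (\<forall>i<snd p. fst q i = fst p i) \<and> (\<exists>i<snd q. fst q i \<noteq> e n i)"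
    for n and p q :: "(nat \<Rightarrow> nat) \<times> nat"
  have "\<exists>s. \<forall>n. (fst (s n) \<in> Q \<and> n \<le> snd (s n)) \<and> (rel n (s n) (s (Suc n)) \<and> snd (s n) \<le> snd (s (Suc n)))"
  proof (rule dependent_nat_choice)
    show "\<exists>p. fst p \<in> Q \<and> (0::nat) \<le> snd p"
      using ne by (intro exI[of _ "(x\<^sub>0, 0)"]) auto
  next
    fix p and n :: nat assume p: "fst p \<in> Q \<and> n \<le> snd p"
    obtain x' where x': "x' \<in> Q" "\<forall>i<snd p. x' i = fst p i" "x' \<noteq> e n"
      using perfect[of "fst p" "snd p"] p by (cases "fst p = e n") auto
    then obtain i where i: "x' i \<noteq> e n i" by blast
    show "\<exists>q. (fst q \<in> Q \<and> Suc n \<le> snd q) \<and> rel n p q \<and> snd p \<le> snd q"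
      \<comment> \<open>The new length exceeds the old one and also includes the coordinate
        \<open>i\<close> at which \<open>x'\<close> departs from \<open>e n\<close>.\<close>
      using x' i p by (intro exI[of _ "(x', Suc (snd p + i))"]) (auto simp: rel_def)
  qed
  then obtain s where s: "\<And>n. fst (s n) \<in> Q" "\<And>n. n \<le> snd (s n)" "\<And>n. rel n (s n) (s (Suc n))"
      and mono: "\<And>n. snd (s n) \<le> snd (s (Suc n))"
    by blast
  have agree: "fst (s m) i = fst (s n) i" if "n \<le> m" "i < snd (s n)" for m n i
    using that
  proof (induction m rule: dec_induct)
    case (step m)
    have "snd (s n) \<le> snd (s m)"
      using lift_Suc_mono_le[of "\<lambda>n. snd (s n)", OF mono] step by blast
    then have "fst (s (Suc m)) i = fst (s m) i"
      using s(3)[of m] step by (auto simp: rel_def)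
    then show ?case
      using step by simp
  qed simp
  \<comment> \<open>The cylinder at stage \<open>Suc i\<close> has length at least
    \<open>Suc i\<close>, so coordinate \<open>i\<close> is settled by then.\<close>
  define z where "z i = fst (s (Suc i)) i" for i
  have z: "z i = fst (s n) i" if "i < snd (s n)" for i n
  proof (cases "Suc i \<le> n")
    case True
    then show ?thesis
      using agree[of "Suc i" n i] s(2)[of "Suc i"] by (simp add: z_def)
  next
    case False
    then show ?thesis
      using agree[of n "Suc i" i] that by (simp add: z_def)
  qed
  obtain K where K: "\<And>j::nat. clopen_random N (K j)" "C = (\<Inter>j. K j)"
    using C unfolding closed_random_def by blast
  have "(z, \<omega>) \<in> K j" for j
  proof -
    obtain k where k: "\<And>x x' \<omega>. (\<forall>i<k. x i = x' i) \<Longrightarrow> (x, \<omega>) \<in> K j \<Longrightarrow> (x', \<omega>) \<in> K j"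
      using K(1)[of j] unfolding clopen_random_def by blast
    show ?thesis
    proof (rule k)
      show "\<forall>i<k. fst (s k) i = z i"
        using z[of _ k] s(2)[of k] by simp
      show "(fst (s k), \<omega>) \<in> K j"
        using QC[OF s(1)] K(2) by blast
    qed
  qed
  then obtain n where "z = e n"
    using e K(2) by blast
  then show False
    using s(3)[of n] z[of _ "Suc n"] by (auto simp: rel_def)
qed

lemma closed_random_enumeration:
  assumes N: "finite_measure N" "complete_measure N" and C: "closed_random N C"
    and count: "AE \<omega> in N. countable {x. (x, \<omega>) \<in> C}"
  shows "\<exists>g. (\<forall>i::nat. random_graph N (g i)) \<and> (AE \<omega> in N. \<forall>x. (x, \<omega>) \<in> C \<longleftrightarrow> (\<exists>i. (x, \<omega>) \<in> g i))"
proof -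
  interpret finite_measure N by fact
  define \<Gamma> where "\<Gamma> = {g. random_graph N g \<and> g \<subseteq> C}"
  \<comment> \<open>The part of \<open>C\<close> in the cylinder \<open>l\<close> that the graphs in
    \<open>\<C>\<close> miss. There are countably many cylinders, so one family can minimize all the
    projections.\<close>
  define R where "R l \<C> = {(x, \<omega>)\<in>C. \<forall>i<length l. x i = l ! i} - \<Union>\<C>"
    for l :: "nat list" and \<C> :: "((nat \<Rightarrow> nat) \<times> 'a) set set"
  have R: "R l \<C> \<in> sets (baire_product N)" if "countable \<C>" "\<C> \<subseteq> \<Gamma>" for l \<C>
  proof -
    have "{(x, \<omega>)\<in>C. \<forall>i<length l. x i = l ! i} =
        C \<inter> (\<Inter>i. {(x, \<omega>). \<omega> \<in> space N \<and> (i < length l \<longrightarrow> x i = l ! i)})"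
      using closed_random_space[OF C] by auto
    moreover have "\<dots> \<in> sets (baire_product N)"
      by (intro sets.Int sets_baire_product_closed C sets.countable_INT')
        (auto intro: sets_baire_product_coordinate)
    moreover have "\<Union>\<C> \<in> sets (baire_product N)"
      using that by (intro sets.countable_Union) (auto simp: \<Gamma>_def intro: sets_random_graph)
    ultimately show ?thesis
      unfolding R_def by auto
  qed
  define \<Phi> where "\<Phi> l \<C> = emeasure N (snd ` R l \<C>)" for l \<C>
  have proj: "snd ` R l \<C> \<in> sets N" if "countable \<C>" "\<C> \<subseteq> \<Gamma>" for l \<C>
    by (intro sets_baire_product_projection N R that)
  have "\<Phi> l \<C>' \<le> \<Phi> l \<C>" if "countable \<C>'" "\<C>' \<subseteq> \<Gamma>" "\<C> \<subseteq> \<C>'" for l \<C> \<C>'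
  proof -
    have "countable \<C>" "\<C> \<subseteq> \<Gamma>"
      using that by (auto intro: countable_subset)
    moreover have "R l \<C>' \<subseteq> R l \<C>"
      using that by (auto simp: R_def)
    ultimately show ?thesis
      unfolding \<Phi>_def by (intro emeasure_mono proj image_mono)
  qed
  then obtain \<C> where \<C>: "countable \<C>" "\<C> \<subseteq> \<Gamma>"
      and min: "\<And>l \<C>'. countable \<C>' \<Longrightarrow> \<C>' \<subseteq> \<Gamma> \<Longrightarrow> \<Phi> l \<C> \<le> \<Phi> l \<C>'"
    using simultaneous_minimizer[of \<Gamma> \<Phi>] by blast
  define E where "E l = {\<omega>. \<exists>!x. (x, \<omega>) \<in> R l \<C>}" for l
  have "E l \<in> null_sets N" for l
  proof -
    let ?g = "{(x, \<omega>)\<in>R l \<C>. \<omega> \<in> E l}"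
    have E: "E l \<in> sets N"
      unfolding E_def by (rule unique_section(1)[OF N R[OF \<C>]])
    have E_sub: "E l \<subseteq> snd ` R l \<C>"
      by (force simp: E_def)
    have "?g \<in> \<Gamma>"
      using unique_section(2)[OF N R[OF \<C>], of l] unfolding \<Gamma>_def E_def
      by (auto simp: R_def)
    \<comment> \<open>Over \<open>E l\<close> the missed section is the single point on
      \<open>?g\<close>. Adding \<open>?g\<close> clears \<open>E l\<close> from the projection, so
      minimality leaves no mass for \<open>E l\<close>.\<close>
    then have "\<Phi> l \<C> \<le> \<Phi> l (insert ?g \<C>)"
      using \<C> by (intro min) auto
    also have "\<dots> \<le> emeasure N (snd ` R l \<C> - E l)"
      unfolding \<Phi>_def
      by (intro emeasure_mono sets.Diff proj \<C> E) (auto simp: R_def)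
    also have "\<dots> = emeasure N (snd ` R l \<C>) - emeasure N (E l)"
      using E proj[OF \<C>] E_sub by (intro emeasure_Diff) auto
    finally have "emeasure N (snd ` R l \<C>) \<le> emeasure N (snd ` R l \<C>) - emeasure N (E l)"
      by (simp add: \<Phi>_def)
    moreover have "measure N (E l) \<le> measure N (snd ` R l \<C>)"
      using proj[OF \<C>] E_sub by (intro finite_measure_mono) auto
    ultimately have "measure N (E l) = 0"
      by (simp add: emeasure_eq_measure ennreal_minus ennreal_le_iff antisym)
    then show ?thesis
      using E by (simp add: null_sets_def emeasure_eq_measure)
  qed
  then have "AE \<omega> in N. \<forall>l. \<omega> \<notin> E l"
    by (subst AE_all_countable) (blast intro: AE_not_in)
  with count have ae: "AE \<omega> in N. \<forall>x. (x, \<omega>) \<in> C \<longleftrightarrow> (x, \<omega>) \<in> \<Union>\<C>"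
  proof eventually_elim
    fix \<omega> assume count: "countable {x. (x, \<omega>) \<in> C}" and E: "\<forall>l. \<omega> \<notin> E l"
    have "(x, \<omega>) \<in> \<Union>\<C>" if "(x, \<omega>) \<in> C" for x
    proof (rule ccontr)
      assume "(x, \<omega>) \<notin> \<Union>\<C>"
      then have "x \<in> {x. (x, \<omega>) \<in> C - \<Union>\<C>}"
        using that by simp
      then obtain y k where y: "y \<in> {x. (x, \<omega>) \<in> C - \<Union>\<C>}"
          and iso: "\<forall>x'\<in>{x. (x, \<omega>) \<in> C - \<Union>\<C>}. (\<forall>i<k. x' i = y i) \<longrightarrow> x' = y"
        using closed_countable_isolated[OF C count, of "{x. (x, \<omega>) \<in> C - \<Union>\<C>}"] by blast
      \<comment> \<open>The first \<open>k\<close> coordinates of the isolated point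
        \<open>y\<close> name a cylinder in which it is the only missed point, which puts
        \<open>\<omega>\<close> into one of the null sets.\<close>
      have "(x', \<omega>) \<in> R (map y [0..<k]) \<C> \<longleftrightarrow> x' = y" for x'
        using y iso by (auto simp: R_def)
      then have "\<omega> \<in> E (map y [0..<k])"
        by (simp add: E_def)
      then show False
        using E by blast
    qed
    moreover have "(x, \<omega>) \<in> C" if "(x, \<omega>) \<in> \<Union>\<C>" for x
      using that \<C> by (auto simp: \<Gamma>_def)
    ultimately show "\<forall>x. (x, \<omega>) \<in> C \<longleftrightarrow> (x, \<omega>) \<in> \<Union>\<C>"
      by blast
  qed
  \<comment> \<open>The empty graph makes the family nonempty, so that \<open>from_nat_into\<close>
    runs through exactly its members.\<close>
  define g where "g = from_nat_into (insert {} \<C>)"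
  have range_g: "range g = insert {} \<C>"
    using \<C> by (simp add: g_def range_from_nat_into)
  then have "random_graph N (g i)" for i
    using \<C>(2) random_graph_empty[of N] by (metis (no_types, lifting) \<Gamma>_def insertE mem_Collect_eq rangeI subsetD)
  moreover have "(\<exists>i. p \<in> g i) \<longleftrightarrow> p \<in> \<Union>\<C>" for p
  proof -
    have "(\<exists>i. p \<in> g i) \<longleftrightarrow> p \<in> \<Union>(range g)"
      by blast
    then show ?thesis
      by (simp add: range_g)
  qed
  ultimately show ?thesis
    using ae by (intro exI[of _ g]) simp
qed

section \<open>Coffin-valued variables and dyadic codes of reals\<close>

lemma coffin_generators: "{Some ` E | E. E \<in> sets borel} \<union> {{None}} \<subseteq> Pow (UNIV :: real option set)"
  by auto

lemma space_borel_coffin [simp]: "space borel_coffin = UNIV"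
  by (simp add: borel_coffin_def)

lemma sets_borel_coffin_None [measurable]: "{None} \<in> sets borel_coffin"
  by (simp add: borel_coffin_def)

lemma measurable_Some_coffin [measurable]: "Some \<in> borel \<rightarrow>\<^sub>M borel_coffin"
  unfolding borel_coffin_def
proof (rule measurable_measure_of[OF coffin_generators])
  fix y :: "real option set"
  assume "y \<in> {Some ` E | E. E \<in> sets borel} \<union> {{None}}"
  then consider E where "E \<in> sets borel" "y = Some ` E" | "y = {None}"
    by blast
  then show "Some -` y \<inter> space borel \<in> sets borel"
  proof cases
    case (1 E)
    then have "Some -` y \<inter> space borel = E"
      by auto
    then show ?thesis using 1 by simp
  next
    case 2
    then have "Some -` y \<inter> space borel = {}"
      by auto
    then show ?thesis by simp
  qed
qed simp

lemma measurable_case_coffin: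
  assumes h: "h \<in> borel \<rightarrow>\<^sub>M M" and c: "c \<in> space M"
  shows "case_option c h \<in> borel_coffin \<rightarrow>\<^sub>M M"
proof (rule measurableI)
  fix x :: "real option"
  show "case_option c h x \<in> space M"
    using c measurable_space[OF h] by (cases x) auto
next
  fix A assume A: "A \<in> sets M"
  have "Some ` (h -` A) \<in> sets borel_coffin"
    using measurable_sets[OF h A] by (auto simp: borel_coffin_def coffin_generators)
  moreover have "case_option c h -` A \<inter> space borel_coffin =
      Some ` (h -` A) \<union> (if c \<in> A then {None} else {})"
  proof (rule set_eqI)
    fix x
    show "x \<in> case_option c h -` A \<inter> space borel_coffin \<longleftrightarrow>
        x \<in> Some ` (h -` A) \<union> (if c \<in> A then {None} else {})"
      by (cases x) auto
  qed
  ultimately show "case_option c h -` A \<inter> space borel_coffin \<in> sets borel_coffin"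
    using sets.Un[of "Some ` (h -` A)" borel_coffin "{None}"] sets_borel_coffin_None by simp
qed

text \<open>The lower dyadic approximations of \<open>t\<close>, as integers coded by naturals.
  Sequences outside the range of this map are recognized by failing
  \<open>real_code (real_decode y) = y\<close>.\<close>

definition real_code :: "real \<Rightarrow> nat \<Rightarrow> nat" where
  "real_code t = (\<lambda>n. to_nat \<lfloor>2 ^ n * t\<rfloor>)"

definition real_decode :: "(nat \<Rightarrow> nat) \<Rightarrow> real" where
  "real_decode y = lim (\<lambda>n. of_int (from_nat (y n)) / 2 ^ n)"

lemma LIMSEQ_dyadic_floor: "(\<lambda>n. of_int \<lfloor>2 ^ n * t\<rfloor> / 2 ^ n) \<longlonglongrightarrow> (t :: real)"
proof (rule tendsto_sandwich)
  show "\<forall>\<^sub>F n in sequentially. t - (1 / 2) ^ n \<le> of_int \<lfloor>2 ^ n * t\<rfloor> / 2 ^ n"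
  proof (intro always_eventually allI)
    fix n
    have "t - (1 / 2) ^ n = (2 ^ n * t - 1) / 2 ^ n"
      by (simp add: field_simps power_divide)
    also have "\<dots> \<le> of_int \<lfloor>2 ^ n * t\<rfloor> / 2 ^ n"
      by (intro divide_right_mono) (linarith, simp)
    finally show "t - (1 / 2) ^ n \<le> of_int \<lfloor>2 ^ n * t\<rfloor> / 2 ^ n" .
  qed
  show "\<forall>\<^sub>F n in sequentially. of_int \<lfloor>2 ^ n * t\<rfloor> / 2 ^ n \<le> t"
  proof (intro always_eventually allI)
    fix n
    have "of_int \<lfloor>2 ^ n * t\<rfloor> \<le> 2 ^ n * t" by linarith
    then show "of_int \<lfloor>2 ^ n * t\<rfloor> / 2 ^ n \<le> t"
      by (simp add: field_simps)
  qed
  show "(\<lambda>n. t - (1 / 2) ^ n) \<longlonglongrightarrow> t"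
    by (rule tendsto_eq_intros LIMSEQ_power_zero | simp)+
qed simp

lemma real_decode_code [simp]: "real_decode (real_code t) = t"
  by (simp add: real_decode_def real_code_def limI LIMSEQ_dyadic_floor)

lemma measurable_baire_product_fst: "(\<lambda>p. fst p n) \<in> baire_product N \<rightarrow>\<^sub>M count_space UNIV"
proof (rule measurableI)
  fix A :: "nat set"
  have "(\<lambda>p. fst p n) -` A \<inter> space (baire_product N) = {(x, \<omega>). \<omega> \<in> space N \<and> x n \<in> A}"
    by auto
  then show "(\<lambda>p. fst p n) -` A \<inter> space (baire_product N) \<in> sets (baire_product N)"
    using sets_baire_product_coordinate[where P="\<lambda>m. m \<in> A"] by metis
qed simp

lemma measurable_baire_product_snd: "snd \<in> baire_product N \<rightarrow>\<^sub>M N"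
proof (rule measurableI)
  fix A assume A: "A \<in> sets N"
  have "snd -` A \<inter> space (baire_product N) = UNIV \<times> A"
    using sets.sets_into_space[OF A] by auto
  moreover have "clopen_random N (UNIV \<times> A)"
    using A by (intro clopen_randomI[where k=0]) auto
  ultimately show "snd -` A \<inter> space (baire_product N) \<in> sets (baire_product N)"
    by auto
qed auto

lemma borel_measurable_real_decode:
  assumes "\<And>n. (\<lambda>p. f p n) \<in> M \<rightarrow>\<^sub>M count_space UNIV"
  shows "(\<lambda>p. real_decode (f p)) \<in> borel_measurable M"
  unfolding real_decode_def
proof (rule borel_measurable_lim_metric)
  fix n
  have "(\<lambda>m. of_int (from_nat m) / 2 ^ n :: real) \<in> count_space UNIV \<rightarrow>\<^sub>M borel"
    by simp
  from measurable_compose[OF assms this]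
  show "(\<lambda>p. of_int (from_nat (f p n)) / 2 ^ n :: real) \<in> borel_measurable M" .
qed

text \<open>A measure-theoretic form of the Lusin-Novikov theorem.\<close>

lemma countable_sections_enumeration:
  fixes D :: "(real \<times> 'a) set"
  assumes N: "finite_measure N" "complete_measure N"
    and D: "D \<in> sets (borel \<Otimes>\<^sub>M N)" and count: "AE \<omega> in N. countable {t. (t, \<omega>) \<in> D}"
  shows "\<exists>S. (\<forall>i::nat. S i \<in> N \<rightarrow>\<^sub>M borel_coffin) \<and>
    (AE \<omega> in N. {t. (t, \<omega>) \<in> D} = seq_set (\<lambda>i. S i \<omega>))"
proof -
  let ?dec = "\<lambda>p::(nat \<Rightarrow> nat) \<times> 'a. real_decode (fst p)"
  have [measurable]: "?dec \<in> borel_measurable (baire_product N)"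
    by (intro borel_measurable_real_decode measurable_baire_product_fst)
  have [measurable]: "(\<lambda>p. real (fst p n)) \<in> borel_measurable (baire_product N)" for n
    by (rule measurable_compose[OF measurable_baire_product_fst]) simp
  have [measurable]: "(\<lambda>p. real (to_nat \<lfloor>2 ^ n * ?dec p\<rfloor>)) \<in> borel_measurable (baire_product N)" for n
  proof -
    have "(\<lambda>p. \<lfloor>2 ^ n * ?dec p\<rfloor>) \<in> baire_product N \<rightarrow>\<^sub>M count_space UNIV"
      by measurable
    from measurable_compose[OF this, of "\<lambda>k. real (to_nat k)" borel] show ?thesis
      by simp
  qed
  have [measurable]: "(\<lambda>p. (?dec p, snd p)) \<in> baire_product N \<rightarrow>\<^sub>M borel \<Otimes>\<^sub>M N"
    by (intro measurable_Pair measurable_baire_product_snd) measurable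
  note D[measurable]
  \<comment> \<open>The first condition says that the sequence is a genuine code. A real then has
    exactly one representative, and the sections of \<open>D'\<close> correspond to those of
    \<open>D\<close> one to one.\<close>
  define D' where "D' = {p \<in> space (baire_product N).
    (\<forall>n. real (to_nat \<lfloor>2 ^ n * ?dec p\<rfloor>) = real (fst p n)) \<and> (?dec p, snd p) \<in> D}"
  have "D' \<in> sets (baire_product N)"
    unfolding D'_def by measurable
  then obtain C where C: "closed_random N C"
      "\<And>y \<omega>. (y, \<omega>) \<in> D' \<longleftrightarrow> (\<exists>x. (pair_seq y x, \<omega>) \<in> C)"
      "\<And>y x x' \<omega>. (pair_seq y x, \<omega>) \<in> C \<Longrightarrow> (pair_seq y x', \<omega>) \<in> C \<Longrightarrow> x = x'"
    using unique_projection_baire_product unfolding unique_projection_def by metis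
  have D'_iff: "(y, \<omega>) \<in> D' \<longleftrightarrow> real_code (real_decode y) = y \<and> (real_decode y, \<omega>) \<in> D" for y \<omega>
    using sets.sets_into_space[OF D] by (auto simp: D'_def real_code_def fun_eq_iff space_pair_measure)
  have C_D: "(t, \<omega>) \<in> D \<longleftrightarrow> (\<exists>z. (z, \<omega>) \<in> C \<and> t = real_decode (fst_seq z))" for t \<omega>
  proof
    assume "(t, \<omega>) \<in> D"
    then have "(real_code t, \<omega>) \<in> D'"
      by (simp add: D'_iff)
    then show "\<exists>z. (z, \<omega>) \<in> C \<and> t = real_decode (fst_seq z)"
      using C(2) by (metis fst_pair_seq real_decode_code)
  next
    assume "\<exists>z. (z, \<omega>) \<in> C \<and> t = real_decode (fst_seq z)"
    then show "(t, \<omega>) \<in> D"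
      using C(2) D'_iff by (metis pair_fst_snd_seq)
  qed
  \<comment> \<open>Countability is lifted from \<open>D\<close> through \<open>D'\<close> to
    \<open>C\<close>; the last passage uses that \<open>fst_seq\<close> is injective on each section
    of \<open>C\<close>.\<close>
  have "AE \<omega> in N. countable {z. (z, \<omega>) \<in> C}"
    using count
  proof eventually_elim
    case (elim \<omega>)
    have "fst_seq ` {z. (z, \<omega>) \<in> C} \<subseteq> real_code ` {t. (t, \<omega>) \<in> D}"
    proof
      fix y assume "y \<in> fst_seq ` {z. (z, \<omega>) \<in> C}"
      then obtain z where z: "(z, \<omega>) \<in> C" "y = fst_seq z" by blast
      then have "(y, \<omega>) \<in> D'"
        using C(2)[of y \<omega>] by (metis pair_fst_snd_seq)
      then show "y \<in> real_code ` {t. (t, \<omega>) \<in> D}"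
        by (intro image_eqI[of _ _ "real_decode y"]) (auto simp: D'_iff)
    qed
    then have "countable (fst_seq ` {z. (z, \<omega>) \<in> C})"
      using elim by (rule countable_subset[OF _ countable_image])
    moreover have "inj_on fst_seq {z. (z, \<omega>) \<in> C}"
      using C(3) by (intro inj_onI) (metis mem_Collect_eq pair_fst_snd_seq)
    ultimately show ?case
      by (rule countable_image_inj_on)
  qed
  from closed_random_enumeration[OF N C(1) this] obtain g
    where g: "\<And>i::nat. random_graph N (g i)"
      and ae: "AE \<omega> in N. \<forall>x. (x, \<omega>) \<in> C \<longleftrightarrow> (\<exists>i. (x, \<omega>) \<in> g i)"
    by blast
  have "\<exists>E f. E \<in> sets N \<and> (\<forall>n m. {\<omega>\<in>E. f \<omega> n = m} \<in> sets N) \<and> g i = (\<lambda>\<omega>. (f \<omega>, \<omega>)) ` E" for i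
    using g[of i] unfolding random_graph_def by blast
  from choice[OF allI[OF this]] obtain E where "\<forall>i. \<exists>f. E i \<in> sets N \<and>
      (\<forall>n m. {\<omega>\<in>E i. f \<omega> n = m} \<in> sets N) \<and> g i = (\<lambda>\<omega>. (f \<omega>, \<omega>)) ` E i" ..
  from choice[OF this] obtain f where "\<forall>i. E i \<in> sets N \<and>
      (\<forall>n m. {\<omega>\<in>E i. f i \<omega> n = m} \<in> sets N) \<and> g i = (\<lambda>\<omega>. (f i \<omega>, \<omega>)) ` E i" ..
  then have E: "\<And>i. E i \<in> sets N" "\<And>i n m. {\<omega>\<in>E i. f i \<omega> n = m} \<in> sets N"
      and g_eq: "\<And>i. g i = (\<lambda>\<omega>. (f i \<omega>, \<omega>)) ` E i"
    by simp_all
  \<comment> \<open>The zero sequence outside \<open>E i\<close> makes the function total and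
    measurable; \<open>S\<close> below returns the coffin state there.\<close>
  define h where "h i \<omega> = (if \<omega> \<in> E i then f i \<omega> else (\<lambda>_. 0))" for i \<omega>
  have h: "(\<lambda>\<omega>. h i \<omega> n) \<in> N \<rightarrow>\<^sub>M count_space UNIV" for i n
    unfolding measurable_count_space_eq2_countable
  proof (intro conjI ballI)
    fix m
    have "(\<lambda>\<omega>. h i \<omega> n) -` {m} \<inter> space N =
        {\<omega>\<in>E i. f i \<omega> n = m} \<union> (if m = 0 then space N - E i else {})"
      using sets.sets_into_space[OF E(1), of i] by (auto simp: h_def split: if_splits)
    then show "(\<lambda>\<omega>. h i \<omega> n) -` {m} \<inter> space N \<in> sets N"
      using E by simp
  qed simp
  define S where "S i \<omega> = (if \<omega> \<in> E i then Some (real_decode (fst_seq (h i \<omega>))) else None)" for i \<omega>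
  have "S i \<in> N \<rightarrow>\<^sub>M borel_coffin" for i
  proof -
    have [measurable]: "(\<lambda>\<omega>. fst_seq (h i \<omega>) n) \<in> N \<rightarrow>\<^sub>M count_space UNIV" for n
      unfolding fst_seq_def
      by (rule measurable_compose[OF h, where g="\<lambda>k. fst (prod_decode k)"]) simp
    have [measurable]: "(\<lambda>\<omega>. real_decode (fst_seq (h i \<omega>))) \<in> borel_measurable N"
      by (rule borel_measurable_real_decode) measurable
    note E(1)[measurable]
    show ?thesis
      unfolding S_def by measurable
  qed
  moreover have "AE \<omega> in N. {t. (t, \<omega>) \<in> D} = seq_set (\<lambda>i. S i \<omega>)"
    using ae
  proof eventually_elim
    case (elim \<omega>)
    have "(z, \<omega>) \<in> C \<longleftrightarrow> (\<exists>i. \<omega> \<in> E i \<and> z = h i \<omega>)" for z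
      using elim by (auto simp: g_eq h_def)
    then have "t \<in> seq_set (\<lambda>i. S i \<omega>) \<longleftrightarrow> (t, \<omega>) \<in> D" for t
      unfolding C_D by (auto simp: seq_set_def S_def image_iff split: if_splits)
    then show ?case
      by blast
  qed
  ultimately show ?thesis by blast
qed


section \<open>Path space\<close>

lemma Omega0_continuous: "\<omega> \<in> Omega0 \<Longrightarrow> continuous_on S \<omega>"
  using continuous_on_subset[of UNIV \<omega> S] by (auto simp: Omega0_def)

lemma levy_shift_Omega0:
  assumes "\<omega> \<in> Omega0"
  shows "levy_shift u \<omega> \<in> Omega0"
proof -
  have \<omega>: "continuous_on UNIV \<omega>"
    using assms by (simp add: Omega0_def)
  have "continuous_on UNIV (\<lambda>t. \<omega> (u + t))"
    by (rule continuous_on_compose2[OF \<omega>]) (auto intro!: continuous_on_add continuous_on_const continuous_on_id)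
  then have "continuous_on UNIV (\<lambda>t. \<omega> (u + t) - \<omega> u)"
    by (rule continuous_on_diff[OF _ continuous_on_const])
  then show ?thesis
    by (simp add: Omega0_def levy_shift_def)
qed

lemma levy_shift_levy_shift: "levy_shift t (levy_shift u \<omega>) = levy_shift (u + t) \<omega>"
  by (simp add: levy_shift_def add.assoc)

definition path_field :: "real set \<Rightarrow> (real \<Rightarrow> real) measure" where
  "path_field I = vimage_algebra Omega0 (\<lambda>\<omega>. \<lambda>t\<in>I. \<omega> t) (Pi\<^sub>M I (\<lambda>_. borel))"

lemma space_path_field [simp]: "space (path_field I) = Omega0"
  by (simp add: path_field_def)

lemma germ_field_path_field: "germ_field = (\<Inter>\<epsilon>\<in>{0<..}. sets (path_field {-\<epsilon><..<\<epsilon>}))"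
  by (simp add: germ_field_def path_field_def)

lemma measurable_path_field_eval:
  assumes "t \<in> I"
  shows "(\<lambda>\<omega>. \<omega> t) \<in> borel_measurable (path_field I)"
proof -
  have "(\<lambda>\<omega>. \<lambda>t\<in>I. \<omega> t) \<in> path_field I \<rightarrow>\<^sub>M Pi\<^sub>M I (\<lambda>_. borel)"
    unfolding path_field_def by (rule measurable_vimage_algebra1) (auto simp: space_PiM)
  from measurable_compose[OF this measurable_component_singleton[OF assms]] assms
  show ?thesis by simp
qed

lemma measurable_path_fieldI:
  assumes "\<And>x. x \<in> space F \<Longrightarrow> f x \<in> Omega0" "\<And>t. t \<in> I \<Longrightarrow> (\<lambda>x. f x t) \<in> borel_measurable F"
  shows "f \<in> F \<rightarrow>\<^sub>M path_field I"
  unfolding path_field_def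
  by (rule measurable_vimage_algebra2) (use assms in \<open>auto intro!: measurable_restrict\<close>)

lemma sets_path_field_subset:
  assumes "space F = Omega0" "\<And>t. t \<in> I \<Longrightarrow> (\<lambda>\<omega>. \<omega> t) \<in> borel_measurable F"
  shows "sets (path_field I) \<subseteq> sets F"
proof
  fix A assume A: "A \<in> sets (path_field I)"
  have "(\<lambda>\<omega>. \<omega>) \<in> F \<rightarrow>\<^sub>M path_field I"
    by (rule measurable_path_fieldI) (use assms in auto)
  from measurable_sets[OF this A] sets.sets_into_space[OF A] show "A \<in> sets F"
    by (simp add: assms(1) Int_absorb2)
qed

lemma sets_path_field_mono: "I \<subseteq> J \<Longrightarrow> sets (path_field I) \<subseteq> sets (path_field J)"
  by (intro sets_path_field_subset) (auto intro: measurable_path_field_eval)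

text \<open>At the dyadic floor of the time the process is jointly measurable, since only countably
  many times occur; continuity of paths gives the limit.\<close>

lemma borel_measurable_continuous_process:
  fixes X :: "real \<Rightarrow> 'a \<Rightarrow> real"
  assumes meas: "\<And>t. X t \<in> borel_measurable F"
    and cont: "\<And>\<omega>. \<omega> \<in> space F \<Longrightarrow> continuous_on UNIV (\<lambda>t. X t \<omega>)"
  shows "(\<lambda>p. X (fst p) (snd p)) \<in> borel_measurable (borel \<Otimes>\<^sub>M F)"
proof (rule borel_measurable_LIMSEQ_real)
  fix p :: "real \<times> 'a" assume "p \<in> space (borel \<Otimes>\<^sub>M F)"
  then have "continuous_on UNIV (\<lambda>t. X t (snd p))"
    by (intro cont) (auto simp: space_pair_measure)
  then have "isCont (\<lambda>t. X t (snd p)) (fst p)"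
    by (simp add: continuous_on_eq_continuous_at)
  then show "(\<lambda>n. X (of_int \<lfloor>2 ^ n * fst p\<rfloor> / 2 ^ n) (snd p)) \<longlonglongrightarrow> X (fst p) (snd p)"
    using LIMSEQ_dyadic_floor by (rule isCont_tendsto_compose)
next
  fix n :: nat
  have "(\<lambda>p::real \<times> 'a. X (of_int k / 2 ^ n) (snd p)) \<in> borel_measurable (borel \<Otimes>\<^sub>M F)" for k :: int
    using measurable_compose[OF measurable_snd meas] .
  moreover have "(\<lambda>p. \<lfloor>2 ^ n * fst p\<rfloor>) \<in> (borel :: real measure) \<Otimes>\<^sub>M F \<rightarrow>\<^sub>M count_space UNIV"
    by measurable
  ultimately show "(\<lambda>p::real \<times> 'a. X (of_int \<lfloor>2 ^ n * fst p\<rfloor> / 2 ^ n) (snd p)) \<in> borel_measurable (borel \<Otimes>\<^sub>M F)"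
    by (rule measurable_compose_countable)
qed

text \<open>The time change \<open>c\<close> will clamp the time to a compact interval, so that for
  every value of the parameter only times in \<open>J\<close> are read. The assumption concerns
  increments alone, because evaluations need not be measurable in an increment field.\<close>

lemma measurable_levy_shift_pair:
  fixes c :: "real \<Rightarrow> real"
  assumes F: "space F = Omega0"
    and incr: "\<And>x y. x \<in> J \<Longrightarrow> y \<in> J \<Longrightarrow> (\<lambda>\<omega>. \<omega> x - \<omega> y) \<in> borel_measurable F"
    and c: "continuous_on UNIV c" "\<And>t. c t \<in> J" "\<And>t v. v \<in> I \<Longrightarrow> c t + v \<in> J"
  shows "(\<lambda>p. levy_shift (c (fst p)) (snd p)) \<in> borel \<Otimes>\<^sub>M F \<rightarrow>\<^sub>M path_field I"
proof (rule measurable_path_fieldI)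
  fix p assume "p \<in> space (borel \<Otimes>\<^sub>M F :: (real \<times> (real \<Rightarrow> real)) measure)"
  then show "levy_shift (c (fst p)) (snd p) \<in> Omega0"
    by (intro levy_shift_Omega0) (auto simp: space_pair_measure F)
next
  fix v assume v: "v \<in> I"
  show "(\<lambda>p. levy_shift (c (fst p)) (snd p) v) \<in> borel_measurable (borel \<Otimes>\<^sub>M F)"
  proof (rule borel_measurable_continuous_process)
    fix t
    show "(\<lambda>\<omega>. levy_shift (c t) \<omega> v) \<in> borel_measurable F"
      unfolding levy_shift_def by (intro incr c v)
  next
    fix \<omega> assume "\<omega> \<in> space F"
    then have \<omega>: "continuous_on UNIV \<omega>"
      by (simp add: F Omega0_continuous)
    have "continuous_on UNIV (\<lambda>t. \<omega> (c t + v))" "continuous_on UNIV (\<lambda>t. \<omega> (c t))"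
      by (rule continuous_on_compose2[OF \<omega>]; auto intro!: continuous_on_add continuous_on_const c(1))+
    then show "continuous_on UNIV (\<lambda>t. levy_shift (c t) \<omega> v)"
      unfolding levy_shift_def by (rule continuous_on_diff)
  qed
qed

section \<open>The Borel \<sigma>-field of the locally uniform topology\<close>

definition rat_box :: "rat \<times> rat \<times> rat \<times> rat \<Rightarrow> (real \<Rightarrow> real) set" where
  "rat_box = (\<lambda>(a, b, r, d). {\<eta> \<in> Omega0. \<forall>s\<in>{of_rat a..of_rat b}. \<bar>\<eta> s - of_rat r\<bar> \<le> of_rat d})"

lemma closure_rat_Icc:
  assumes "s \<in> {of_rat a..of_rat b :: real}"
  shows "s \<in> closure {q \<in> \<rat>. q \<in> {of_rat a..of_rat b :: real}}"
proof (cases "a < b")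
  case True
  then have ab: "of_rat a < (of_rat b :: real)"
    by (simp add: of_rat_less)
  have "{of_rat a<..<of_rat b} \<subseteq> closure ({of_rat a<..<of_rat b :: real} \<inter> \<rat>)"
    using open_Int_closure_subset[of "{of_rat a<..<of_rat b :: real}" \<rat>] by (simp add: Rats_closure_real)
  then have "closure {of_rat a<..<of_rat b} \<subseteq> closure ({of_rat a<..<of_rat b :: real} \<inter> \<rat>)"
    by (simp add: closure_minimal)
  also have "\<dots> \<subseteq> closure {q \<in> \<rat>. q \<in> {of_rat a..of_rat b :: real}}"
    by (intro closure_mono) auto
  finally show ?thesis
    using assms ab by (auto simp: closure_greaterThanLessThan)
next
  case False
  then have "(of_rat b :: real) \<le> of_rat a"
    by (simp add: of_rat_less_eq)
  then have "s = of_rat a"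
    using assms by simp
  then have "s \<in> {q \<in> \<rat>. q \<in> {of_rat a..of_rat b :: real}}"
    using assms by simp
  then show ?thesis
    using closure_subset by (rule rev_subsetD)
qed

text \<open>A weak inequality on a closed interval follows by continuity from its validity at
  rational times, which makes a box measurable for the evaluations.\<close>

lemma rat_box_countable_inter:
  "rat_box (a, b, r, d) =
    (\<Inter>q\<in>\<rat>. {\<eta> \<in> Omega0. q \<in> {of_rat a..of_rat b} \<longrightarrow> \<bar>\<eta> q - of_rat r\<bar> \<le> of_rat d})" (is "_ = ?R")
proof (intro set_eqI iffI)
  fix \<eta> assume "\<eta> \<in> ?R"
  then have \<eta>: "\<eta> \<in> Omega0" and le: "\<And>q. q \<in> {q \<in> \<rat>. q \<in> {of_rat a..of_rat b}} \<Longrightarrow> \<bar>\<eta> q - of_rat r\<bar> \<le> of_rat d"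
    by auto
  have "\<bar>\<eta> s - of_rat r\<bar> \<le> of_rat d" if "s \<in> {of_rat a..of_rat b}" for s
    by (rule continuous_le_on_closure[OF _ closure_rat_Icc[OF that] le])
      (intro continuous_intros Omega0_continuous \<eta>)
  then show "\<eta> \<in> rat_box (a, b, r, d)"
    using \<eta> by (simp add: rat_box_def)
qed (auto simp: rat_box_def)

lemma sets_rat_box: "rat_box p \<in> sets (path_field UNIV)"
proof -
  obtain a b r d where p: "p = (a, b, r, d)" by (cases p)
  have "{\<eta> \<in> Omega0. q \<in> {of_rat a..of_rat b} \<longrightarrow> \<bar>\<eta> q - of_rat r\<bar> \<le> of_rat d} \<in> sets (path_field UNIV)"
    for q :: real
  proof -
    let ?S = "{x::real. q \<in> {of_rat a..of_rat b} \<longrightarrow> \<bar>x - of_rat r\<bar> \<le> of_rat d}"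
    have "?S = (if q \<in> {of_rat a..of_rat b} then {of_rat r - of_rat d..of_rat r + of_rat d} else UNIV)"
      by auto
    then have "?S \<in> sets borel"
      by simp
    then have "(\<lambda>\<eta>. \<eta> q) -` ?S \<inter> space (path_field UNIV) \<in> sets (path_field UNIV)"
      by (rule measurable_sets[OF measurable_path_field_eval[OF UNIV_I]])
    moreover have "(\<lambda>\<eta>. \<eta> q) -` ?S \<inter> space (path_field UNIV) =
        {\<eta> \<in> Omega0. q \<in> {of_rat a..of_rat b} \<longrightarrow> \<bar>\<eta> q - of_rat r\<bar> \<le> of_rat d}"
      by auto
    ultimately show ?thesis by (simp only:)
  qed
  then have "(\<lambda>q. {\<eta> \<in> Omega0. q \<in> {of_rat a..of_rat b} \<longrightarrow> \<bar>\<eta> q - of_rat r\<bar> \<le> of_rat d}) ` \<rat>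
      \<subseteq> sets (path_field UNIV)"
    by (rule image_subsetI)
  moreover have "(\<rat> :: real set) \<noteq> {}"
    using Rats_0 by (metis empty_iff)
  ultimately show ?thesis
    unfolding p rat_box_countable_inter by (intro sets.countable_INT' countable_rat)
qed

text \<open>Compactness: finitely many short intervals cover \<open>K\<close>, and on each of them a
  rational box around a value of \<open>\<omega>\<close> controls the distance to
  \<open>\<omega>'\<close>.\<close>

lemma locally_uniform_basis_rat_boxes:
  assumes K: "compact K" and \<omega>': "\<omega>' \<in> Omega0" and \<omega>: "\<omega> \<in> Omega0" and e: "\<forall>t\<in>K. \<bar>\<omega> t - \<omega>' t\<bar> < e"
  shows "\<exists>F. finite F \<and> \<omega> \<in> (\<Inter>p\<in>F. rat_box p) \<and>
    Omega0 \<inter> (\<Inter>p\<in>F. rat_box p) \<subseteq> {\<eta> \<in> Omega0. \<forall>t\<in>K. \<bar>\<eta> t - \<omega>' t\<bar> < e}"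
proof -
  define ivl :: "rat \<times> rat \<times> rat \<times> rat \<Rightarrow> real set"
    where "ivl = (\<lambda>(a, b, r, d). {of_rat a<..<of_rat b})"
  have "\<exists>p. t \<in> ivl p \<and> \<omega> \<in> rat_box p \<and> (\<forall>\<eta>\<in>rat_box p. \<forall>s\<in>ivl p. \<bar>\<eta> s - \<omega>' s\<bar> < e)"
    if "t \<in> K" for t
  proof -
    \<comment> \<open>A box radius above \<open>2 * \<epsilon>\<close> lets \<open>\<omega>\<close>
      into the box. Kept below \<open>3 * \<epsilon>\<close>, it adds with the error of
      \<open>r\<close> and the oscillation of \<open>\<omega>'\<close> to less than
      \<open>5 * \<epsilon>\<close>, while \<open>6 * \<epsilon>\<close> is available.\<close>
    define \<epsilon> where "\<epsilon> = (e - \<bar>\<omega> t - \<omega>' t\<bar>) / 6"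
    have "\<epsilon> > 0"
      using e that by (auto simp: \<epsilon>_def)
    have "isCont \<omega> t" "isCont \<omega>' t"
      using \<omega> \<omega>' by (auto simp: Omega0_def continuous_on_eq_continuous_at)
    then obtain \<delta>1 \<delta>2 where \<delta>: "\<delta>1 > 0" "\<And>s. \<bar>s - t\<bar> < \<delta>1 \<Longrightarrow> \<bar>\<omega> s - \<omega> t\<bar> < \<epsilon>"
        "\<delta>2 > 0" "\<And>s. \<bar>s - t\<bar> < \<delta>2 \<Longrightarrow> \<bar>\<omega>' s - \<omega>' t\<bar> < \<epsilon>"
      unfolding continuous_at_eps_delta dist_real_def using \<open>\<epsilon> > 0\<close> by metis
    define \<delta> where "\<delta> = min \<delta>1 \<delta>2"
    have "\<delta> > 0" using \<delta> by (simp add: \<delta>_def)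
    obtain a where a: "t - \<delta> < of_rat a" "of_rat a < t"
      using of_rat_dense[of "t - \<delta>" t] \<open>\<delta> > 0\<close> by auto
    obtain b where b: "t < of_rat b" "of_rat b < t + \<delta>"
      using of_rat_dense[of t "t + \<delta>"] \<open>\<delta> > 0\<close> by auto
    obtain r where r: "\<omega> t - \<epsilon> < of_rat r" "of_rat r < \<omega> t + \<epsilon>"
      using of_rat_dense[of "\<omega> t - \<epsilon>" "\<omega> t + \<epsilon>"] \<open>\<epsilon> > 0\<close> by auto
    obtain d where d: "2 * \<epsilon> < of_rat d" "of_rat d < 3 * \<epsilon>"
      using of_rat_dense[of "2 * \<epsilon>" "3 * \<epsilon>"] \<open>\<epsilon> > 0\<close> by auto
    have near: "\<bar>\<omega> s - \<omega> t\<bar> < \<epsilon>" "\<bar>\<omega>' s - \<omega>' t\<bar> < \<epsilon>" if "s \<in> {of_rat a..of_rat b}" for s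
      using that a b by (auto intro!: \<delta> simp: \<delta>_def)
    have "\<omega> \<in> rat_box (a, b, r, d)"
      unfolding rat_box_def using \<omega>
    proof (simp, intro ballI)
      fix s assume "s \<in> {of_rat a..of_rat b :: real}"
      then show "\<bar>\<omega> s - of_rat r\<bar> \<le> of_rat d"
        using near(1)[of s] r d by linarith
    qed
    moreover have "\<bar>\<eta> s - \<omega>' s\<bar> < e" if "\<eta> \<in> rat_box (a, b, r, d)" "s \<in> {of_rat a<..<of_rat b}" for \<eta> s
    proof -
      have "\<bar>\<eta> s - of_rat r\<bar> \<le> of_rat d"
        using that by (auto simp: rat_box_def)
      moreover have "\<bar>\<omega>' s - \<omega>' t\<bar> < \<epsilon>"
        using that by (intro near) auto
      moreover have "6 * \<epsilon> = e - \<bar>\<omega> t - \<omega>' t\<bar>"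
        by (simp add: \<epsilon>_def)
      ultimately show ?thesis
        using r d by linarith
    qed
    ultimately show ?thesis
      using a b by (intro exI[of _ "(a, b, r, d)"]) (auto simp: ivl_def)
  qed
  from bchoice[OF ballI[OF this]] obtain p where box: "\<forall>t\<in>K. t \<in> ivl (p t) \<and> \<omega> \<in> rat_box (p t) \<and>
      (\<forall>\<eta>\<in>rat_box (p t). \<forall>s\<in>ivl (p t). \<bar>\<eta> s - \<omega>' s\<bar> < e)" ..
  have "open (ivl (p t))" for t
    by (auto simp: ivl_def split: prod.splits)
  moreover have "K \<subseteq> (\<Union>t\<in>K. ivl (p t))"
    using box by blast
  ultimately obtain T where T: "T \<subseteq> K" "finite T" "K \<subseteq> (\<Union>t\<in>T. ivl (p t))"
    by (rule compactE_image[OF K])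
  let ?F = "p ` T"
  have "\<bar>\<eta> s - \<omega>' s\<bar> < e" if "\<eta> \<in> (\<Inter>p\<in>?F. rat_box p)" "s \<in> K" for \<eta> s
  proof -
    obtain t where t: "t \<in> T" "s \<in> ivl (p t)"
      using T(3) \<open>s \<in> K\<close> by blast
    then have "t \<in> K" "\<eta> \<in> rat_box (p t)"
      using T(1) that(1) by auto
    then show ?thesis
      using box t(2) by blast
  qed
  moreover have "\<omega> \<in> (\<Inter>p\<in>?F. rat_box p)"
    using T(1) box by auto
  ultimately show ?thesis
    using T(2) by (intro exI[of _ ?F]) auto
qed

lemma openin_locally_uniform_rat_boxes:
  assumes "openin locally_uniform_topology U" "\<omega> \<in> U"
  shows "\<omega> \<in> Omega0 \<and> (\<exists>F. finite F \<and> \<omega> \<in> (\<Inter>p\<in>F. rat_box p) \<and> Omega0 \<inter> (\<Inter>p\<in>F. rat_box p) \<subseteq> U)"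
  using assms unfolding locally_uniform_topology_def openin_topology_generated_by_iff
proof (induction arbitrary: \<omega> rule: generate_topology_on.induct)
  case (Int U V)
  from Int.IH(1)[of \<omega>] Int.IH(2)[of \<omega>] Int.prems obtain F G where \<omega>: "\<omega> \<in> Omega0"
    and "finite F" "\<omega> \<in> (\<Inter>p\<in>F. rat_box p)" "Omega0 \<inter> (\<Inter>p\<in>F. rat_box p) \<subseteq> U"
    and "finite G" "\<omega> \<in> (\<Inter>p\<in>G. rat_box p)" "Omega0 \<inter> (\<Inter>p\<in>G. rat_box p) \<subseteq> V"
    by auto
  then show ?case
    by (intro conjI exI[of _ "F \<union> G"]) auto
next
  case (UN K)
  from UN.prems obtain k where k: "k \<in> K" "\<omega> \<in> k" by auto
  from UN.IH[OF k] obtain F where "\<omega> \<in> Omega0" "finite F" "\<omega> \<in> (\<Inter>p\<in>F. rat_box p)"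
    "Omega0 \<inter> (\<Inter>p\<in>F. rat_box p) \<subseteq> k" by (elim conjE exE)
  then show ?case
    using k(1) by (intro conjI exI[of _ F]) auto
next
  case (Basis s)
  then show ?case
    using locally_uniform_basis_rat_boxes by auto
qed simp

lemma sets_borel_Omega0: "sets borel_Omega0 = sets (path_field UNIV)"
proof -
  have sub: "{U. openin locally_uniform_topology U} \<subseteq> Pow Omega0"
    using openin_locally_uniform_rat_boxes by blast
  then have sp: "space borel_Omega0 = Omega0"
    by (simp add: borel_Omega0_def)
  show "sets borel_Omega0 = sets (path_field UNIV)"
  proof
    have "(\<lambda>\<omega>. \<omega> t) \<in> borel_measurable borel_Omega0" for t
    proof (rule borel_measurableI)
      fix S :: "real set" assume "open S"
      have "openin locally_uniform_topology ((\<lambda>\<omega>. \<omega> t) -` S \<inter> Omega0)"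
      proof (subst openin_subopen, intro ballI)
        fix \<omega> assume \<omega>: "\<omega> \<in> (\<lambda>\<omega>. \<omega> t) -` S \<inter> Omega0"
        then obtain e where e: "e > 0" "\<And>y. \<bar>y - \<omega> t\<bar> < e \<Longrightarrow> y \<in> S"
          using \<open>open S\<close> by (auto simp: open_dist dist_real_def)
        let ?T = "{\<eta> \<in> Omega0. \<forall>s\<in>{t}. \<bar>\<eta> s - \<omega> s\<bar> < e}"
        have "openin locally_uniform_topology ?T"
          unfolding locally_uniform_topology_def
        proof (rule topology_generated_by_Basis)
          show "?T \<in> {{\<eta> \<in> Omega0. \<forall>t\<in>K. \<bar>\<eta> t - \<omega> t\<bar> < e} | \<omega> K e. \<omega> \<in> Omega0 \<and> compact K \<and> e > 0}"
            using \<omega> e(1) compact_sing[of t] by blast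
        qed
        moreover have "\<omega> \<in> ?T" "?T \<subseteq> (\<lambda>\<omega>. \<omega> t) -` S \<inter> Omega0"
          using \<omega> e by auto
        ultimately show "\<exists>T. openin locally_uniform_topology T \<and> \<omega> \<in> T \<and> T \<subseteq> (\<lambda>\<omega>. \<omega> t) -` S \<inter> Omega0"
          by blast
      qed
      then have "(\<lambda>\<omega>. \<omega> t) -` S \<inter> Omega0 \<in> sets borel_Omega0"
        using sub by (auto simp: borel_Omega0_def)
      then show "(\<lambda>\<omega>. \<omega> t) -` S \<inter> space borel_Omega0 \<in> sets borel_Omega0"
        by (simp only: sp)
    qed
    then show "sets (path_field UNIV) \<subseteq> sets borel_Omega0"
      by (intro sets_path_field_subset sp)
  next
    have "U \<in> sets (path_field UNIV)" if U: "openin locally_uniform_topology U" for U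
    proof -
      let ?V = "\<lambda>l. Omega0 \<inter> (\<Inter>p\<in>set l. rat_box p)"
      have "?V l \<in> sets (path_field UNIV)" for l
      proof (induction l)
        case Nil
        then show ?case using sets.top[of "path_field UNIV"] by simp
      next
        case (Cons p l)
        have "?V (p # l) = rat_box p \<inter> ?V l" by auto
        then show ?case
          using Cons sets_rat_box by auto
      qed
      \<comment> \<open>There are only countably many finite lists of rational boxes, so this is a
        countable union.\<close>
      moreover have "U = (\<Union>l\<in>{l. ?V l \<subseteq> U}. ?V l)"
      proof (intro set_eqI iffI)
        fix \<omega> assume "\<omega> \<in> U"
        from openin_locally_uniform_rat_boxes[OF U this] obtain F where F: "\<omega> \<in> Omega0" "finite F"
          "\<omega> \<in> (\<Inter>p\<in>F. rat_box p)" "Omega0 \<inter> (\<Inter>p\<in>F. rat_box p) \<subseteq> U" by blast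
        obtain l where "set l = F"
          using finite_list[OF F(2)] by blast
        then show "\<omega> \<in> (\<Union>l\<in>{l. ?V l \<subseteq> U}. ?V l)"
          using F by auto
      qed auto
      moreover have "(\<Union>l\<in>{l. ?V l \<subseteq> U}. ?V l) \<in> sets (path_field UNIV)"
        using calculation(1) by (intro sets.countable_UN'') auto
      ultimately show ?thesis by simp
    qed
    then show "sets borel_Omega0 \<subseteq> sets (path_field UNIV)"
      unfolding borel_Omega0_def sets_measure_of[OF sub]
      using sets.sigma_sets_subset[of "{U. openin locally_uniform_topology U}" "path_field UNIV"] by auto
  qed
qed


section \<open>Shift invariance of Wiener measure\<close>

lemma prod_lessThan_add: "prod g {..<k + m} = prod g {..<k} * (\<Prod>j<m. g (k + j))" for g :: "nat \<Rightarrow> real"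
  by (induction m) (simp_all add: mult.assoc)

lemma brownian_increments_prob:
  assumes X: "standard_brownian_motion P X" and \<tau>: "0 \<le> \<tau> 0" "\<And>i. i < n \<Longrightarrow> \<tau> i < \<tau> (Suc i)"
    and E: "\<And>i. i < n \<Longrightarrow> E i \<in> sets borel"
  shows "measure P {\<omega> \<in> space P. \<forall>i<n. X (\<tau> (Suc i)) \<omega> - X (\<tau> i) \<omega> \<in> E i} =
    (\<Prod>i<n. measure P {\<omega> \<in> space P. X (\<tau> (Suc i)) \<omega> - X (\<tau> i) \<omega> \<in> E i})"
proof -
  interpret prob_space P
    using X by (simp add: standard_brownian_motion_def)
  show ?thesis
  \<comment> \<open>The product formula for independent variables requires a nonempty index
    set.\<close>
  proof (cases "n = 0")
    case True
    then show ?thesis by (simp add: prob_space)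
  next
    case False
    have "indep_vars (\<lambda>_. borel) (\<lambda>i \<omega>. X (\<tau> (Suc i)) \<omega> - X (\<tau> i) \<omega>) {..<n}"
      using X \<tau> unfolding standard_brownian_motion_def by blast
    from indep_varsD_finite[OF this, of E] E False
    have "measure P (\<Inter>i<n. (\<lambda>\<omega>. X (\<tau> (Suc i)) \<omega> - X (\<tau> i) \<omega>) -` E i \<inter> space P) =
        (\<Prod>i<n. measure P ((\<lambda>\<omega>. X (\<tau> (Suc i)) \<omega> - X (\<tau> i) \<omega>) -` E i \<inter> space P))"
      by (simp add: lessThan_empty_iff)
    moreover have "(\<lambda>\<omega>. X (\<tau> (Suc i)) \<omega> - X (\<tau> i) \<omega>) -` E i \<inter> space P =
        {\<omega> \<in> space P. X (\<tau> (Suc i)) \<omega> - X (\<tau> i) \<omega> \<in> E i}" for i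
      by auto
    moreover have "(\<Inter>i<n. (\<lambda>\<omega>. X (\<tau> (Suc i)) \<omega> - X (\<tau> i) \<omega>) -` E i \<inter> space P) =
        {\<omega> \<in> space P. \<forall>i<n. X (\<tau> (Suc i)) \<omega> - X (\<tau> i) \<omega> \<in> E i}"
      using False by auto
    ultimately show ?thesis by simp
  qed
qed

lemma two_sided_wienerD:
  assumes "two_sided_wiener P"
  shows "prob_space P" "sets P = sets (path_field UNIV)" "space P = Omega0"
    and "standard_brownian_motion P (\<lambda>t \<omega>. \<omega> t)" "standard_brownian_motion P (\<lambda>t \<omega>. \<omega> (- t))"
    and "prob_space.indep_var P
       (Pi\<^sub>M {0..} (\<lambda>_. borel)) (\<lambda>\<omega>. \<lambda>t\<in>{0..}. \<omega> t)
       (Pi\<^sub>M {0..} (\<lambda>_. borel)) (\<lambda>\<omega>. \<lambda>t\<in>{0..}. \<omega> (- t))"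
proof -
  show sets: "sets P = sets (path_field UNIV)"
    using assms by (simp add: two_sided_wiener_def sets_borel_Omega0)
  show "space P = Omega0"
    using sets_eq_imp_space_eq[OF sets] by simp
qed (use assms in \<open>simp_all add: two_sided_wiener_def\<close>)

lemma measurable_two_sided_wiener_eval:
  assumes "two_sided_wiener P"
  shows "(\<lambda>\<omega>. \<omega> t) \<in> borel_measurable P"
  using measurable_path_field_eval[of t UNIV] measurable_cong_sets[OF two_sided_wienerD(2)[OF assms] refl]
  by blast

text \<open>To the left of the origin time is reversed, which changes the sign of the increment; the
  centred normal law is symmetric.\<close>

lemma wiener_increment_distributed:
  assumes P: "two_sided_wiener P" and "s < t" "t \<le> 0 \<or> 0 \<le> s"
  shows "distributed P lborel (\<lambda>\<omega>. \<omega> t - \<omega> s) (normal_density 0 (sqrt (t - s)))"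
proof (cases "0 \<le> s")
  case True
  then show ?thesis
    using two_sided_wienerD(4)[OF P] \<open>s < t\<close> by (simp add: standard_brownian_motion_def)
next
  case False
  interpret prob_space P by (rule two_sided_wienerD(1)[OF P])
  have st: "0 \<le> - t \<and> - t < - s"
    using assms False by auto
  have "\<forall>s t. 0 \<le> s \<and> s < t \<longrightarrow>
      distributed P lborel (\<lambda>\<omega>. \<omega> (- t) - \<omega> (- s)) (normal_density 0 (sqrt (t - s)))"
    using two_sided_wienerD(5)[OF P] by (simp add: standard_brownian_motion_def)
  from this[rule_format, OF st]
  have "distributed P lborel (\<lambda>\<omega>. \<omega> s - \<omega> t) (normal_density 0 (sqrt (t - s)))"
    by simp
  from normal_density_affine[OF this, of "-1" 0] \<open>s < t\<close> show ?thesis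
    by simp
qed

lemma sets_PiM_increments:
  fixes n :: nat
  assumes "\<And>i. i < n \<Longrightarrow> a i \<in> I" "\<And>i. i < n \<Longrightarrow> b i \<in> I" "\<And>i. i < n \<Longrightarrow> E i \<in> sets borel"
  shows "{g \<in> space (Pi\<^sub>M I (\<lambda>_. borel)). \<forall>i\<in>{..<n}. g (a i) - g (b i) \<in> E i}
    \<in> sets (Pi\<^sub>M I (\<lambda>_. borel :: real measure))"
proof (rule sets.sets_Collect_finite_All)
  fix i assume "i \<in> {..<n}"
  then have "(\<lambda>g. g (a i) - g (b i)) \<in> borel_measurable (Pi\<^sub>M I (\<lambda>_. borel :: real measure))"
    using assms by (intro borel_measurable_diff measurable_component_singleton) auto
  from measurable_sets[OF this, of "E i"]
  show "{g \<in> space (Pi\<^sub>M I (\<lambda>_. borel)). g (a i) - g (b i) \<in> E i} \<in> sets (Pi\<^sub>M I (\<lambda>_. borel :: real measure))"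
    using assms(3) \<open>i \<in> {..<n}\<close> by (simp add: vimage_def Int_def conj_commute)
qed simp

text \<open>With a node at the origin, each increment belongs to one of the two independent
  half-line motions, and the product formula holds within each of these.\<close>

lemma wiener_grid_independent:
  assumes P: "two_sided_wiener P" and \<tau>: "\<And>i. i < k + m \<Longrightarrow> \<tau> i < \<tau> (Suc i)" "\<tau> k = 0"
    and E: "\<And>i. i < k + m \<Longrightarrow> E i \<in> sets borel"
  shows "measure P {\<omega> \<in> Omega0. \<forall>i<k + m. \<omega> (\<tau> (Suc i)) - \<omega> (\<tau> i) \<in> E i} =
    (\<Prod>i<k + m. measure P {\<omega> \<in> Omega0. \<omega> (\<tau> (Suc i)) - \<omega> (\<tau> i) \<in> E i})"
proof -
  interpret prob_space P by (rule two_sided_wienerD(1)[OF P])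
  note sp = two_sided_wienerD(3)[OF P]
  have mono: "\<tau> i \<le> \<tau> j" if "i \<le> j" "j \<le> k + m" for i j
    using that
  proof (induction j rule: dec_induct)
    case (step j)
    then show ?case using \<tau>(1)[of j] by simp
  qed simp
  define p where "p i = measure P {\<omega> \<in> Omega0. \<omega> (\<tau> (Suc i)) - \<omega> (\<tau> i) \<in> E i}" for i
  let ?Pos = "{\<omega> \<in> Omega0. \<forall>j<m. \<omega> (\<tau> (Suc (k + j))) - \<omega> (\<tau> (k + j)) \<in> E (k + j)}"
  let ?Neg = "{\<omega> \<in> Omega0. \<forall>i<k. \<omega> (\<tau> (Suc i)) - \<omega> (\<tau> i) \<in> E i}"
  have pos: "measure P ?Pos = (\<Prod>j<m. p (k + j))"
    using brownian_increments_prob[OF two_sided_wienerD(4)[OF P], of "\<lambda>j. \<tau> (k + j)" m "\<lambda>j. E (k + j)"] \<tau> E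
    by (simp add: sp p_def)
  have neg: "measure P ?Neg = prod p {..<k}"
  proof -
    \<comment> \<open>The nodes left of 0, reflected and read backwards, form an increasing grid for
      the reversed motion. \<open>E'\<close> carries the minus sign of the reversed
      increments.\<close>
    define \<sigma> where "\<sigma> j = - \<tau> (k - j)" for j
    define E' where "E' j = uminus -` E (k - Suc j)" for j
    have \<sigma>: "\<omega> (- \<sigma> (Suc j)) - \<omega> (- \<sigma> j) \<in> E' j \<longleftrightarrow>
        \<omega> (\<tau> (Suc (k - Suc j))) - \<omega> (\<tau> (k - Suc j)) \<in> E (k - Suc j)" if "j < k" for j and \<omega> :: "real \<Rightarrow> real"
      using that by (simp add: \<sigma>_def E'_def Suc_diff_Suc)
    have "measure P {\<omega> \<in> space P. \<forall>j<k. \<omega> (- \<sigma> (Suc j)) - \<omega> (- \<sigma> j) \<in> E' j} =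
        (\<Prod>j<k. measure P {\<omega> \<in> space P. \<omega> (- \<sigma> (Suc j)) - \<omega> (- \<sigma> j) \<in> E' j})"
    proof (rule brownian_increments_prob[OF two_sided_wienerD(5)[OF P]])
      show "0 \<le> \<sigma> 0" by (simp add: \<sigma>_def \<tau>)
    next
      fix j assume "j < k"
      then show "\<sigma> j < \<sigma> (Suc j)"
        using \<tau>(1)[of "k - Suc j"] by (simp add: \<sigma>_def Suc_diff_Suc)
      have "E (k - Suc j) \<in> sets borel"
        using \<open>j < k\<close> by (intro E) auto
      from measurable_sets[OF _ this, of uminus borel] show "E' j \<in> sets borel"
        by (simp add: E'_def)
    qed
    moreover have "{\<omega> \<in> space P. \<forall>j<k. \<omega> (- \<sigma> (Suc j)) - \<omega> (- \<sigma> j) \<in> E' j} = ?Neg"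
    proof -
      have "(\<forall>j<k. Q (k - Suc j)) \<longleftrightarrow> (\<forall>i<k. Q i)" for Q
      proof
        assume Q: "\<forall>j<k. Q (k - Suc j)"
        show "\<forall>i<k. Q i"
        proof (intro allI impI)
          fix i assume "i < k"
          then show "Q i" using Q[rule_format, of "k - Suc i"] by simp
        qed
      qed simp
      from this[of "\<lambda>i. \<omega> (\<tau> (Suc i)) - \<omega> (\<tau> i) \<in> E i" for \<omega>]
      show ?thesis
        using \<sigma> by (auto simp: sp)
    qed
    moreover have "(\<Prod>j<k. measure P {\<omega> \<in> space P. \<omega> (- \<sigma> (Suc j)) - \<omega> (- \<sigma> j) \<in> E' j}) =
        (\<Prod>j<k. p (k - Suc j))"
      using \<sigma> by (intro prod.cong) (auto simp: p_def sp)
    ultimately show ?thesis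
      by (simp add: prod.nat_diff_reindex)
  qed
  let ?M = "Pi\<^sub>M {0..} (\<lambda>_. borel) :: (real \<Rightarrow> real) measure"
  \<comment> \<open>Independence is given for the two halves as random elements of a product space,
    so both events are pulled back from there. \<open>?B\<close> negates the times because the left
    half is parametrized by reversed time.\<close>
  let ?A = "{g \<in> space ?M. \<forall>j\<in>{..<m}. g (\<tau> (Suc (k + j))) - g (\<tau> (k + j)) \<in> E (k + j)}"
  let ?B = "{g \<in> space ?M. \<forall>i\<in>{..<k}. g (- \<tau> (Suc i)) - g (- \<tau> i) \<in> E i}"
  have pos_times: "0 \<le> \<tau> (k + j)" if "j \<le> m" for j
    using mono[of k "k + j"] that \<tau>(2) by simp
  have neg_times: "\<tau> i \<le> 0" if "i \<le> k" for i
    using mono[of i k] that \<tau>(2) by simp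
  have "?A \<in> sets ?M"
    using pos_times[of "Suc _"] pos_times E by (intro sets_PiM_increments) auto
  have "?B \<in> sets ?M"
    using neg_times E by (intro sets_PiM_increments) auto
  have pair_vimage: "(\<lambda>x. (f x, g x)) -` (A \<times> B) \<inter> S = (f -` A \<inter> S) \<inter> (g -` B \<inter> S)"
    for f g :: "(real \<Rightarrow> real) \<Rightarrow> real \<Rightarrow> real" and A B S
    by auto
  from \<open>?A \<in> sets ?M\<close> \<open>?B \<in> sets ?M\<close> have "prob ((\<lambda>x. ((\<lambda>t\<in>{0..}. x t), (\<lambda>t\<in>{0..}. x (- t)))) -` (?A \<times> ?B) \<inter> space P) =
      prob ((\<lambda>\<omega>. \<lambda>t\<in>{0..}. \<omega> t) -` ?A \<inter> space P) * prob ((\<lambda>\<omega>. \<lambda>t\<in>{0..}. \<omega> (- t)) -` ?B \<inter> space P)"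
    by (rule indep_varD[OF two_sided_wienerD(6)[OF P]])
  moreover have A: "(\<lambda>\<omega>. \<lambda>t\<in>{0..}. \<omega> t) -` ?A \<inter> space P = ?Pos"
    using pos_times[of "Suc _"] pos_times by (auto simp: sp space_PiM)
  moreover have B: "(\<lambda>\<omega>. \<lambda>t\<in>{0..}. \<omega> (- t)) -` ?B \<inter> space P = ?Neg"
    using neg_times by (auto simp: sp space_PiM)
  moreover have "(\<lambda>x. ((\<lambda>t\<in>{0..}. x t), (\<lambda>t\<in>{0..}. x (- t)))) -` (?A \<times> ?B) \<inter> space P = ?Pos \<inter> ?Neg"
    unfolding A[symmetric] B[symmetric] by (rule pair_vimage)
  moreover have "?Pos \<inter> ?Neg = {\<omega> \<in> Omega0. \<forall>i<k + m. \<omega> (\<tau> (Suc i)) - \<omega> (\<tau> i) \<in> E i}"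
  proof -
    have "(\<forall>i<k + m. Q i) \<longleftrightarrow> (\<forall>i<k. Q i) \<and> (\<forall>j<m. Q (k + j))" for Q
    proof (intro iffI conjI)
      assume Q: "(\<forall>i<k. Q i) \<and> (\<forall>j<m. Q (k + j))"
      show "\<forall>i<k + m. Q i"
      proof (intro allI impI)
        fix i assume "i < k + m"
        then show "Q i"
          using Q[THEN conjunct1, rule_format, of i] Q[THEN conjunct2, rule_format, of "i - k"] by (cases "i < k") auto
      qed
    qed auto
    from this[of "\<lambda>i. \<omega> (\<tau> (Suc i)) - \<omega> (\<tau> i) \<in> E i" for \<omega>]
    show ?thesis by auto
  qed
  ultimately have "prob {\<omega> \<in> Omega0. \<forall>i<k + m. \<omega> (\<tau> (Suc i)) - \<omega> (\<tau> i) \<in> E i} =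
      (\<Prod>j<m. p (k + j)) * prod p {..<k}"
    using pos neg by (simp only:)
  then show ?thesis
    by (simp add: prod_lessThan_add p_def)
qed

text \<open>The right-hand side depends on the grid through its gaps only. Two grids that are
  translates of each other, both containing 0, therefore give the same probability.\<close>

lemma wiener_grid_prob:
  assumes P: "two_sided_wiener P" and \<tau>: "\<And>i. i < n \<Longrightarrow> \<tau> i < \<tau> (Suc i)" "\<tau> k = 0" "k \<le> n"
    and E: "\<And>i. i < n \<Longrightarrow> E i \<in> sets borel"
  shows "measure P {\<omega> \<in> Omega0. \<forall>i<n. \<omega> (\<tau> (Suc i)) - \<omega> (\<tau> i) \<in> E i} =
    (\<Prod>i<n. measure (density lborel (normal_density 0 (sqrt (\<tau> (Suc i) - \<tau> i)))) (E i))"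
proof -
  obtain m where n: "n = k + m"
    using \<open>k \<le> n\<close> le_Suc_ex by blast
  have mono: "\<tau> i \<le> \<tau> j" if "i \<le> j" "j \<le> n" for i j
    using that
  proof (induction j rule: dec_induct)
    case (step j)
    then show ?case using \<tau>(1)[of j] by simp
  qed simp
  have "measure P {\<omega> \<in> Omega0. \<omega> (\<tau> (Suc i)) - \<omega> (\<tau> i) \<in> E i} =
      measure (density lborel (normal_density 0 (sqrt (\<tau> (Suc i) - \<tau> i)))) (E i)" if "i < n" for i
  proof -
    have "\<tau> (Suc i) \<le> 0 \<or> 0 \<le> \<tau> i"
      using mono[of "Suc i" k] mono[of k i] \<tau>(2,3) that by (cases "i < k") auto
    then have d: "distributed P lborel (\<lambda>\<omega>. \<omega> (\<tau> (Suc i)) - \<omega> (\<tau> i)) (normal_density 0 (sqrt (\<tau> (Suc i) - \<tau> i)))"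
      by (intro wiener_increment_distributed P \<tau> that)
    have "measure (distr P lborel (\<lambda>\<omega>. \<omega> (\<tau> (Suc i)) - \<omega> (\<tau> i))) (E i) =
        measure P ((\<lambda>\<omega>. \<omega> (\<tau> (Suc i)) - \<omega> (\<tau> i)) -` E i \<inter> space P)"
      by (rule measure_distr[OF distributed_measurable[OF d]]) (simp add: E that)
    also have "(\<lambda>\<omega>. \<omega> (\<tau> (Suc i)) - \<omega> (\<tau> i)) -` E i \<inter> space P = {\<omega> \<in> Omega0. \<omega> (\<tau> (Suc i)) - \<omega> (\<tau> i) \<in> E i}"
      by (auto simp: two_sided_wienerD(3)[OF P])
    finally show ?thesis
      by (simp add: distributed_distr_eq_density[OF d])
  qed
  then show ?thesis
    using wiener_grid_independent[OF P, of k m \<tau> E] \<tau> E by (simp add: n)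
qed

lemma measurable_levy_shift:
  assumes P: "two_sided_wiener P"
  shows "levy_shift u \<in> P \<rightarrow>\<^sub>M P"
proof -
  have "levy_shift u \<in> P \<rightarrow>\<^sub>M path_field UNIV"
  proof (rule measurable_path_fieldI)
    show "levy_shift u \<omega> \<in> Omega0" if "\<omega> \<in> space P" for \<omega>
      using that levy_shift_Omega0 by (simp add: two_sided_wienerD(3)[OF P])
    show "(\<lambda>\<omega>. levy_shift u \<omega> t) \<in> borel_measurable P" for t
      unfolding levy_shift_def by (intro borel_measurable_diff measurable_two_sided_wiener_eval P)
  qed
  then show ?thesis
    by (simp add: two_sided_wienerD(2)[OF P] cong: measurable_cong_sets)
qed

text \<open>The finite-dimensional distributions on a grid of times are determined by the increments
  because the grid contains \<open>0\<close>, where every path vanishes; the shifted grid has to contain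
  \<open>0\<close> as well, so that no increment straddles the origin.\<close>

lemma wiener_shift_cylinder:
  assumes P: "two_sided_wiener P" and T: "finite T" "0 \<in> T" "- u \<in> T"
    and A: "\<And>t. t \<in> T \<Longrightarrow> A t \<in> sets borel"
  shows "measure P {\<omega> \<in> Omega0. \<forall>t\<in>T. levy_shift u \<omega> t \<in> A t} = measure P {\<omega> \<in> Omega0. \<forall>t\<in>T. \<omega> t \<in> A t}"
proof -
  interpret prob_space P by (rule two_sided_wienerD(1)[OF P])
  note sp = two_sided_wienerD(3)[OF P]
  define l where "l = sorted_list_of_set T"
  define n where "n = length l - 1"
  define \<tau> where "\<tau> i = l ! i" for i
  have l: "set l = T" "sorted_wrt (<) l"
    using T(1) by (simp_all add: l_def)
  have len: "length l = Suc n"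
    using l(1) T(2) by (cases l) (auto simp: n_def)
  have \<tau>_less: "\<tau> i < \<tau> (Suc i)" if "i < n" for i
    using that sorted_wrt_nth_less[OF l(2), of i "Suc i"] by (simp add: \<tau>_def len)
  have T_eq: "T = \<tau> ` {..n}"
    using l(1) by (force simp: \<tau>_def set_conv_nth len less_Suc_eq_le)
  obtain k where k: "k \<le> n" "\<tau> k = 0"
    using T(2) unfolding T_eq by (metis atMost_iff imageE)
  \<comment> \<open>The node \<open>- u\<close> is the one that lies at the origin once the grid is
    translated by \<open>u\<close>.\<close>
  obtain k' where k': "k' \<le> n" "\<tau> k' = - u"
    using T(3) unfolding T_eq by (metis atMost_iff imageE)
  let ?M = "Pi\<^sub>M {..<n} (\<lambda>_. borel) :: (nat \<Rightarrow> real) measure"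
  define V where "V \<omega> = (\<lambda>i\<in>{..<n}. \<omega> (\<tau> (Suc i)) - \<omega> (\<tau> i))" for \<omega> :: "real \<Rightarrow> real"
  have V[measurable]: "V \<in> P \<rightarrow>\<^sub>M ?M"
    unfolding V_def
    by (intro measurable_restrict borel_measurable_diff measurable_two_sided_wiener_eval P)
  have V_shift[measurable]: "(\<lambda>\<omega>. V (levy_shift u \<omega>)) \<in> P \<rightarrow>\<^sub>M ?M"
    using measurable_compose[OF measurable_levy_shift[OF P] V] .
  have "distr P ?M V = distr P ?M (\<lambda>\<omega>. V (levy_shift u \<omega>))"
  proof (rule measure_eqI_PiM_finite[where A="\<lambda>_. \<Pi>\<^sub>E i\<in>{..<n}. UNIV"])
    fix B :: "nat \<Rightarrow> real set" assume B: "\<And>i. i \<in> {..<n} \<Longrightarrow> B i \<in> sets borel"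
    have B': "Pi\<^sub>E {..<n} B \<in> sets ?M"
      using B by (intro sets_PiM_I_finite) auto
    have V_B: "V \<eta> \<in> Pi\<^sub>E {..<n} B \<longleftrightarrow> (\<forall>i<n. \<eta> (\<tau> (Suc i)) - \<eta> (\<tau> i) \<in> B i)" for \<eta>
      by (simp add: V_def restrict_PiE_iff Pi_iff Ball_def)
    have V1: "V -` Pi\<^sub>E {..<n} B \<inter> space P = {\<omega> \<in> Omega0. \<forall>i<n. \<omega> (\<tau> (Suc i)) - \<omega> (\<tau> i) \<in> B i}"
      by (simp add: vimage_def Int_def V_B sp conj_commute)
    have V2: "(\<lambda>\<omega>. V (levy_shift u \<omega>)) -` Pi\<^sub>E {..<n} B \<inter> space P =
        {\<omega> \<in> Omega0. \<forall>i<n. \<omega> (u + \<tau> (Suc i)) - \<omega> (u + \<tau> i) \<in> B i}"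
      by (simp add: vimage_def Int_def V_B sp conj_commute) (simp add: levy_shift_def)
    have "measure P (V -` Pi\<^sub>E {..<n} B \<inter> space P) =
        measure P {\<omega> \<in> Omega0. \<forall>i<n. \<omega> (\<tau> (Suc i)) - \<omega> (\<tau> i) \<in> B i}"
      by (simp only: V1)
    also have "\<dots> = (\<Prod>i<n. measure (density lborel (normal_density 0 (sqrt (\<tau> (Suc i) - \<tau> i)))) (B i))"
      by (rule wiener_grid_prob[OF P \<tau>_less k(2) k(1)]) (use B in auto)
    also have "\<dots> = measure P {\<omega> \<in> Omega0. \<forall>i<n. \<omega> (u + \<tau> (Suc i)) - \<omega> (u + \<tau> i) \<in> B i}"
      using wiener_grid_prob[OF P, of n "\<lambda>i. u + \<tau> i" k' B] \<tau>_less k' B by simp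
    also have "\<dots> = measure P ((\<lambda>\<omega>. V (levy_shift u \<omega>)) -` Pi\<^sub>E {..<n} B \<inter> space P)"
      by (simp only: V2)
    finally show "emeasure (distr P ?M V) (Pi\<^sub>E {..<n} B) =
        emeasure (distr P ?M (\<lambda>\<omega>. V (levy_shift u \<omega>))) (Pi\<^sub>E {..<n} B)"
      using B' by (simp add: emeasure_distr emeasure_eq_measure)
  next
    show "range (\<lambda>_::nat. \<Pi>\<^sub>E i\<in>{..<n}. UNIV) \<subseteq> prod_algebra {..<n} (\<lambda>_. borel :: real measure)"
      by (auto intro!: prod_algebraI_finite)
    show "emeasure (distr P ?M V) (\<Pi>\<^sub>E i\<in>{..<n}. UNIV) \<noteq> \<infinity>" for i :: nat
      using prob_space.emeasure_space_1[OF prob_space_distr[OF V]] by (simp add: space_PiM)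
  qed (auto simp: space_PiM)
  then have law: "measure P (V -` C \<inter> space P) = measure P ((\<lambda>\<omega>. V (levy_shift u \<omega>)) -` C \<inter> space P)"
    if "C \<in> sets ?M" for C
    using measure_distr[OF V that] measure_distr[OF V_shift that] by simp
  \<comment> \<open>Values are recovered from increments: the partial sum up to node
    \<open>j\<close> minus that up to node \<open>k\<close>, since the path vanishes at
    \<open>\<tau> k = 0\<close>.\<close>
  let ?C = "{x \<in> space ?M. \<forall>j\<in>{..n}. (\<Sum>i<j. x i) - (\<Sum>i<k. x i) \<in> A (\<tau> j)}"
  have C: "?C \<in> sets ?M"
  proof (rule sets.sets_Collect_finite_All)
    fix j assume j: "j \<in> {..n}"
    have "(\<lambda>x. (\<Sum>i<j. x i) - (\<Sum>i<k. x i)) \<in> borel_measurable ?M"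
      using j k(1) by (intro borel_measurable_diff borel_measurable_sum measurable_component_singleton) auto
    moreover have "A (\<tau> j) \<in> sets borel"
      using A j by (auto simp: T_eq)
    ultimately have "(\<lambda>x. (\<Sum>i<j. x i) - (\<Sum>i<k. x i)) -` A (\<tau> j) \<inter> space ?M \<in> sets ?M"
      by (rule measurable_sets)
    then show "{x \<in> space ?M. (\<Sum>i<j. x i) - (\<Sum>i<k. x i) \<in> A (\<tau> j)} \<in> sets ?M"
      by (simp add: vimage_def Int_def conj_commute)
  qed simp
  have V_C: "V \<eta> \<in> ?C \<longleftrightarrow> (\<forall>t\<in>T. \<eta> t \<in> A t)" if "\<eta> \<in> Omega0" for \<eta>
  proof -
    have sum: "(\<Sum>i<j. V \<eta> i) = \<eta> (\<tau> j) - \<eta> (\<tau> 0)" if "j \<le> n" for j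
      using that by (induction j) (auto simp: V_def)
    have "(\<Sum>i<j. V \<eta> i) - (\<Sum>i<k. V \<eta> i) = \<eta> (\<tau> j)" if "j \<le> n" for j
      using sum[OF that] sum[OF k(1)] k(2) \<open>\<eta> \<in> Omega0\<close> by (simp add: Omega0_def)
    moreover have "V \<eta> \<in> space ?M"
      by (simp add: V_def space_PiM)
    ultimately show ?thesis
      by (auto simp: T_eq)
  qed
  have "V -` ?C \<inter> space P = {\<omega> \<in> Omega0. \<forall>t\<in>T. \<omega> t \<in> A t}"
    unfolding sp using V_C by blast
  moreover have "(\<lambda>\<omega>. V (levy_shift u \<omega>)) -` ?C \<inter> space P = {\<omega> \<in> Omega0. \<forall>t\<in>T. levy_shift u \<omega> t \<in> A t}"
    unfolding sp using V_C levy_shift_Omega0 by blast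
  ultimately show ?thesis
    using law[OF C] by simp
qed

lemma wiener_shift_invariant:
  assumes P: "two_sided_wiener P"
  shows "distr P P (levy_shift u) = P"
proof -
  interpret prob_space P by (rule two_sided_wienerD(1)[OF P])
  note sp = two_sided_wienerD(3)[OF P]
  \<comment> \<open>The comparison takes place in the full product space, where a measure is
    determined by finite cylinders; the events in \<open>P\<close> are traces of product-measurable
    sets.\<close>
  let ?R = "Pi\<^sub>M UNIV (\<lambda>_. borel) :: (real \<Rightarrow> real) measure"
  have id: "(\<lambda>\<omega>. \<omega>) \<in> P \<rightarrow>\<^sub>M ?R"
    using measurable_restrict[of UNIV "\<lambda>t \<omega>. \<omega> t" P "\<lambda>_. borel"] measurable_two_sided_wiener_eval[OF P]
    by (simp add: restrict_UNIV)
  have sh: "levy_shift u \<in> P \<rightarrow>\<^sub>M ?R"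
    using measurable_compose[OF measurable_levy_shift[OF P] id] .
  have "distr P ?R (\<lambda>\<omega>. \<omega>) = distr P ?R (levy_shift u)"
  proof (rule measure_eqI_PiM_infinite)
    fix B :: "real \<Rightarrow> real set" and J :: "real set"
    assume J: "finite J" "J \<subseteq> UNIV" and B: "\<And>i. i \<in> J \<Longrightarrow> B i \<in> sets borel"
    let ?X = "prod_emb UNIV (\<lambda>_. borel) J (Pi\<^sub>E J B)"
    \<comment> \<open>The two extra nodes required of a grid are added without a constraint.\<close>
    define T where "T = insert 0 (insert (- u) J)"
    define A where "A t = (if t \<in> J then B t else UNIV)" for t
    have X: "?X \<in> sets ?R"
      using J B by (intro sets_PiM_I) auto
    have "\<omega> \<in> ?X \<longleftrightarrow> (\<forall>t\<in>T. \<omega> t \<in> A t)" for \<omega>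
      by (auto simp: prod_emb_iff T_def A_def PiE_iff)
    then have "(\<lambda>\<omega>. \<omega>) -` ?X \<inter> space P = {\<omega> \<in> Omega0. \<forall>t\<in>T. \<omega> t \<in> A t}"
        "levy_shift u -` ?X \<inter> space P = {\<omega> \<in> Omega0. \<forall>t\<in>T. levy_shift u \<omega> t \<in> A t}"
      unfolding sp by blast+
    moreover have "measure P {\<omega> \<in> Omega0. \<forall>t\<in>T. levy_shift u \<omega> t \<in> A t} = measure P {\<omega> \<in> Omega0. \<forall>t\<in>T. \<omega> t \<in> A t}"
      using J B by (intro wiener_shift_cylinder P) (auto simp: T_def A_def)
    ultimately show "emeasure (distr P ?R (\<lambda>\<omega>. \<omega>)) ?X = emeasure (distr P ?R (levy_shift u)) ?X"
      using X by (simp only: emeasure_distr[OF id] emeasure_distr[OF sh] emeasure_eq_measure)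
  qed (auto intro: prob_space.finite_measure prob_space_distr id)
  show ?thesis
  proof (rule measure_eqI)
    fix X assume "X \<in> sets (distr P P (levy_shift u))"
    then have X: "X \<in> sets P" by simp
    then have "X \<in> sets (path_field UNIV)"
      by (simp add: two_sided_wienerD(2)[OF P])
    then obtain C where C: "C \<in> sets ?R" "X = (\<lambda>\<omega>. \<omega>) -` C \<inter> Omega0"
      unfolding path_field_def
      by (subst (asm) sets_vimage_algebra2) (auto simp: space_PiM restrict_UNIV)
    have "levy_shift u -` X \<inter> space P = levy_shift u -` C \<inter> space P"
      using C(2) levy_shift_Omega0 by (auto simp: sp)
    then have "emeasure (distr P P (levy_shift u)) X = emeasure (distr P ?R (levy_shift u)) C"
      using X C(1) measurable_levy_shift[OF P] sh by (simp add: emeasure_distr)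
    also have "\<dots> = emeasure (distr P ?R (\<lambda>\<omega>. \<omega>)) C"
      using \<open>distr P ?R (\<lambda>\<omega>. \<omega>) = distr P ?R (levy_shift u)\<close> by simp
    also have "\<dots> = emeasure P X"
      using C id by (simp add: emeasure_distr sp)
    finally show "emeasure (distr P P (levy_shift u)) X = emeasure P X" .
  qed simp
qed

lemma AE_levy_shift:
  assumes P: "two_sided_wiener P" and "AE \<omega> in P. Q \<omega>"
  shows "AE \<omega> in P. Q (levy_shift u \<omega>)"
proof -
  obtain N where N: "N \<in> sets P" "emeasure P N = 0" "{\<omega> \<in> space P. \<not> Q \<omega>} \<subseteq> N"
    using assms(2) by (auto elim: AE_E)
  have "emeasure P (levy_shift u -` N \<inter> space P) = emeasure (distr P P (levy_shift u)) N"
    using N(1) measurable_levy_shift[OF P] by (simp add: emeasure_distr)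
  then have "emeasure P (levy_shift u -` N \<inter> space P) = 0"
    using N(2) by (simp add: wiener_shift_invariant[OF P])
  moreover have "{\<omega> \<in> space P. \<not> Q (levy_shift u \<omega>)} \<subseteq> levy_shift u -` N \<inter> space P"
    using N(3) measurable_space[OF measurable_levy_shift[OF P]] by auto
  ultimately show ?thesis
    using measurable_sets[OF measurable_levy_shift[OF P] N(1)] by (intro AE_I)
qed


section \<open>Local and stationary sets\<close>

definition coffin_val :: "real option \<Rightarrow> real" where
  "coffin_val z = (case z of None \<Rightarrow> 0 | Some x \<Rightarrow> x)"

lemma coffin_val_Some [simp]: "coffin_val (Some x) = x"
  by (simp add: coffin_val_def)

lemma measurable_coffin_val [measurable]: "coffin_val \<in> borel_measurable borel_coffin"
proof -
  have "case_option 0 (\<lambda>x. x) \<in> borel_coffin \<rightarrow>\<^sub>M borel"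
    by (rule measurable_case_coffin) auto
  then show ?thesis
    unfolding coffin_val_def .
qed

lemma pred_coffin_None [measurable]: "Measurable.pred borel_coffin (\<lambda>z. z = None)"
  using sets_borel_coffin_None by (simp add: pred_def)

lemma mem_seq_set_coffin_val: "x \<in> seq_set s \<longleftrightarrow> (\<exists>i. s i \<noteq> None \<and> coffin_val (s i) = x)"
proof -
  have "s i \<noteq> None \<and> coffin_val (s i) = x \<longleftrightarrow> Some x = s i" for i
    by (cases "s i") auto
  then show ?thesis
    by (simp add: seq_set_def image_iff)
qed

lemma countable_seq_set: "countable (seq_set s)"
proof (rule countable_subset)
  show "seq_set s \<subseteq> (\<lambda>i. the (s i)) ` UNIV"
  proof
    fix x assume "x \<in> seq_set s"
    then obtain i where "Some x = s i"
      by (auto simp: seq_set_def image_iff)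
    then have "x = the (s i)"
      by (metis option.sel)
    then show "x \<in> (\<lambda>i. the (s i)) ` UNIV"
      by blast
  qed
qed simp

text \<open>To modify a coffin-valued variable on a null set, encode \<open>\<dagger>\<close> as \<open>0\<close> and
  a real \<open>x\<close> as \<open>exp x\<close>, and approximate by simple functions.\<close>

lemma coffin_measurable_version:
  assumes sp: "space F = space G" "space G = space W"
    and ver: "\<And>E. E \<in> sets G \<Longrightarrow> \<exists>E'\<in>sets F. AE \<omega> in W. \<omega> \<in> E \<longleftrightarrow> \<omega> \<in> E'"
    and f: "f \<in> G \<rightarrow>\<^sub>M borel_coffin"
  shows "\<exists>f'. f' \<in> F \<rightarrow>\<^sub>M borel_coffin \<and> (AE \<omega> in W. f \<omega> = f' \<omega>)"
proof -
  have *: "\<exists>g'\<in>borel_measurable F. AE \<omega> in W. g \<omega> = g' \<omega>" if "g \<in> borel_measurable G"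
    for g :: "'a \<Rightarrow> ennreal"
    using that
  proof (induction rule: borel_measurable_induct)
    case (cong f g)
    have "AE \<omega> in W. f \<omega> = g \<omega>"
      using cong(3) by (intro AE_I2) (simp add: sp)
    moreover obtain g' where "g' \<in> borel_measurable F" "AE \<omega> in W. g \<omega> = g' \<omega>"
      using cong.IH by blast
    ultimately show ?case
      by (intro bexI[of _ g']) auto
  next
    case (set A)
    obtain A' where A': "A' \<in> sets F" "AE \<omega> in W. \<omega> \<in> A \<longleftrightarrow> \<omega> \<in> A'"
      using ver[OF set] by blast
    have "AE \<omega> in W. indicator A \<omega> = (indicator A' \<omega> :: ennreal)"
      using A'(2) by eventually_elim (simp add: indicator_def)
    then show ?case
      using A'(1) by (intro bexI[of _ "indicator A'"]) auto
  next
    case (mult u c)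
    obtain u' where u': "u' \<in> borel_measurable F" "AE \<omega> in W. u \<omega> = u' \<omega>"
      using mult.IH by blast
    have "AE \<omega> in W. c * u \<omega> = c * u' \<omega>"
      using u'(2) by eventually_elim simp
    then show ?case
      using u'(1) by (intro bexI[of _ "\<lambda>\<omega>. c * u' \<omega>"]) auto
  next
    case (add u v)
    obtain u' where u': "u' \<in> borel_measurable F" "AE \<omega> in W. u \<omega> = u' \<omega>"
      using add.IH(1) by blast
    obtain v' where v': "v' \<in> borel_measurable F" "AE \<omega> in W. v \<omega> = v' \<omega>"
      using add.IH(2) by blast
    have "AE \<omega> in W. v \<omega> + u \<omega> = v' \<omega> + u' \<omega>"
      using u'(2) v'(2) by eventually_elim simp
    then show ?case
      using u'(1) v'(1) by (intro bexI[of _ "\<lambda>\<omega>. v' \<omega> + u' \<omega>"]) auto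
  next
    case (seq U)
    have "\<exists>u'. u' \<in> borel_measurable F \<and> (AE \<omega> in W. U i \<omega> = u' \<omega>)" for i
      using seq.IH[of i] by blast
    from choice[OF allI[OF this]] obtain U'
      where U': "\<forall>i. U' i \<in> borel_measurable F \<and> (AE \<omega> in W. U i \<omega> = U' i \<omega>)" ..
    then have "AE \<omega> in W. \<forall>i. U i \<omega> = U' i \<omega>"
      by (simp add: AE_all_countable)
    then have "AE \<omega> in W. (SUP i. U i) \<omega> = (SUP i. U' i \<omega>)"
      by eventually_elim (simp only: SUP_apply)
    moreover have "(\<lambda>\<omega>. SUP i. U' i \<omega>) \<in> borel_measurable F"
      using U' by (intro borel_measurable_SUP) auto
    ultimately show ?case
      using seq.hyps by (intro bexI[of _ "\<lambda>\<omega>. SUP i. U' i \<omega>"]) auto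
  qed
  define c where "c = case_option 0 (\<lambda>x. ennreal (exp x))"
  define d where "d y = (if y = 0 then None else Some (ln (enn2real y)))" for y :: ennreal
  have dc: "d (c z) = z" for z
    by (cases z) (simp_all add: c_def d_def)
  have "c \<in> borel_measurable borel_coffin"
    unfolding c_def by (rule measurable_case_coffin) auto
  then have "(\<lambda>\<omega>. c (f \<omega>)) \<in> borel_measurable G"
    by (rule measurable_compose[OF f])
  from *[OF this] obtain g where g: "g \<in> borel_measurable F" "AE \<omega> in W. c (f \<omega>) = g \<omega>"
    by blast
  have "d \<in> borel \<rightarrow>\<^sub>M borel_coffin"
    unfolding d_def by measurable
  from measurable_compose[OF g(1) this] have "(\<lambda>\<omega>. d (g \<omega>)) \<in> F \<rightarrow>\<^sub>M borel_coffin" .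
  moreover have "AE \<omega> in W. f \<omega> = d (g \<omega>)"
    using g(2) by eventually_elim (metis dc)
  ultimately show ?thesis by blast
qed

lemma version_sigma_sets:
  assumes sub: "C \<subseteq> Pow (space W)" and F: "space F = space W"
    and ver: "\<And>E. E \<in> C \<Longrightarrow> \<exists>E'\<in>sets F. AE \<omega> in W. \<omega> \<in> E \<longleftrightarrow> \<omega> \<in> E'"
    and "E \<in> sigma_sets (space W) C"
  shows "\<exists>E'\<in>sets F. AE \<omega> in W. \<omega> \<in> E \<longleftrightarrow> \<omega> \<in> E'"
  using assms(4)
proof (induction rule: sigma_sets.induct)
  case (Basic E)
  then show ?case by (rule ver)
next
  case Empty
  then show ?case by (intro bexI[of _ "{}"]) auto
next
  case (Compl E)
  then obtain E' where E': "E' \<in> sets F" "AE \<omega> in W. \<omega> \<in> E \<longleftrightarrow> \<omega> \<in> E'" by blast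
  have "AE \<omega> in W. \<omega> \<in> space W - E \<longleftrightarrow> \<omega> \<in> space F - E'"
    using E'(2) by eventually_elim (simp add: F)
  then show ?case
    using E'(1) by (intro bexI[of _ "space F - E'"]) auto
next
  case (Union E)
  have "\<exists>E'. E' \<in> sets F \<and> (AE \<omega> in W. \<omega> \<in> E i \<longleftrightarrow> \<omega> \<in> E')" for i
    using Union.IH[of i] by blast
  from choice[OF allI[OF this]] obtain E'
    where E': "\<forall>i. E' i \<in> sets F \<and> (AE \<omega> in W. \<omega> \<in> E i \<longleftrightarrow> \<omega> \<in> E' i)" ..
  then have "AE \<omega> in W. \<forall>i. \<omega> \<in> E i \<longleftrightarrow> \<omega> \<in> E' i"
    by (simp add: AE_all_countable)
  then have "AE \<omega> in W. \<omega> \<in> (\<Union>i. E i) \<longleftrightarrow> \<omega> \<in> (\<Union>i. E' i)"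
    by eventually_elim simp
  then show ?case
    using E' by (intro bexI[of _ "\<Union>i. E' i"]) auto
qed

text \<open>Shifts compose additively, so the stationarity of a visiting set holds path by
  path.\<close>

lemma visiting_set_levy_shift: "visiting_set A \<omega> = (\<lambda>x. u + x) ` visiting_set A (levy_shift u \<omega>)"
proof (intro set_eqI iffI)
  fix t assume "t \<in> visiting_set A \<omega>"
  then show "t \<in> (\<lambda>x. u + x) ` visiting_set A (levy_shift u \<omega>)"
    by (intro image_eqI[of _ _ "t - u"]) (auto simp: visiting_set_def levy_shift_levy_shift)
qed (auto simp: visiting_set_def levy_shift_levy_shift)

lemma AE_lborel_translation:
  assumes "AE v in lborel. Q v"
  shows "AE u in lborel. Q (t + u :: real)"
proof -
  obtain N where N: "N \<in> sets lborel" "emeasure lborel N = 0" "{v \<in> space lborel. \<not> Q v} \<subseteq> N"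
    using assms by (auto elim: AE_E)
  have meas: "(+) t -` N \<inter> space lborel \<in> sets lborel"
    using N(1) by (intro measurable_sets[of _ lborel lborel]) auto
  have "emeasure lborel ((+) t -` N \<inter> space lborel) = emeasure (distr lborel borel ((+) t)) N"
    using N(1) by (subst emeasure_distr) auto
  also have "\<dots> = 0"
    using N(2) by (simp add: lborel_distr_plus)
  finally show ?thesis
    using N(3) meas by (intro AE_I[of _ _ "(+) t -` N \<inter> space lborel"]) auto
qed

section \<open>Visiting sets of germ events\<close>

context
  fixes P W :: "(real \<Rightarrow> real) measure"
  assumes P: "two_sided_wiener P" and W: "W = completion P"
begin

interpretation prob_space P
  by (rule two_sided_wienerD(1)[OF P])

lemma space_W: "space W = Omega0"
  by (simp add: W two_sided_wienerD(3)[OF P])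

lemma prob_space_W: "prob_space W"
  by (rule prob_spaceI) (simp add: W emeasure_space_1)

lemma AE_W_iff: "(AE \<omega> in W. Q \<omega>) \<longleftrightarrow> (AE \<omega> in P. Q \<omega>)"
  unfolding W by (rule AE_completion_iff)

lemma AE_W_levy_shift: "AE \<omega> in W. Q \<omega> \<Longrightarrow> AE \<omega> in W. Q (levy_shift u \<omega>)"
  unfolding AE_W_iff by (rule AE_levy_shift[OF P])

lemma increment_generators:
  "{(\<lambda>\<omega>. \<omega> v - \<omega> u) -` E \<inter> Omega0 | u v E.
     s \<le> ereal u \<and> u \<le> v \<and> ereal v \<le> t \<and> E \<in> sets (borel :: real measure)} \<union>
   {N \<in> sets W. measure W N = 0 \<or> measure W N = 1} \<subseteq> Pow Omega0"
  using sets.sets_into_space[of _ W] by (auto simp: space_W)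

lemma space_increment_field: "space (increment_field W s t) = Omega0"
  unfolding increment_field_def by (rule space_measure_of[OF increment_generators])

lemma sets_increment_field: "sets (increment_field W s t) = sigma_sets Omega0
    ({(\<lambda>\<omega>. \<omega> v - \<omega> u) -` E \<inter> Omega0 | u v E.
       s \<le> ereal u \<and> u \<le> v \<and> ereal v \<le> t \<and> E \<in> sets (borel :: real measure)} \<union>
     {N \<in> sets W. measure W N = 0 \<or> measure W N = 1})"
  unfolding increment_field_def by (rule sets_measure_of[OF increment_generators])

lemma subalgebra_increment_field: "subalgebra W (increment_field W s t)"
proof -
  have "(\<lambda>\<omega>. \<omega> v - \<omega> u) -` E \<inter> Omega0 \<in> sets W" if "E \<in> sets borel" for u v :: real and E
  proof -
    have "(\<lambda>\<omega>. \<omega> v - \<omega> u) \<in> borel_measurable W"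
      unfolding W by (intro measurable_completion borel_measurable_diff measurable_two_sided_wiener_eval P)
    from measurable_sets[OF this that] show ?thesis
      by (simp add: space_W)
  qed
  then have "sets (increment_field W s t) \<subseteq> sets W"
    unfolding sets_increment_field space_W[symmetric]
    by (intro sets.sigma_sets_subset) (auto simp: space_W)
  then show ?thesis
    by (simp add: subalgebra_def space_increment_field space_W)
qed

lemma null_sets_increment_field: "N \<in> null_sets W \<Longrightarrow> N \<in> sets (increment_field W s t)"
  unfolding sets_increment_field by (rule sigma_sets.Basic) (auto simp: measure_def)

lemma measurable_increment:
  assumes "s \<le> ereal x" "ereal x \<le> t" "s \<le> ereal y" "ereal y \<le> t"
  shows "(\<lambda>\<omega>. \<omega> x - \<omega> y) \<in> borel_measurable (increment_field W s t)"
proof -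
  have incr: "(\<lambda>\<omega>. \<omega> v - \<omega> u) \<in> borel_measurable (increment_field W s t)"
    if "u \<le> v" "s \<le> ereal u" "ereal v \<le> t" for u v
  proof (rule measurableI)
    fix E assume "E \<in> sets (borel :: real measure)"
    then show "(\<lambda>\<omega>. \<omega> v - \<omega> u) -` E \<inter> space (increment_field W s t) \<in> sets (increment_field W s t)"
      using that unfolding space_increment_field sets_increment_field
      by (intro sigma_sets.Basic UnI1) blast
  qed simp
  show ?thesis
  proof (cases "y \<le> x")
    case True
    then show ?thesis using incr assms by blast
  next
    case False
    then have "(\<lambda>\<omega>. - (\<omega> y - \<omega> x)) \<in> borel_measurable (increment_field W s t)"
      using assms by (intro borel_measurable_uminus incr) auto
    then show ?thesis by simp
  qed
qed

text \<open>All null events belong to the increment field by definition, so restricting the complete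
  measure \<open>W\<close> to it loses no null sets. Selection over the restricted space thus yields
  variables measurable in the increments.\<close>

lemma restr_increment_field:
  defines "N \<equiv> \<lambda>s t. restr_to_subalg W (increment_field W s t)"
  shows "finite_measure (N s t)" "complete_measure (N s t)"
    and "(AE \<omega> in N s t. Q \<omega>) \<longleftrightarrow> (AE \<omega> in W. Q \<omega>)"
proof -
  note sub = subalgebra_increment_field[of s t]
  interpret W: complete_measure W
    unfolding W by (rule completion.complete_measure_axioms)
  show "finite_measure (N s t)"
    unfolding N_def
    by (intro finite_measure_restr_to_subalg sub prob_space.finite_measure prob_space_W)
  show "complete_measure (N s t)"
  proof
    fix A B assume "B \<subseteq> A" "A \<in> null_sets (N s t)"
    then have "B \<in> null_sets W"
      using W.complete2 by (auto simp: N_def null_sets_restr_to_subalg[OF sub])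
    then show "B \<in> sets (N s t)"
      using null_sets_increment_field by (simp add: N_def sets_restr_to_subalg[OF sub])
  qed
  show "(AE \<omega> in N s t. Q \<omega>) \<longleftrightarrow> (AE \<omega> in W. Q \<omega>)"
  proof
    assume "AE \<omega> in W. Q \<omega>"
    then have "{\<omega> \<in> space W. \<not> Q \<omega>} \<in> null_sets W"
      by (simp add: W.AE_iff_null_sets)
    then have "{\<omega> \<in> space W. \<not> Q \<omega>} \<in> null_sets (N s t)"
      using null_sets_increment_field by (simp add: N_def null_sets_restr_to_subalg[OF sub])
    then show "AE \<omega> in N s t. Q \<omega>"
      by (rule AE_I') (simp add: N_def space_restr_to_subalg)
  next
    assume "AE \<omega> in N s t. Q \<omega>"
    then show "AE \<omega> in W. Q \<omega>"
      unfolding N_def by (rule AE_restr_to_subalg[OF sub])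
  qed
qed

text \<open>A germ event may be tested on any window around the time. For times in a rational
  interval with margin \<epsilon> inside the range from \<open>s\<close> to \<open>t\<close>, a
  window of size \<epsilon> uses only increments in that range, and countably many such intervals
  exhaust the open one.\<close>

lemma sets_visiting_graph:
  assumes A: "A \<in> germ_field"
  shows "{(x, \<omega>). \<omega> \<in> Omega0 \<and> s < ereal x \<and> ereal x < t \<and> levy_shift x \<omega> \<in> A}
    \<in> sets (borel \<Otimes>\<^sub>M increment_field W s t)"
proof -
  let ?F = "increment_field W s t"
  \<comment> \<open>Clamping to the rational interval changes nothing on this set, but makes the
    shifted path depend on the permitted increments for every value of the parameter.\<close>
  define D where "D = (\<lambda>(a, b, m :: nat). {p \<in> space (borel \<Otimes>\<^sub>M ?F).
    fst p \<in> {of_rat a..of_rat b} \<and> levy_shift (max (of_rat a) (min (of_rat b) (fst p))) (snd p) \<in> A})"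
  define I where "I = {(a, b, m :: nat). of_rat a \<le> (of_rat b :: real) \<and>
    s \<le> ereal (of_rat a - 1 / Suc m) \<and> ereal (of_rat b + 1 / Suc m) \<le> t}"
  have "D i \<in> sets (borel \<Otimes>\<^sub>M ?F)" if i: "i \<in> I" for i
  proof -
    obtain a b m where i_eq: "i = (a, b, m)" by (cases i)
    define \<epsilon> where "\<epsilon> = 1 / real (Suc m)"
    have \<epsilon>: "\<epsilon> > 0" by (simp add: \<epsilon>_def)
    have ab: "of_rat a \<le> (of_rat b :: real)" "s \<le> ereal (of_rat a - \<epsilon>)" "ereal (of_rat b + \<epsilon>) \<le> t"
      using i by (auto simp: I_def i_eq \<epsilon>_def)
    let ?c = "\<lambda>x::real. max (of_rat a) (min (of_rat b) x)"
    have between: "s \<le> ereal x \<and> ereal x \<le> t" if "x \<in> {of_rat a - \<epsilon>..of_rat b + \<epsilon>}" for x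
      using that ab by (meson atLeastAtMost_iff ereal_less_eq(3) order_trans)
    have "A \<in> sets (path_field {-\<epsilon><..<\<epsilon>})"
      using A \<epsilon> by (auto simp: germ_field_path_field)
    moreover have "(\<lambda>p. levy_shift (?c (fst p)) (snd p)) \<in> borel \<Otimes>\<^sub>M ?F \<rightarrow>\<^sub>M path_field {-\<epsilon><..<\<epsilon>}"
    proof (rule measurable_levy_shift_pair[where J="{of_rat a - \<epsilon>..of_rat b + \<epsilon>}"])
      show "(\<lambda>\<omega>. \<omega> x - \<omega> y) \<in> borel_measurable ?F"
        if "x \<in> {of_rat a - \<epsilon>..of_rat b + \<epsilon>}" "y \<in> {of_rat a - \<epsilon>..of_rat b + \<epsilon>}" for x y
        using between[OF that(1)] between[OF that(2)] by (intro measurable_increment) auto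
      show "continuous_on UNIV ?c"
        by (intro continuous_on_max continuous_on_min continuous_on_const continuous_on_id)
    qed (use ab(1) \<epsilon> in \<open>auto simp: space_increment_field\<close>)
    ultimately have "(\<lambda>p. levy_shift (?c (fst p)) (snd p)) -` A \<inter> space (borel \<Otimes>\<^sub>M ?F) \<in> sets (borel \<Otimes>\<^sub>M ?F)"
      by (rule measurable_sets[rotated])
    moreover have "{of_rat a..of_rat b} \<times> space ?F \<in> sets ((borel :: real measure) \<Otimes>\<^sub>M ?F)"
      by (intro pair_measureI) auto
    moreover have "D i = ((\<lambda>p. levy_shift (?c (fst p)) (snd p)) -` A \<inter> space (borel \<Otimes>\<^sub>M ?F)) \<inter>
        ({of_rat a..of_rat b} \<times> space ?F)"
      by (auto simp: D_def i_eq space_pair_measure)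
    ultimately show ?thesis
      by (simp only: sets.Int)
  qed
  then have "(\<Union>i\<in>I. D i) \<in> sets (borel \<Otimes>\<^sub>M ?F)"
    by (intro sets.countable_UN'') auto
  moreover have "{(x, \<omega>). \<omega> \<in> Omega0 \<and> s < ereal x \<and> ereal x < t \<and> levy_shift x \<omega> \<in> A} = (\<Union>i\<in>I. D i)"
  proof (intro set_eqI iffI)
    fix p assume "p \<in> {(x, \<omega>). \<omega> \<in> Omega0 \<and> s < ereal x \<and> ereal x < t \<and> levy_shift x \<omega> \<in> A}"
    then obtain x \<omega> where p: "p = (x, \<omega>)" "\<omega> \<in> Omega0" "s < ereal x" "ereal x < t" "levy_shift x \<omega> \<in> A"
      by auto
    obtain y1 where y1: "s < ereal y1" "y1 < x"
      using ereal_dense2[OF p(3)] by auto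
    obtain y2 where y2: "x < y2" "ereal y2 < t"
      using ereal_dense2[OF p(4)] by auto
    obtain a where a: "y1 < of_rat a" "of_rat a < x"
      using of_rat_dense[OF y1(2)] by blast
    obtain b where b: "x < of_rat b" "of_rat b < y2"
      using of_rat_dense[OF y2(1)] by blast
    obtain m where m: "1 / real (Suc m) < min (of_rat a - y1) (y2 - of_rat b)"
      using nat_approx_posE[of "min (of_rat a - y1) (y2 - of_rat b)"] a b by auto
    have "s \<le> ereal (of_rat a - 1 / Suc m)"
    proof -
      have "y1 \<le> of_rat a - 1 / Suc m" using m by simp
      then show ?thesis
        using y1(1) by (meson ereal_less_eq(3) less_imp_le order_trans)
    qed
    moreover have "ereal (of_rat b + 1 / Suc m) \<le> t"
    proof -
      have "of_rat b + 1 / Suc m \<le> y2" using m by simp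
      then show ?thesis
        using y2(2) by (meson ereal_less_eq(3) less_imp_le order_trans)
    qed
    ultimately have "(a, b, m) \<in> I"
      using a b by (auto simp: I_def)
    moreover have "p \<in> D (a, b, m)"
      using p a b by (auto simp: D_def space_pair_measure space_increment_field)
    ultimately show "p \<in> (\<Union>i\<in>I. D i)"
      by blast
  next
    fix p assume "p \<in> (\<Union>i\<in>I. D i)"
    then obtain a b m where I: "(a, b, m) \<in> I" and D: "p \<in> D (a, b, m)"
      by auto
    obtain x \<omega> where p: "p = (x, \<omega>)" by (cases p)
    have x: "of_rat a \<le> x" "x \<le> of_rat b" "\<omega> \<in> Omega0" "levy_shift x \<omega> \<in> A"
      using D by (auto simp: D_def p space_pair_measure space_increment_field max_def min_def split: if_splits)
    have pos: "0 < 1 / real (Suc m)"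
      by simp
    have "s < ereal x"
    proof -
      have "of_rat a - 1 / Suc m < x" using x(1) pos by linarith
      moreover have "s \<le> ereal (of_rat a - 1 / Suc m)" using I unfolding I_def by simp
      ultimately show ?thesis by (metis le_less_trans less_ereal.simps(1))
    qed
    moreover have "ereal x < t"
    proof -
      have "x < of_rat b + 1 / Suc m" using x(2) pos by linarith
      moreover have "ereal (of_rat b + 1 / Suc m) \<le> t" using I unfolding I_def by simp
      ultimately show ?thesis by (metis less_le_trans less_ereal.simps(1))
    qed
    ultimately show "p \<in> {(x, \<omega>). \<omega> \<in> Omega0 \<and> s < ereal x \<and> ereal x < t \<and> levy_shift x \<omega> \<in> A}"
      using x by (simp add: p)
  qed
  ultimately show ?thesis
    by (simp only:)
qed

lemma visiting_set_enumeration: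
  assumes A: "A \<in> germ_field" and count: "AE \<omega> in W. countable (visiting_set A \<omega>)"
    and M: "AE \<omega> in W. M \<omega> = visiting_set A \<omega>"
  shows "\<exists>S. measurable_enumeration W (increment_field W s t)
    (\<lambda>\<omega>. M \<omega> \<inter> {x. s < ereal x \<and> ereal x < t}) S"
proof -
  let ?N = "restr_to_subalg W (increment_field W s t)"
  let ?D = "{(x, \<omega>). \<omega> \<in> Omega0 \<and> s < ereal x \<and> ereal x < t \<and> levy_shift x \<omega> \<in> A}"
  have sets_N: "sets ?N = sets (increment_field W s t)"
    by (rule sets_restr_to_subalg[OF subalgebra_increment_field])
  have sect: "{x. (x, \<omega>) \<in> ?D} = visiting_set A \<omega> \<inter> {x. s < ereal x \<and> ereal x < t}" if "\<omega> \<in> space W" for \<omega>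
    using that by (auto simp: visiting_set_def space_W)
  have "\<exists>S. (\<forall>i::nat. S i \<in> ?N \<rightarrow>\<^sub>M borel_coffin) \<and>
    (AE \<omega> in ?N. {x. (x, \<omega>) \<in> ?D} = seq_set (\<lambda>i. S i \<omega>))"
  proof (rule countable_sections_enumeration[OF restr_increment_field(1,2)])
    show "?D \<in> sets (borel \<Otimes>\<^sub>M ?N)"
      using sets_visiting_graph[OF A] sets_pair_measure_cong[OF refl sets_N] by blast
    show "AE \<omega> in ?N. countable {x. (x, \<omega>) \<in> ?D}"
      unfolding restr_increment_field(3)
      using count AE_space
    proof eventually_elim
      case (elim \<omega>)
      then show ?case
        unfolding sect[OF elim(2)] by simp
    qed
  qed
  then obtain S where S: "\<forall>i::nat. S i \<in> ?N \<rightarrow>\<^sub>M borel_coffin"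
      "AE \<omega> in W. {x. (x, \<omega>) \<in> ?D} = seq_set (\<lambda>i. S i \<omega>)"
    unfolding restr_increment_field(3) by blast
  have "AE \<omega> in W. M \<omega> \<inter> {x. s < ereal x \<and> ereal x < t} = seq_set (\<lambda>i. S i \<omega>)"
    using S(2) M AE_space
  proof eventually_elim
    case (elim \<omega>)
    then show ?case
      using sect[OF elim(3)] by simp
  qed
  moreover have "S i \<in> increment_field W s t \<rightarrow>\<^sub>M borel_coffin" for i
    using S(1) measurable_cong_sets[OF sets_N refl] by blast
  ultimately show ?thesis
    unfolding measurable_enumeration_def by blast
qed

lemma visiting_set_properties:
  assumes A: "A \<in> germ_field" and count: "AE \<omega> in W. countable (visiting_set A \<omega>)"
    and M: "AE \<omega> in W. M \<omega> = visiting_set A \<omega>"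
  shows "random_countable_set W M" "local_set W M" "stationary_set W M"
proof -
  show "local_set W M"
    unfolding local_set_def using visiting_set_enumeration[OF assms] by blast
  \<comment> \<open>Intersecting with the whole line changes nothing, so this enumerates
    \<open>M\<close> itself.\<close>
  obtain S where S: "measurable_enumeration W (increment_field W (-\<infinity>) \<infinity>)
      (\<lambda>\<omega>. M \<omega> \<inter> {x. -\<infinity> < ereal x \<and> ereal x < \<infinity>}) S"
    using visiting_set_enumeration[OF assms] by blast
  have "S i \<in> W \<rightarrow>\<^sub>M borel_coffin" for i
    using S by (intro measurable_from_subalg[OF subalgebra_increment_field]) (auto simp: measurable_enumeration_def)
  then show "random_countable_set W M"
    using S unfolding random_countable_set_def measurable_enumeration_def by auto
  show "stationary_set W M"
    unfolding stationary_set_def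
  proof
    fix u
    show "AE \<omega> in W. M \<omega> = (\<lambda>x. u + x) ` M (levy_shift u \<omega>)"
      using M AE_W_levy_shift[OF M, of u]
    proof eventually_elim
      case (elim \<omega>)
      then show ?case
        using visiting_set_levy_shift[of A \<omega> u] by simp
    qed
  qed
qed


section \<open>From local stationary sets to germ events\<close>

lemma increment_field_version:
  assumes "f \<in> increment_field W (ereal a) (ereal b) \<rightarrow>\<^sub>M borel_coffin"
  shows "\<exists>f'. f' \<in> path_field {a..b} \<rightarrow>\<^sub>M borel_coffin \<and> (AE \<omega> in W. f \<omega> = f' \<omega>)"
proof (rule coffin_measurable_version[OF _ _ _ assms])
  fix E assume "E \<in> sets (increment_field W (ereal a) (ereal b))"
  then show "\<exists>E'\<in>sets (path_field {a..b}). AE \<omega> in W. \<omega> \<in> E \<longleftrightarrow> \<omega> \<in> E'"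
    unfolding sets_increment_field space_W[symmetric]
  proof (rule version_sigma_sets[rotated -1])
    fix E assume "E \<in> {(\<lambda>\<omega>. \<omega> v - \<omega> u) -` E \<inter> space W | u v E.
         ereal a \<le> ereal u \<and> u \<le> v \<and> ereal v \<le> ereal b \<and> E \<in> sets (borel :: real measure)} \<union>
       {N \<in> sets W. measure W N = 0 \<or> measure W N = 1}"
    then consider u v B where "E = (\<lambda>\<omega>. \<omega> v - \<omega> u) -` B \<inter> space W" "a \<le> u" "u \<le> v" "v \<le> b" "B \<in> sets borel"
      | "E \<in> sets W" "measure W E = 0" | "E \<in> sets W" "measure W E = 1"
      by auto
    \<comment> \<open>Increment events already lie in the uncompleted field; events of probability 0
      and 1 are replaced by the empty set and the whole space.\<close>
    then show "\<exists>E'\<in>sets (path_field {a..b}). AE \<omega> in W. \<omega> \<in> E \<longleftrightarrow> \<omega> \<in> E'"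
    proof cases
      case (1 u v B)
      have "(\<lambda>\<omega>. \<omega> v - \<omega> u) \<in> borel_measurable (path_field {a..b})"
        using 1 by (intro borel_measurable_diff measurable_path_field_eval) auto
      from measurable_sets[OF this 1(5)] have "E \<in> sets (path_field {a..b})"
        by (simp add: 1(1) space_W)
      then show ?thesis by auto
    next
      case 2
      have "emeasure W E = 0"
        using 2(2) by (simp add: finite_measure.emeasure_eq_measure[OF prob_space.finite_measure[OF prob_space_W]])
      then have "AE \<omega> in W. \<omega> \<notin> E"
        using 2(1) by (intro AE_not_in null_setsI)
      then show ?thesis
        by (intro bexI[of _ "{}"]) auto
    next
      case 3
      have "AE \<omega> in W. \<omega> \<in> E"
        using 3 prob_space.AE_in_set_eq_1[OF prob_space_W] by blast
      then have "AE \<omega> in W. \<omega> \<in> E \<longleftrightarrow> \<omega> \<in> space W"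
        using AE_space by eventually_elim simp
      moreover have "space W \<in> sets (path_field {a..b})"
        using sets.top[of "path_field {a..b}"] by (simp add: space_W)
      ultimately show ?thesis by blast
    qed
  next
    show "{(\<lambda>\<omega>. \<omega> v - \<omega> u) -` E \<inter> space W | u v E.
         ereal a \<le> ereal u \<and> u \<le> v \<and> ereal v \<le> ereal b \<and> E \<in> sets (borel :: real measure)} \<union>
       {N \<in> sets W. measure W N = 0 \<or> measure W N = 1} \<subseteq> Pow (space W)"
      using increment_generators by (simp only: space_W)
  qed (simp add: space_W)
qed (simp_all add: space_increment_field space_W)

text \<open>Fubini's theorem will be used over the uncompleted \<open>P\<close>, which calls for an
  enumeration by Borel variables.\<close>

lemma completion_version:
  assumes "f \<in> W \<rightarrow>\<^sub>M borel_coffin"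
  shows "\<exists>f'. f' \<in> P \<rightarrow>\<^sub>M borel_coffin \<and> (AE \<omega> in W. f \<omega> = f' \<omega>)"
proof (rule coffin_measurable_version[OF _ _ _ assms])
  fix E assume "E \<in> sets W"
  then obtain S N N' where E: "E = S \<union> N" "N \<subseteq> N'" "N' \<in> null_sets P" "S \<in> sets P"
    unfolding W by (rule sets_completionE)
  have "AE \<omega> in W. \<omega> \<notin> N'"
    unfolding AE_W_iff using E(3) by (rule AE_not_in)
  then have "AE \<omega> in W. \<omega> \<in> E \<longleftrightarrow> \<omega> \<in> S"
    by eventually_elim (use E(1,2) in auto)
  then show "\<exists>E'\<in>sets P. AE \<omega> in W. \<omega> \<in> E \<longleftrightarrow> \<omega> \<in> E'"
    using E(4) by blast
qed (simp_all add: W)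


text \<open>Whether \<open>t \<in> M\<close> is decided by asking, for almost every \<open>u\<close> near \<open>0\<close>, the enumeration
  \<open>T\<close> of \<open>M\<close> near \<open>0\<close> at the path shifted by \<open>t + u\<close>. By Fubini this absorbs the null sets in the
  definition of stationarity, which depend on the shift, so that the decision is right for all
  \<open>t\<close> simultaneously.\<close>

lemma local_visiting_event:
  assumes S: "\<And>i::nat. S i \<in> P \<rightarrow>\<^sub>M borel_coffin" "AE \<omega> in W. M \<omega> = seq_set (\<lambda>i. S i \<omega>)"
    and stat: "stationary_set W M" and \<epsilon>: "0 < \<epsilon>"
    and T: "\<And>i::nat. T i \<in> path_field {-\<epsilon>..\<epsilon>} \<rightarrow>\<^sub>M borel_coffin"
      "AE \<omega> in W. M \<omega> \<inter> {-\<epsilon><..<\<epsilon>} = seq_set (\<lambda>i. T i \<omega>)"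
  shows "\<exists>A\<in>sets (path_field {-(3 * \<epsilon>)<..<3 * \<epsilon>}). AE \<omega> in W. \<forall>t. levy_shift t \<omega> \<in> A \<longleftrightarrow> t \<in> M \<omega>"
proof -
  \<comment> \<open>A clamped shift of at most \<epsilon>, followed by \<open>T\<close> reading up
    to \<epsilon>, reaches \<open>2 * \<epsilon>\<close>; the open window of radius
    \<open>3 * \<epsilon>\<close> contains this with room to spare.\<close>
  define c where "c u = max (-\<epsilon>) (min \<epsilon> u)" for u
  have c_id: "c u = u" if "u \<in> {-\<epsilon><..<\<epsilon>}" for u
    using that by (simp add: c_def)
  let ?H = "path_field {-(3 * \<epsilon>)<..<3 * \<epsilon>}"
  define Z where "Z i p = T i (levy_shift (c (snd p)) (fst p))" for i and p :: "(real \<Rightarrow> real) \<times> real"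
  have Z[measurable]: "Z i \<in> ?H \<Otimes>\<^sub>M lborel \<rightarrow>\<^sub>M borel_coffin" for i
  proof -
    have "(\<lambda>p. levy_shift (c (fst p)) (snd p)) \<in> borel \<Otimes>\<^sub>M ?H \<rightarrow>\<^sub>M path_field {-\<epsilon>..\<epsilon>}"
    proof (rule measurable_levy_shift_pair[where J="{-(2 * \<epsilon>)..2 * \<epsilon>}"])
      show "(\<lambda>\<omega>. \<omega> x - \<omega> y) \<in> borel_measurable ?H"
        if "x \<in> {-(2 * \<epsilon>)..2 * \<epsilon>}" "y \<in> {-(2 * \<epsilon>)..2 * \<epsilon>}" for x y
        using that \<epsilon> by (intro borel_measurable_diff measurable_path_field_eval) auto
      show "continuous_on UNIV c"
        unfolding c_def by (intro continuous_on_max continuous_on_min continuous_on_const continuous_on_id)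
    qed (use \<epsilon> in \<open>auto simp: c_def\<close>)
    moreover have "(\<lambda>p. (snd p, fst p)) \<in> ?H \<Otimes>\<^sub>M lborel \<rightarrow>\<^sub>M borel \<Otimes>\<^sub>M ?H"
      by measurable
    ultimately have "(\<lambda>p. levy_shift (c (snd p)) (fst p)) \<in> ?H \<Otimes>\<^sub>M lborel \<rightarrow>\<^sub>M path_field {-\<epsilon>..\<epsilon>}"
      using measurable_compose[of "\<lambda>p. (snd p, fst p)" "?H \<Otimes>\<^sub>M lborel" "borel \<Otimes>\<^sub>M ?H"
          "\<lambda>p. levy_shift (c (fst p)) (snd p)"] by simp
    then show ?thesis
      unfolding Z_def by (rule measurable_compose[OF _ T(1)])
  qed
  \<comment> \<open>\<open>B\<close> collects the shifts \<open>u\<close> at which the test fails.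
    Requiring its sections to be Lebesgue-null is a measurable condition on the path, unlike a test
    at each single \<open>u\<close>.\<close>
  define B where "B = {p \<in> space (?H \<Otimes>\<^sub>M lborel). snd p \<in> {-\<epsilon><..<\<epsilon>} \<and>
    (\<forall>i. \<not> (Z i p \<noteq> None \<and> coffin_val (Z i p) = - snd p))}"
  have B: "B \<in> sets (?H \<Otimes>\<^sub>M lborel)"
    unfolding B_def by measurable
  define A where "A = {\<omega> \<in> space ?H. emeasure lborel (Pair \<omega> -` B) = 0}"
  have "(\<lambda>\<omega>. emeasure lborel (Pair \<omega> -` B)) \<in> borel_measurable ?H"
    by (rule lborel.measurable_emeasure_Pair[OF B])
  then have "A \<in> sets ?H"
    unfolding A_def by measurable
  moreover have A_iff: "\<omega> \<in> A \<longleftrightarrow> (AE u in lborel. u \<in> {-\<epsilon><..<\<epsilon>} \<longrightarrow> - u \<in> seq_set (\<lambda>i. T i (levy_shift u \<omega>)))"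
    if "\<omega> \<in> Omega0" for \<omega>
  proof -
    have B\<omega>: "Pair \<omega> -` B = {u \<in> space lborel. \<not> (u \<in> {-\<epsilon><..<\<epsilon>} \<longrightarrow> - u \<in> seq_set (\<lambda>i. T i (levy_shift u \<omega>)))}"
    proof (rule set_eqI)
      fix u
      show "u \<in> Pair \<omega> -` B \<longleftrightarrow>
          u \<in> {u \<in> space lborel. \<not> (u \<in> {-\<epsilon><..<\<epsilon>} \<longrightarrow> - u \<in> seq_set (\<lambda>i. T i (levy_shift u \<omega>)))}"
      proof (cases "u \<in> {-\<epsilon><..<\<epsilon>}")
        case True
        then show ?thesis
          using that c_id[OF True] by (simp add: B_def Z_def mem_seq_set_coffin_val space_pair_measure)
      qed (auto simp: B_def)
    qed
    have "(AE u in lborel. u \<in> {-\<epsilon><..<\<epsilon>} \<longrightarrow> - u \<in> seq_set (\<lambda>i. T i (levy_shift u \<omega>))) \<longleftrightarrow>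
        emeasure lborel (Pair \<omega> -` B) = 0"
      by (rule AE_iff_measurable[OF sets_Pair1[OF B] B\<omega>[symmetric]])
    then show ?thesis
      using that by (simp only: A_def mem_Collect_eq space_path_field simp_thms)
  qed
  moreover have "AE \<omega> in W. \<forall>t. levy_shift t \<omega> \<in> A \<longleftrightarrow> t \<in> M \<omega>"
  proof -
    \<comment> \<open>The local enumeration at the path shifted by \<open>v\<close> agrees with the
      global one inside the window. For fixed \<open>v\<close> this is stationarity together with
      shift invariance.\<close>
    define Good where "Good v \<omega> \<longleftrightarrow>
      (\<forall>x\<in>{-\<epsilon><..<\<epsilon>}. x \<in> seq_set (\<lambda>i. T i (levy_shift v \<omega>)) \<longleftrightarrow> v + x \<in> seq_set (\<lambda>i. S i \<omega>))" for v \<omega>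
    have "AE \<omega> in P. Good v \<omega>" for v
      using AE_W_levy_shift[OF T(2), of v] S(2) stat[unfolded stationary_set_def, rule_format, of v]
      unfolding AE_W_iff
    proof eventually_elim
      case (elim \<omega>)
      have "x \<in> seq_set (\<lambda>i. T i (levy_shift v \<omega>)) \<longleftrightarrow> v + x \<in> seq_set (\<lambda>i. S i \<omega>)"
        if "x \<in> {-\<epsilon><..<\<epsilon>}" for x
      proof -
        have "x \<in> seq_set (\<lambda>i. T i (levy_shift v \<omega>)) \<longleftrightarrow> x \<in> M (levy_shift v \<omega>)"
          using that unfolding elim(1)[symmetric] by blast
        also have "\<dots> \<longleftrightarrow> v + x \<in> M \<omega>"
          unfolding elim(3) by auto
        finally show ?thesis
          unfolding elim(2) .
      qed
      then show ?case
        by (simp add: Good_def)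
    qed
    then have "AE v in lborel. AE \<omega> in P. Good v \<omega>"
      by simp
    moreover have "{p \<in> space (lborel \<Otimes>\<^sub>M P). Good (fst p) (snd p)} \<in> sets (lborel \<Otimes>\<^sub>M P)"
    proof -
      define Y where "Y i p = T i (levy_shift (fst p) (snd p))" for i and p :: "real \<times> (real \<Rightarrow> real)"
      have "(\<lambda>p. levy_shift (fst p) (snd p)) \<in> borel \<Otimes>\<^sub>M P \<rightarrow>\<^sub>M path_field {-\<epsilon>..\<epsilon>}"
        by (rule measurable_levy_shift_pair[where J=UNIV and c="\<lambda>x. x"])
          (auto simp: two_sided_wienerD(3)[OF P] intro!: borel_measurable_diff measurable_two_sided_wiener_eval P)
      then have "(\<lambda>p. levy_shift (fst p) (snd p)) \<in> lborel \<Otimes>\<^sub>M P \<rightarrow>\<^sub>M path_field {-\<epsilon>..\<epsilon>}"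
        using measurable_cong_sets[OF sets_pair_measure_cong[OF sets_lborel refl] refl] by blast
      from measurable_compose[OF this T(1)]
      have [measurable]: "Y i \<in> lborel \<Otimes>\<^sub>M P \<rightarrow>\<^sub>M borel_coffin" for i
        unfolding Y_def .
      note S(1)[measurable]
      \<comment> \<open>The quantifier over uncountably many \<open>x\<close> is traded for
        quantifiers over indices, since only points listed by one of the two enumerations matter.
        This gives joint measurability.\<close>
      have Good_iff: "Good (fst p) (snd p) \<longleftrightarrow>
        (\<forall>i. Y i p \<noteq> None \<and> -\<epsilon> < coffin_val (Y i p) \<and> coffin_val (Y i p) < \<epsilon> \<longrightarrow>
          (\<exists>j. S j (snd p) \<noteq> None \<and> coffin_val (S j (snd p)) = fst p + coffin_val (Y i p))) \<and>
        (\<forall>j. S j (snd p) \<noteq> None \<and> -\<epsilon> < coffin_val (S j (snd p)) - fst p \<and> coffin_val (S j (snd p)) - fst p < \<epsilon> \<longrightarrow>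
          (\<exists>i. Y i p \<noteq> None \<and> coffin_val (Y i p) = coffin_val (S j (snd p)) - fst p))" (is "_ \<longleftrightarrow> ?R p") for p
      proof
        assume G: "Good (fst p) (snd p)"
        have mem: "coffin_val (Y i p) \<in> seq_set (\<lambda>i. T i (levy_shift (fst p) (snd p)))" if "Y i p \<noteq> None" for i
          using that unfolding mem_seq_set_coffin_val Y_def by blast
        have mem': "fst p + (coffin_val (S j (snd p)) - fst p) \<in> seq_set (\<lambda>i. S i (snd p))" if "S j (snd p) \<noteq> None" for j
          using that unfolding mem_seq_set_coffin_val by auto
        show "?R p"
        proof (intro conjI allI impI)
          fix i assume i: "Y i p \<noteq> None \<and> -\<epsilon> < coffin_val (Y i p) \<and> coffin_val (Y i p) < \<epsilon>"
          then have "fst p + coffin_val (Y i p) \<in> seq_set (\<lambda>i. S i (snd p))"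
            using G[unfolded Good_def, rule_format, of "coffin_val (Y i p)"] mem[of i] by auto
          then show "\<exists>j. S j (snd p) \<noteq> None \<and> coffin_val (S j (snd p)) = fst p + coffin_val (Y i p)"
            unfolding mem_seq_set_coffin_val .
        next
          fix j assume j: "S j (snd p) \<noteq> None \<and> -\<epsilon> < coffin_val (S j (snd p)) - fst p \<and> coffin_val (S j (snd p)) - fst p < \<epsilon>"
          then have "coffin_val (S j (snd p)) - fst p \<in> seq_set (\<lambda>i. T i (levy_shift (fst p) (snd p)))"
            using G[unfolded Good_def, rule_format, of "coffin_val (S j (snd p)) - fst p"] mem'[of j] by auto
          then show "\<exists>i. Y i p \<noteq> None \<and> coffin_val (Y i p) = coffin_val (S j (snd p)) - fst p"
            unfolding mem_seq_set_coffin_val Y_def .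
        qed
      next
        assume R: "?R p"
        show "Good (fst p) (snd p)"
          unfolding Good_def
        proof (intro ballI iffI)
          fix x assume x: "x \<in> {-\<epsilon><..<\<epsilon>}" and "x \<in> seq_set (\<lambda>i. T i (levy_shift (fst p) (snd p)))"
          then obtain i where "Y i p \<noteq> None" "coffin_val (Y i p) = x"
            unfolding mem_seq_set_coffin_val Y_def by blast
          then show "fst p + x \<in> seq_set (\<lambda>i. S i (snd p))"
            unfolding mem_seq_set_coffin_val
            using R[THEN conjunct1, rule_format, of i] x by simp
        next
          fix x assume x: "x \<in> {-\<epsilon><..<\<epsilon>}" and "fst p + x \<in> seq_set (\<lambda>i. S i (snd p))"
          then obtain j where "S j (snd p) \<noteq> None" "coffin_val (S j (snd p)) = fst p + x"
            unfolding mem_seq_set_coffin_val by blast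
          then show "x \<in> seq_set (\<lambda>i. T i (levy_shift (fst p) (snd p)))"
            unfolding mem_seq_set_coffin_val
            using R[THEN conjunct2, rule_format, of j] x by (simp add: Y_def)
        qed
      qed
      show ?thesis
        unfolding Good_iff by measurable
    qed
    moreover have "pair_sigma_finite lborel P"
      by (intro pair_sigma_finite.intro lborel.sigma_finite_measure_axioms sigma_finite_measure_axioms)
    \<comment> \<open>After the exchange, one null set of paths serves almost all shifts.\<close>
    ultimately have "AE \<omega> in P. AE v in lborel. Good v \<omega>"
      using pair_sigma_finite.AE_commute by blast
    then have "AE \<omega> in W. AE v in lborel. Good v \<omega>"
      by (simp only: AE_W_iff)
    then show ?thesis
      using S(2) AE_space
    proof eventually_elim
      case (elim \<omega>)
      show ?case
      proof
        fix t
        have \<omega>: "levy_shift t \<omega> \<in> Omega0"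
          using elim(3) levy_shift_Omega0 by (simp add: space_W)
        \<comment> \<open>Any \<open>t\<close> is allowed, because Lebesgue-null sets are
          translation invariant. With \<open>v = t + u\<close> and \<open>x = - u\<close> the point
          \<open>v + x\<close> is \<open>t\<close> for every \<open>u\<close>.\<close>
        have "AE u in lborel. Good (t + u) \<omega>"
          by (rule AE_lborel_translation[OF elim(1)])
        then have "AE u in lborel. (u \<in> {-\<epsilon><..<\<epsilon>} \<longrightarrow> - u \<in> seq_set (\<lambda>i. T i (levy_shift u (levy_shift t \<omega>)))) \<longleftrightarrow>
            (u \<in> {-\<epsilon><..<\<epsilon>} \<longrightarrow> t \<in> M \<omega>)"
        proof eventually_elim
          case (elim u)
          then show ?case
            unfolding Good_def levy_shift_levy_shift \<open>M \<omega> = _\<close>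
            by (auto dest: bspec[of _ _ "- u"])
        qed
        then have "levy_shift t \<omega> \<in> A \<longleftrightarrow> (AE u in lborel. u \<in> {-\<epsilon><..<\<epsilon>} \<longrightarrow> t \<in> M \<omega>)"
          unfolding A_iff[OF \<omega>] by (rule eventually_cong)
        \<comment> \<open>The condition no longer involves \<open>u\<close>, and the window has
          positive length.\<close>
        also have "\<dots> \<longleftrightarrow> t \<in> M \<omega>"
        proof
          assume AE: "AE u in lborel. u \<in> {-\<epsilon><..<\<epsilon>} \<longrightarrow> t \<in> M \<omega>"
          show "t \<in> M \<omega>"
          proof (rule ccontr)
            assume "t \<notin> M \<omega>"
            with AE have "AE u in lborel. u \<notin> {-\<epsilon><..<\<epsilon>}" by simp
            then have "{-\<epsilon><..<\<epsilon>} \<in> null_sets lborel"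
              by (subst AE_iff_null_sets) auto
            then show False
              using \<epsilon> by (simp add: null_sets_def)
          qed
        qed simp
        finally show "levy_shift t \<omega> \<in> A \<longleftrightarrow> t \<in> M \<omega>" .
      qed
    qed
  qed
  ultimately show ?thesis by blast
qed

lemma stationary_local_visiting:
  assumes count: "random_countable_set W M" and loc: "local_set W M" and stat: "stationary_set W M"
  shows "\<exists>A\<in>germ_field. (AE \<omega> in W. countable (visiting_set A \<omega>)) \<and> (AE \<omega> in W. M \<omega> = visiting_set A \<omega>)"
proof -
  \<comment> \<open>Only countably many variables are changed, each on a null set, so the enumerated
    set is almost surely the same.\<close>
  have modify: "\<exists>S'. (\<forall>i. S' i \<in> F \<rightarrow>\<^sub>M borel_coffin) \<and> (AE \<omega> in W. K \<omega> = seq_set (\<lambda>i. S' i \<omega>))"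
    if en: "measurable_enumeration W G K S"
      and ver: "\<And>f. f \<in> G \<rightarrow>\<^sub>M borel_coffin \<Longrightarrow> \<exists>f'. f' \<in> F \<rightarrow>\<^sub>M borel_coffin \<and> (AE \<omega> in W. f \<omega> = f' \<omega>)"
    for F G K S
  proof -
    have "\<exists>f'. f' \<in> F \<rightarrow>\<^sub>M borel_coffin \<and> (AE \<omega> in W. S i \<omega> = f' \<omega>)" for i
      using en by (intro ver) (simp add: measurable_enumeration_def)
    from choice[OF allI[OF this]] obtain S'
      where S': "\<forall>i. S' i \<in> F \<rightarrow>\<^sub>M borel_coffin \<and> (AE \<omega> in W. S i \<omega> = S' i \<omega>)" ..
    then have "AE \<omega> in W. \<forall>i. S i \<omega> = S' i \<omega>"
      by (simp add: AE_all_countable)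
    moreover have "AE \<omega> in W. K \<omega> = seq_set (\<lambda>i. S i \<omega>)"
      using en by (simp add: measurable_enumeration_def)
    ultimately have "AE \<omega> in W. K \<omega> = seq_set (\<lambda>i. S' i \<omega>)"
      by eventually_elim simp
    then show ?thesis
      using S' by blast
  qed
  obtain S0 where "measurable_enumeration W W M S0"
    using count unfolding random_countable_set_def by blast
  from modify[OF this completion_version] obtain S
    where S: "\<forall>i. S i \<in> P \<rightarrow>\<^sub>M borel_coffin" "AE \<omega> in W. M \<omega> = seq_set (\<lambda>i. S i \<omega>)"
    by blast
  define \<epsilon> where "\<epsilon> n = 1 / real (Suc n)" for n
  have \<epsilon>: "0 < \<epsilon> n" for n
    by (simp add: \<epsilon>_def)
  have "\<exists>A. A \<in> sets (path_field {-(3 * \<epsilon> n)<..<3 * \<epsilon> n}) \<and>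
      (AE \<omega> in W. \<forall>t. levy_shift t \<omega> \<in> A \<longleftrightarrow> t \<in> M \<omega>)" for n
  proof -
    have "ereal (- \<epsilon> n) < ereal (\<epsilon> n)"
      using \<epsilon>[of n] by simp
    then obtain T0 where "measurable_enumeration W (increment_field W (ereal (- \<epsilon> n)) (ereal (\<epsilon> n)))
        (\<lambda>\<omega>. M \<omega> \<inter> {x. ereal (- \<epsilon> n) < ereal x \<and> ereal x < ereal (\<epsilon> n)}) T0"
      using loc unfolding local_set_def by blast
    from modify[OF this increment_field_version] obtain T
      where T: "\<forall>i. T i \<in> path_field {-\<epsilon> n..\<epsilon> n} \<rightarrow>\<^sub>M borel_coffin"
        "AE \<omega> in W. M \<omega> \<inter> {x. ereal (- \<epsilon> n) < ereal x \<and> ereal x < ereal (\<epsilon> n)} = seq_set (\<lambda>i. T i \<omega>)"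
      by blast
    have "{x. ereal (- \<epsilon> n) < ereal x \<and> ereal x < ereal (\<epsilon> n)} = {-\<epsilon> n<..<\<epsilon> n}"
      by auto
    with T S \<epsilon>[of n] stat show ?thesis
      using local_visiting_event[of S M "\<epsilon> n" T] by auto
  qed
  from choice[OF allI[OF this]] obtain A where "\<forall>n. A n \<in> sets (path_field {-(3 * \<epsilon> n)<..<3 * \<epsilon> n}) \<and>
      (AE \<omega> in W. \<forall>t. levy_shift t \<omega> \<in> A n \<longleftrightarrow> t \<in> M \<omega>)" ..
  then have A: "\<And>n. A n \<in> sets (path_field {-(3 * \<epsilon> n)<..<3 * \<epsilon> n})"
    and ae: "AE \<omega> in W. \<forall>n t. levy_shift t \<omega> \<in> A n \<longleftrightarrow> t \<in> M \<omega>"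
    by (simp_all add: AE_all_countable)
  \<comment> \<open>The limit inferior ignores any finite number of the \<open>A n\<close>, so it is
    measurable on every window without completion. Almost surely all \<open>A n\<close> give the
    same answer at every shift, hence so does \<open>A\<^sub>0\<close>.\<close>
  define A\<^sub>0 where "A\<^sub>0 = (\<Union>m. \<Inter>n\<in>{m..}. A n)"
  have "A\<^sub>0 \<in> sets (path_field {-\<delta><..<\<delta>})" if "0 < \<delta>" for \<delta>
  proof -
    have "0 < \<delta> / 3"
      using that by simp
    then obtain m where m: "1 / real (Suc m) < \<delta> / 3"
      by (rule nat_approx_posE)
    have "A n \<in> sets (path_field {-\<delta><..<\<delta>})" if "m \<le> n" for n
    proof -
      have "\<epsilon> n \<le> 1 / real (Suc m)"
        unfolding \<epsilon>_def using that by (intro divide_left_mono) auto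
      then have "3 * \<epsilon> n \<le> \<delta>"
        using m by simp
      then show ?thesis
        using A[of n] sets_path_field_mono[of "{-(3 * \<epsilon> n)<..<3 * \<epsilon> n}" "{-\<delta><..<\<delta>}"] by fastforce
    qed
    then have "(\<Inter>n\<in>{k + m..}. A n) \<in> sets (path_field {-\<delta><..<\<delta>})" for k
      by (intro sets.countable_INT') auto
    then have "(\<Union>k. \<Inter>n\<in>{k + m..}. A n) \<in> sets (path_field {-\<delta><..<\<delta>})"
      by blast
    moreover have "A\<^sub>0 = (\<Union>k. \<Inter>n\<in>{k + m..}. A n)"
    proof (intro set_eqI iffI)
      fix x assume "x \<in> A\<^sub>0"
      then obtain k where "\<forall>n\<ge>k. x \<in> A n"
        by (auto simp: A\<^sub>0_def)
      then have "x \<in> (\<Inter>n\<in>{k + m..}. A n)"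
        by auto
      then show "x \<in> (\<Union>k. \<Inter>n\<in>{k + m..}. A n)"
        by blast
    qed (auto simp: A\<^sub>0_def)
    ultimately show ?thesis by simp
  qed
  then have "A\<^sub>0 \<in> germ_field"
    by (simp add: germ_field_path_field)
  moreover have M: "AE \<omega> in W. M \<omega> = visiting_set A\<^sub>0 \<omega>"
    using ae
  proof eventually_elim
    case (elim \<omega>)
    then have "levy_shift t \<omega> \<in> A\<^sub>0 \<longleftrightarrow> t \<in> M \<omega>" for t
      unfolding A\<^sub>0_def by auto
    then show ?case
      by (auto simp: visiting_set_def)
  qed
  moreover have "AE \<omega> in W. countable (visiting_set A\<^sub>0 \<omega>)"
    using M S(2) by eventually_elim (metis countable_seq_set)
  ultimately show ?thesis
    by blast
qed

end

theorem theorem3p31: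
  fixes W :: "(real \<Rightarrow> real) measure"
    and M :: "(real \<Rightarrow> real) \<Rightarrow> real set"
  assumes "completed_wiener W"
  shows "random_countable_set W M \<and> local_set W M \<and> stationary_set W M \<longleftrightarrow>
    (\<exists>A\<in>germ_field. (AE \<omega> in W. countable (visiting_set A \<omega>)) \<and>
                    (AE \<omega> in W. M \<omega> = visiting_set A \<omega>))"
proof -
  obtain P where "two_sided_wiener P" "W = completion P"
    using assms unfolding completed_wiener_def by blast
  note visiting = visiting_set_properties[OF this] and conv = stationary_local_visiting[OF this]
  show ?thesis
  proof
    assume "random_countable_set W M \<and> local_set W M \<and> stationary_set W M"
    then show "\<exists>A\<in>germ_field. (AE \<omega> in W. countable (visiting_set A \<omega>)) \<and>
        (AE \<omega> in W. M \<omega> = visiting_set A \<omega>)"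
      by (intro conv) auto
  next
    assume "\<exists>A\<in>germ_field. (AE \<omega> in W. countable (visiting_set A \<omega>)) \<and>
        (AE \<omega> in W. M \<omega> = visiting_set A \<omega>)"
    then obtain A where "A \<in> germ_field" "AE \<omega> in W. countable (visiting_set A \<omega>)"
        "AE \<omega> in W. M \<omega> = visiting_set A \<omega>"
      by blast
    from visiting[OF this] show "random_countable_set W M \<and> local_set W M \<and> stationary_set W M"
      by blast
  qed
qed

end
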